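(* Let $\mathcal{F}\in\{\mathcal{A},\mathcal{S}\}$. Let $r\ge1$, $(k_1,\dots,k_r)\in\mathbb{Z}_{\ge1}^r$ and $t\in\mathbb{Z}_{\ge0}$. Then \[ \sum_{\substack{m_1+\cdots+m_r=r+t\\ m_i\ge1\,(1\le i\le r)}}\ \sum_{\substack{\mathbf{a}_i\in\mathbb{Z}_{\ge1}^{m_i},\ |\mathbf{a}_i|=k_i+m_i-1\\(1\le i\le r)}}\zeta_{\mathcal{F}}(\mathbf{a}_1,\dots,\mathbf{a}_r) =\sum_{l=0}^{t}\ \sum_{\substack{m_1+\cdots+m_{r-1}=t-l\\ m_i\ge0\,(1\le i\le r-1)}}\ \sum_{\substack{|\mathbf{e}|=l\\ \mathbf{e}\ge0}}\zeta_{\mathcal{F}}\big((k_1,\{1\}^{m_1},\dots,k_{r-1},\{1\}^{m_{r-1}},k_r)+\mathbf{e}\big), \] where $(\mathbf{a}_1,\dots,\mathbf{a}_r)$ denotes concatenation and in the last sum $\mathbf{e}$ ranges over non-negative integer tuples of the same depth as $(k_1,\{1\}^{m_1},\dots,k_{r-1},\{1\}^{m_{r-1}},k_r)$ with sum $l$. When $r=1$, the right-hand side is understood as $\zeta_{\mathcal{F}}(k_1+t)$.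
   Context: Let $\mathcal{A}=\big(\prod_p\mathbb{Z}/p\mathbb{Z}\big)/\big(\bigoplus_p\mathbb{Z}/p\mathbb{Z}\big)$, $p$ running over primes (a $\mathbb{Q}$-algebra). For $k_1,\dots,k_r\in\mathbb{Z}_{\ge1}$, $\zeta_{\mathcal{A}}(k_1,\dots,k_r):=\big(\sum_{p>n_1>\cdots>n_r\ge1}n_1^{-k_1}\cdots n_r^{-k_r}\bmod p\big)_p\in\mathcal{A}$. For $k_1\ge2$, $\zeta(k_1,\dots,k_r)=\sum_{n_1>\cdots>n_r\ge1}n_1^{-k_1}\cdots n_r^{-k_r}$; $\zeta^{*}(k_1,\dots,k_r)$ denotes the harmonic-regularized value (the extension of $\zeta$ to all indices of positive integers that is compatible with the harmonic (stuffle) product and satisfies $\zeta^*(1)=0$, as in Ihara–Kaneko–Zagier), with $\zeta^*(\emptyset)=1$. Let $\mathcal{Z}_{\mathbb{R}}$ be the $\mathbb{Q}$-subspace (a $\mathbb{Q}$-algebra) of $\mathbb{R}$ spanned by $1$ and all multiple zeta values. Set $\zeta^*_{\mathcal{S}}(k_1,\dots,k_r):=\sum_{i=0}^r(-1)^{k_1+\cdots+k_i}\zeta^*(k_i,\dots,k_1)\zeta^*(k_{i+1},\dots,k_r)$ and $\zeta_{\mathcal{S}}(k_1,\dots,k_r):=\zeta^*_{\mathcal{S}}(k_1,\dots,k_r)\bmod \zeta(2)$, an element of $\mathcal{Z}_{\mathbb{R}}/\zeta(2)\mathcal{Z}_{\mathbb{R}}$. For a tuple $\mathbf{k}$, $|\mathbf{k}|$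 is the sum of its entries and its depth is its length; $\mathbf{k}+\mathbf{e}$ is componentwise addition for tuples of equal depth; $\mathbf{e}\ge0$ means all components are non-negative integers; $\{1\}^m$ denotes $m$ entries equal to $1$. *)

theory Defs
  imports
    "HOL-Analysis.Analysis"
    "HOL-Number_Theory.Modular_Inverse"
    "HOL-Real_Asymp.Real_Asymp"
begin

section \<open>Index tuples\<close>

text \<open>An index is a list of natural numbers, its head being the exponent of the largest
  summation variable.\<close>

definition positive_index :: "nat list \<Rightarrow> bool" where
  "positive_index ks \<longleftrightarrow> (\<forall>k\<in>set ks. k \<ge> 1)"

definition admissible :: "nat list \<Rightarrow> bool" where
  "admissible ks \<longleftrightarrow> positive_index ks \<and> (ks = [] \<or> hd ks \<ge> 2)"

definition dec_tuples :: "nat \<Rightarrow> nat set \<Rightarrow> nat list set" where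
  "dec_tuples r S = {ns. length ns = r \<and> sorted_wrt (>) ns \<and> set ns \<subseteq> S}"

definition weak_comps :: "nat \<Rightarrow> nat \<Rightarrow> nat list set" where
  "weak_comps m s = {xs. length xs = m \<and> sum_list xs = s}"

definition comps :: "nat \<Rightarrow> nat \<Rightarrow> nat list set" where
  "comps m s = {xs. length xs = m \<and> sum_list xs = s \<and> positive_index xs}"

text \<open>\<open>insert_ones [k\<^sub>1, \<dots>, k\<^sub>r] [m\<^sub>1, \<dots>, m\<^sub>r\<^sub>-\<^sub>1]\<close> is
  \<open>(k\<^sub>1, {1}\<^bsup>m\<^sub>1\<^esup>, \<dots>, k\<^sub>r\<^sub>-\<^sub>1, {1}\<^bsup>m\<^sub>r\<^sub>-\<^sub>1\<^esup>, k\<^sub>r)\<close>.\<close>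

definition insert_ones :: "nat list \<Rightarrow> nat list \<Rightarrow> nat list" where
  "insert_ones ks ms = concat (map2 (\<lambda>k m. k # replicate m 1) (butlast ks) ms) @ [last ks]"

lemma finite_weak_comps: "finite (weak_comps m s)"
  by (rule finite_subset[of _ "{xs. set xs \<subseteq> {..s} \<and> length xs = m}"])
     (auto simp: weak_comps_def finite_lists_length_eq dest: member_le_sum_list)

lemma finite_comps: "finite (comps m s)"
  by (rule finite_subset[OF _ finite_weak_comps[of m s]]) (auto simp: comps_def weak_comps_def)

text \<open>For \<open>r = 1\<close> the sum over \<open>(m\<^sub>1, \<dots>, m\<^sub>r\<^sub>-\<^sub>1)\<close>
  ranges over the empty tuple, whose sum is \<open>0\<close>; only \<open>l = t\<close> contributes.\<close>

lemma depth_one_sum: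
  fixes f :: "nat list \<Rightarrow> 'a :: comm_monoid_add"
  shows "(\<Sum>l=0..t. \<Sum>ms\<in>weak_comps 0 (t - l). \<Sum>es\<in>weak_comps (length (insert_ones [k] ms)) l.
            f (map2 (+) (insert_ones [k] ms) es)) = f [k + t]"
proof -
  have 0: "weak_comps 0 s = (if s = 0 then {[]} else {})" for s
    by (auto simp: weak_comps_def)
  have 1: "weak_comps (Suc 0) l = {[l]}" for l
    by (auto simp: weak_comps_def length_Suc_conv)
  have "(\<Sum>l=0..t. \<Sum>ms\<in>weak_comps 0 (t - l). \<Sum>es\<in>weak_comps (length (insert_ones [k] ms)) l.
            f (map2 (+) (insert_ones [k] ms) es)) = (\<Sum>l=0..t. if l = t then f [k + t] else 0)"
    by (intro sum.cong refl) (auto simp: 0 1 insert_ones_def)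
  thus ?thesis by simp
qed


section \<open>The ring \<open>\<A>\<close> and finite multiple zeta values\<close>

text \<open>A family in \<open>\<Prod>\<^sub>p \<int>/p\<int>\<close> is represented by a function giving an integer
  representative at each prime (its values at non-primes are irrelevant); two families are
  identified if they differ modulo \<open>p\<close> at finitely many primes \<open>p\<close> only.\<close>

definition A_rel :: "(nat \<Rightarrow> int) \<Rightarrow> (nat \<Rightarrow> int) \<Rightarrow> bool" where
  "A_rel f g \<longleftrightarrow> finite {p. prime p \<and> \<not> [f p = g p] (mod int p)}"

lemma A_rel_iff: "A_rel f g \<longleftrightarrow> (\<forall>\<^sub>F p in cofinite. prime p \<longrightarrow> [f p = g p] (mod int p))"
  by (simp add: A_rel_def eventually_cofinite)

lemma equivp_A_rel: "equivp A_rel"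
proof (rule equivpI)
  show "reflp A_rel" by (simp add: reflp_def A_rel_iff)
  show "symp A_rel" by (simp add: symp_def A_rel_iff cong_sym_eq)
  show "transp A_rel"
    unfolding transp_def A_rel_iff
    by (intro allI impI, erule (1) eventually_elim2) (auto intro: cong_trans)
qed

quotient_type calA = "nat \<Rightarrow> int" / A_rel
  by (rule equivp_A_rel)

instantiation calA :: comm_ring_1
begin

lift_definition zero_calA :: calA is "\<lambda>_. 0" .

lift_definition one_calA :: calA is "\<lambda>_. 1" .

lift_definition plus_calA :: "calA \<Rightarrow> calA \<Rightarrow> calA" is "\<lambda>f g p. f p + g p"
  unfolding A_rel_iff by (erule (1) eventually_elim2) (auto intro: cong_add)

lift_definition minus_calA :: "calA \<Rightarrow> calA \<Rightarrow> calA" is "\<lambda>f g p. f p - g p"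
  unfolding A_rel_iff by (erule (1) eventually_elim2) (auto intro: cong_diff)

lift_definition uminus_calA :: "calA \<Rightarrow> calA" is "\<lambda>f p. - f p"
  unfolding A_rel_iff by (elim eventually_mono) (auto simp: cong_minus_minus_iff)

lift_definition times_calA :: "calA \<Rightarrow> calA \<Rightarrow> calA" is "\<lambda>f g p. f p * g p"
  unfolding A_rel_iff by (erule (1) eventually_elim2) (auto intro: cong_mult)

instance
proof
  show "(0::calA) \<noteq> 1"
  proof transfer
    have "{p::nat. prime p \<and> \<not> [0 = 1] (mod int p)} = {p. prime p}"
      by (auto simp: cong_def dest: prime_gt_1_nat)
    thus "\<not> A_rel (\<lambda>_. 0) (\<lambda>_. 1)"
      using primes_infinite by (simp add: A_rel_def)
  qed
qed (transfer; simp add: A_rel_def algebra_simps)+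

end

definition zeta_A :: "nat list \<Rightarrow> calA" where
  "zeta_A ks = abs_calA (\<lambda>p. \<Sum>ns\<in>dec_tuples (length ks) {1..<p}.
     prod_list (map2 (\<lambda>n k. modular_inverse (int p) (int n) ^ k) ns ks))"


section \<open>Multiple zeta values and the harmonic product\<close>

definition mzv :: "nat list \<Rightarrow> real" where
  "mzv ks = (\<Sum>\<^sub>\<infinity>ns\<in>dec_tuples (length ks) {1..}.
     prod_list (map2 (\<lambda>n k. 1 / real n ^ k) ns ks))"

text \<open>The terms, with multiplicity, of the harmonic product of two indices.\<close>

fun stuffle :: "nat list \<Rightarrow> nat list \<Rightarrow> nat list list" where
  "stuffle [] ls = [ls]"
| "stuffle ks [] = [ks]"
| "stuffle (k # ks) (l # ls) =
     map ((#) k) (stuffle ks (l # ls)) @ map ((#) l) (stuffle (k # ks) ls)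
     @ map ((#) (k + l)) (stuffle ks ls)"

text \<open>The values on lists that contain a \<open>0\<close> are fixed to be \<open>0\<close> for uniqueness only.\<close>

definition harmonic_regularization :: "(nat list \<Rightarrow> real) \<Rightarrow> bool" where
  "harmonic_regularization Z \<longleftrightarrow>
     (\<forall>ks. admissible ks \<and> ks \<noteq> [] \<longrightarrow> Z ks = mzv ks) \<and>
     Z [] = 1 \<and> Z [1] = 0 \<and>
     (\<forall>ks ls. positive_index ks \<and> positive_index ls \<longrightarrow>
        Z ks * Z ls = (\<Sum>ms\<leftarrow>stuffle ks ls. Z ms)) \<and>
     (\<forall>ks. \<not> positive_index ks \<longrightarrow> Z ks = 0)"

definition zeta_star :: "nat list \<Rightarrow> real" where
  "zeta_star = (THE Z. harmonic_regularization Z)"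


subsection \<open>Existence and uniqueness of the harmonic regularization\<close>

lemma positive_index_simps [simp]:
  "positive_index []"
  "positive_index (k # ks) \<longleftrightarrow> k \<ge> 1 \<and> positive_index ks"
  by (auto simp: positive_index_def)

lemma stuffle_Nil2 [simp]: "stuffle ks [] = [ks]"
  by (cases ks) auto

lemma positive_index_stuffle:
  "ms \<in> set (stuffle ks ls) \<Longrightarrow> positive_index ks \<Longrightarrow> positive_index ls \<Longrightarrow> positive_index ms"
  by (induction ks ls arbitrary: ms rule: stuffle.induct) auto

lemma admissible_stuffle:
  "ms \<in> set (stuffle ks ls) \<Longrightarrow> admissible ks \<Longrightarrow> admissible ls \<Longrightarrow> admissible ms"
  by (cases "(ks, ls)" rule: stuffle.cases)
     (auto simp: admissible_def intro: positive_index_stuffle dest!: positive_index_stuffle)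

fun leading_ones :: "nat list \<Rightarrow> nat" where
  "leading_ones [] = 0"
| "leading_ones (k # ks) = (if k = 1 then Suc (leading_ones ks) else 0)"

lemma admissible_iff: "admissible ks \<longleftrightarrow> positive_index ks \<and> leading_ones ks = 0"
  by (cases ks) (auto simp: admissible_def)

lemma stuffle_one_cases:
  assumes "positive_index ks" "ms \<in> set (stuffle [1] ks)"
  shows   "ms = 1 # ks \<or> leading_ones ms \<le> leading_ones ks"
  using assms
proof (induction ks arbitrary: ms)
  case (Cons k ks)
  then consider "ms = 1 # k # ks" | x where "ms = k # x" "x \<in> set (stuffle [1] ks)" | "ms = (1 + k) # ks"
    by auto
  thus ?case
  proof cases
    case (2 x)
    thus ?thesis using Cons.IH[of x] Cons.prems(1) by auto
  qed (use Cons.prems(1) in auto)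
qed auto

lemma Cons_one_in_stuffle: "1 # ks \<in> set (stuffle [1] ks)"
  by (cases ks) auto

lemma stuffle_one_sum:
  fixes f :: "nat list \<Rightarrow> real"
  shows "(\<Sum>ms\<leftarrow>stuffle [1] ks. f ms) =
     real (count_list (stuffle [1] ks) (1 # ks)) * f (1 # ks) +
     (\<Sum>ms\<leftarrow>filter (\<lambda>ms. ms \<noteq> 1 # ks) (stuffle [1] ks). f ms)"
proof -
  have "(\<Sum>ms\<leftarrow>xs. f ms) = real (count_list xs x) * f x + (\<Sum>ms\<leftarrow>filter (\<lambda>ms. ms \<noteq> x) xs. f ms)"
    for xs x by (induction xs) (auto simp: algebra_simps)
  thus ?thesis .
qed

lemma count_stuffle_one_pos: "count_list (stuffle [1] ks) (1 # ks) > 0"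
  using Cons_one_in_stuffle[of ks] by (metis count_list_0_iff gr0I)

lemma leading_ones_induct [consumes 1, case_names admissible step]:
  assumes "positive_index ks"
  assumes "\<And>ks. admissible ks \<Longrightarrow> P ks"
  assumes "\<And>ks. positive_index ks \<Longrightarrow> P ks \<Longrightarrow>
             (\<And>ms. ms \<in> set (stuffle [1] ks) \<Longrightarrow> ms \<noteq> 1 # ks \<Longrightarrow> P ms) \<Longrightarrow> P (1 # ks)"
  shows "P ks"
  using assms(1)
proof (induction "leading_ones ks" arbitrary: ks rule: less_induct)
  case less
  show ?case
  proof (cases "leading_ones ks = 0")
    case True
    thus ?thesis using less.prems assms(2) by (simp add: admissible_iff)
  next
    case False
    then obtain ls where ls: "ks = 1 # ls"
      by (cases ks) (auto split: if_splits)
    show ?thesis unfolding ls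
    proof (rule assms(3))
      show "positive_index ls" "P ls" using less ls by auto
      fix ms assume ms: "ms \<in> set (stuffle [1] ls)" "ms \<noteq> 1 # ls"
      have "leading_ones ms \<le> leading_ones ls"
        using stuffle_one_cases[of ls ms] ms less.prems ls by auto
      moreover have "positive_index ms"
        using ms less.prems ls by (auto dest: positive_index_stuffle)
      ultimately show "P ms" using less.hyps[of ms] ls by simp
    qed
  qed
qed

lemma harmonic_regularization_step:
  assumes "harmonic_regularization Z" "positive_index ks"
  shows "Z (1 # ks) = - (\<Sum>ms\<leftarrow>filter (\<lambda>ms. ms \<noteq> 1 # ks) (stuffle [1] ks). Z ms) /
                        real (count_list (stuffle [1] ks) (1 # ks))"
proof -
  have "positive_index [1]" by simp
  with assms have "Z [1] * Z ks = (\<Sum>ms\<leftarrow>stuffle [1] ks. Z ms)" and "Z [1] = 0"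
    unfolding harmonic_regularization_def by blast+
  thus ?thesis
    using stuffle_one_sum[of Z ks] count_stuffle_one_pos[of ks] by (simp add: field_simps)
qed

lemma harmonic_regularization_unique:
  assumes "harmonic_regularization Z" "harmonic_regularization Z'"
  shows "Z = Z'"
proof
  fix ks
  show "Z ks = Z' ks"
  proof (cases "positive_index ks")
    case True
    thus ?thesis
    proof (induction ks rule: leading_ones_induct)
      case (admissible ks)
      thus ?case using assms unfolding harmonic_regularization_def by (cases "ks = []") auto
    next
      case (step ks)
      have "map Z (filter (\<lambda>ms. ms \<noteq> 1 # ks) (stuffle [1] ks)) =
            map Z' (filter (\<lambda>ms. ms \<noteq> 1 # ks) (stuffle [1] ks))"
        using step by (intro map_cong) auto
      thus ?case
        using assms step(1) by (simp only: harmonic_regularization_step)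
    qed
  qed (use assms in \<open>auto simp: harmonic_regularization_def\<close>)
qed

text \<open>Existence: a truncated multiple zeta value is a polynomial in the truncated harmonic
  series up to an error term that tends to \<open>0\<close> fast enough; \<open>zeta_star\<close> is the constant
  coefficient of this polynomial.\<close>

definition weight :: "nat \<Rightarrow> nat \<Rightarrow> real" where
  "weight n k = (if n = 0 then 0 else 1 / real n ^ k)"

fun trunc :: "nat list \<Rightarrow> nat \<Rightarrow> real" where
  "trunc [] N = 1"
| "trunc (k # ks) N = (\<Sum>n<N. weight n k * trunc ks n)"

lemma weight_nonneg [simp]: "weight n k \<ge> 0"
  by (simp add: weight_def)

lemma weight_add: "weight n (k + l) = weight n k * weight n l"
  by (simp add: weight_def power_add)

lemma weight_antimono: "k \<le> l \<Longrightarrow> weight n l \<le> weight n k"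
  by (auto simp: weight_def intro!: divide_left_mono power_increasing)

lemma trunc_nonneg [simp]: "trunc ks N \<ge> 0"
  by (induction ks arbitrary: N) (auto intro!: sum_nonneg)

lemma trunc_mono: "M \<le> N \<Longrightarrow> trunc ks M \<le> trunc ks N"
  by (cases ks) (auto intro!: sum_mono2)

lemma trunc_stuffle: "trunc ks N * trunc ls N = (\<Sum>ms\<leftarrow>stuffle ks ls. trunc ms N)"
proof (induction ks ls arbitrary: N rule: stuffle.induct)
  case (3 k ks l ls)
  have *: "(\<Sum>ms\<leftarrow>map ((#) j) xs. trunc ms (Suc N)) =
        (\<Sum>ms\<leftarrow>map ((#) j) xs. trunc ms N) + weight N j * (\<Sum>ms\<leftarrow>xs. trunc ms N)" for j xs N
    by (induction xs) (auto simp: algebra_simps)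
  have **: "(\<Sum>ms\<leftarrow>map ((#) j) xs. trunc ms 0) = 0" for j xs
    by (induction xs) auto
  show ?case
  proof (induction N)
    case 0
    show ?case using ** by (simp del: map_map)
  next
    case (Suc N)
    have "trunc (k # ks) (Suc N) * trunc (l # ls) (Suc N) =
       trunc (k # ks) N * trunc (l # ls) N
       + weight N k * (trunc ks N * trunc (l # ls) N)
       + weight N l * (trunc (k # ks) N * trunc ls N)
       + weight N (k + l) * (trunc ks N * trunc ls N)"
      by (simp add: weight_add algebra_simps)
    also have "\<dots> = (\<Sum>ms\<leftarrow>stuffle (k # ks) (l # ls). trunc ms (Suc N))"
      unfolding Suc 3 stuffle.simps map_append sum_list_append *
      by (simp only: algebra_simps)
    finally show ?case .
  qed
qed auto

definition hsum :: "nat \<Rightarrow> real" where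
  "hsum = trunc [1]"

lemma hsum_nonneg [simp]: "hsum N \<ge> 0"
  by (simp add: hsum_def del: trunc.simps)

lemma hsum_mono: "M \<le> N \<Longrightarrow> hsum M \<le> hsum N"
  unfolding hsum_def by (rule trunc_mono)

lemma hsum_eq: "hsum (Suc n) = harm n"
  by (induction n) (simp_all add: hsum_def weight_def harm_Suc harm_expand field_simps)

lemma hsum_at_top: "filterlim hsum at_top sequentially"
  using harm_at_top by (subst filterlim_sequentially_Suc [symmetric]) (simp add: hsum_eq[abs_def])

lemma trunc_le_hsum_power: "positive_index ks \<Longrightarrow> trunc ks N \<le> hsum N ^ length ks"
proof (induction ks arbitrary: N)
  case (Cons k ks)
  have "trunc (k # ks) N \<le> (\<Sum>n<N. weight n 1 * hsum N ^ length ks)"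
    unfolding trunc.simps
  proof (intro sum_mono mult_mono)
    fix n assume "n \<in> {..<N}"
    have "trunc ks n \<le> hsum n ^ length ks" using Cons by simp
    also have "\<dots> \<le> hsum N ^ length ks"
      using \<open>n \<in> _\<close> by (intro power_mono hsum_mono hsum_nonneg) auto
    finally show "trunc ks n \<le> hsum N ^ length ks" .
  qed (use Cons.prems in \<open>auto intro: weight_antimono\<close>)
  also have "\<dots> = hsum N ^ length (k # ks)"
    by (simp add: hsum_def sum_distrib_right)
  finally show ?case .
qed auto

lemma summable_weight_hsum: "summable (\<lambda>n. weight n 2 * hsum n ^ m)"
proof (rule summable_comparison_test_ev)
  have "eventually (\<lambda>n::nat. (1 + ln (real n)) ^ m \<le> real n powr (1/2)) at_top"
    by real_asymp
  thus "eventually (\<lambda>n. norm (weight n 2 * hsum n ^ m) \<le> real n powr (-3/2)) at_top"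
    using eventually_gt_at_top[of 1]
  proof eventually_elim
    case (elim n)
    have "hsum n \<le> hsum (Suc n)" by (rule hsum_mono) simp
    also have "\<dots> \<le> 1 + ln (real n)"
      using euler_mascheroni_sequence_decreasing[of 1 n] elim by (simp add: hsum_eq harm_expand)
    finally have "hsum n ^ m \<le> (1 + ln (real n)) ^ m"
      by (intro power_mono hsum_nonneg)
    also have "\<dots> \<le> real n powr (1/2)" by (rule elim)
    finally have "weight n 2 * hsum n ^ m \<le> weight n 2 * real n powr (1/2)"
      by (intro mult_left_mono weight_nonneg)
    also have "weight n 2 * real n powr (1/2) = real n powr (-2) * real n powr (1/2)"
      using elim by (simp add: weight_def powr_minus_divide)
    also have "\<dots> = real n powr (-3/2)"
      by (simp flip: powr_add)
    finally show ?case by simp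
  qed
qed (simp add: summable_real_powr_iff)

definition negl :: "(nat \<Rightarrow> real) \<Rightarrow> bool" where
  "negl u \<longleftrightarrow> (\<forall>j. (\<lambda>N. u N * hsum N ^ j) \<longlonglongrightarrow> 0)"

lemma negl_tendsto: "negl u \<Longrightarrow> u \<longlonglongrightarrow> 0"
  unfolding negl_def by (auto dest!: spec[of _ 0])

lemma negl_0: "negl (\<lambda>_. 0)"
  by (simp add: negl_def)

lemma negl_add: "negl u \<Longrightarrow> negl v \<Longrightarrow> negl (\<lambda>N. u N + v N)"
  unfolding negl_def by (auto simp: distrib_right intro!: tendsto_add_zero)

lemma negl_mult: 
  assumes "negl u" "v \<longlonglongrightarrow> c"
  shows "negl (\<lambda>N. u N * v N)"
  unfolding negl_def
proof
  fix j
  have "(\<lambda>N. (u N * hsum N ^ j) * v N) \<longlonglongrightarrow> 0 * c"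
    using assms unfolding negl_def by (intro tendsto_mult) auto
  thus "(\<lambda>N. u N * v N * hsum N ^ j) \<longlonglongrightarrow> 0" by (simp only: mult_ac mult_zero_left mult_zero_right)
qed

lemma negl_cmult: "negl u \<Longrightarrow> negl (\<lambda>N. c * u N)"
  using negl_mult[of u "\<lambda>_. c" c] by (simp add: mult.commute)

lemma negl_uminus: "negl u \<Longrightarrow> negl (\<lambda>N. - u N)"
  using negl_cmult[of u "-1"] by simp

lemma negl_hsum: "negl u \<Longrightarrow> negl (\<lambda>N. u N * hsum N)"
  unfolding negl_def
  by (intro allI, drule_tac x = "Suc j" in spec) (simp add: mult_ac)

lemma negl_poly: "negl u \<Longrightarrow> negl (\<lambda>N. u N * poly P (hsum N))"
proof (induction P)
  case (pCons a P)
  have "negl (\<lambda>N. a * u N + u N * poly P (hsum N) * hsum N)"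
    using pCons by (intro negl_add negl_cmult negl_hsum)
  thus ?case by (simp add: algebra_simps)
qed (simp add: negl_0)

definition expands :: "(nat \<Rightarrow> real) \<Rightarrow> real poly \<Rightarrow> bool" where
  "expands u P \<longleftrightarrow> negl (\<lambda>N. u N - poly P (hsum N))"

lemma expands_unique:
  assumes "expands u P" "expands u Q"
  shows "P = Q"
proof (rule ccontr)
  assume "P \<noteq> Q"
  define R where "R = P - Q"
  have lim: "(\<lambda>N. poly R (hsum N)) \<longlonglongrightarrow> 0"
    using tendsto_diff[OF negl_tendsto negl_tendsto,
            OF assms(2,1)[unfolded expands_def]]
    by (simp add: R_def)
  show False
  proof (cases "degree R = 0")
    case True
    then obtain c where "R = [:c:]" by (metis degree_eq_zeroE)
    thus False using lim \<open>P \<noteq> Q\<close> by (simp add: R_def LIMSEQ_const_iff)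
  next
    case False
    have "filterlim (\<lambda>N. poly R (hsum N)) at_infinity sequentially"
      using filterlim_poly_at_infinity[of R] False
        filterlim_mono[OF hsum_at_top at_top_le_at_infinity order_refl]
      by (auto intro: filterlim_compose)
    thus False using lim not_tendsto_and_filterlim_at_infinity by (metis sequentially_bot)
  qed
qed

lemma expands_add: "expands u P \<Longrightarrow> expands v Q \<Longrightarrow> expands (\<lambda>N. u N + v N) (P + Q)"
  unfolding expands_def by (drule (1) negl_add) (simp add: algebra_simps)

lemma expands_cmult: "expands u P \<Longrightarrow> expands (\<lambda>N. c * u N) (smult c P)"
  unfolding expands_def by (drule negl_cmult[of _ c]) (simp add: algebra_simps)

lemma expands_sum_list:
  "(\<And>x. x \<in> set xs \<Longrightarrow> expands (f x) (P x)) \<Longrightarrow>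
     expands (\<lambda>N. \<Sum>x\<leftarrow>xs. f x N) (\<Sum>x\<leftarrow>xs. P x)"
proof (induction xs)
  case Nil
  show ?case by (simp add: expands_def negl_0)
next
  case (Cons x xs)
  thus ?case by (auto intro!: expands_add)
qed

lemma expands_mult:
  assumes "expands u P" "expands v Q"
  shows "expands (\<lambda>N. u N * v N) (P * Q)"
proof -
  define d where "d = (\<lambda>N. u N - poly P (hsum N))"
  define e where "e = (\<lambda>N. v N - poly Q (hsum N))"
  have de: "negl d" "negl e" using assms by (auto simp: d_def e_def expands_def)
  have "negl (\<lambda>N. d N * e N + d N * poly Q (hsum N) + e N * poly P (hsum N))"
    using de by (intro negl_add negl_poly negl_mult[OF _ negl_tendsto]) auto
  thus ?thesis
    unfolding expands_def d_def e_def by (simp add: algebra_simps)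
qed

lemma expands_hsum: "expands hsum [:0, 1:]"
  by (simp add: expands_def negl_0)

lemma finite_dec_tuples: "finite S \<Longrightarrow> finite (dec_tuples r S)"
  by (rule finite_subset[of _ "{ns. set ns \<subseteq> S \<and> length ns = r}"])
     (auto simp: dec_tuples_def finite_lists_length_eq)

lemma trunc_eq_sum:
  "trunc ks N = (\<Sum>ns\<in>dec_tuples (length ks) {1..<N}. prod_list (map2 (\<lambda>n k. 1 / real n ^ k) ns ks))"
proof (induction ks arbitrary: N)
  case Nil
  have "dec_tuples 0 {1..<N} = {[]}" by (auto simp: dec_tuples_def)
  thus ?case by simp
next
  case (Cons k ks)
  let ?f = "\<lambda>ks ns. prod_list (map2 (\<lambda>n k. 1 / real n ^ k) ns ks)"
  have "trunc (k # ks) N = (\<Sum>n\<in>{1..<N}. weight n k * trunc ks n)"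
    unfolding trunc.simps by (intro sum.mono_neutral_right) (auto simp: weight_def)
  also have "\<dots> = (\<Sum>n\<in>{1..<N}. \<Sum>ns\<in>dec_tuples (length ks) {1..<n}. ?f (k # ks) (n # ns))"
    unfolding Cons by (intro sum.cong refl) (auto simp: sum_distrib_left weight_def)
  also have "\<dots> = (\<Sum>(n, ns)\<in>Sigma {1..<N} (\<lambda>n. dec_tuples (length ks) {1..<n}). ?f (k # ks) (n # ns))"
    by (subst sum.Sigma) (auto intro: finite_dec_tuples)
  also have "\<dots> = (\<Sum>ns\<in>dec_tuples (length (k # ks)) {1..<N}. ?f (k # ks) ns)"
    by (rule sum.reindex_bij_witness[of _ "\<lambda>ns. (hd ns, tl ns)" "\<lambda>(n, ns). n # ns"])
       (fastforce simp: dec_tuples_def length_Suc_conv)+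
  finally show ?case .
qed

lemma has_sum_mzv:
  assumes "trunc ks \<longlonglongrightarrow> L"
  shows "((\<lambda>ns. prod_list (map2 (\<lambda>n k. 1 / real n ^ k) ns ks)) has_sum L)
           (dec_tuples (length ks) {1..})" (is "(?f has_sum L) ?A")
proof -
  let ?I = "\<lambda>N. dec_tuples (length ks) {1..<N}"
  have nn: "?f ns \<ge> 0" for ns
    by (rule prod_list_nonneg) auto
  have sub: "?I N \<subseteq> ?A" for N by (auto simp: dec_tuples_def)
  have ex: "\<exists>N. F \<subseteq> ?I N" if "finite F" "F \<subseteq> ?A" for F
  proof
    have "n < Suc (Max (\<Union>(set ` F)))" if "ns \<in> F" "n \<in> set ns" for n ns
      using that \<open>finite F\<close> by (intro le_imp_less_Suc Max_ge) auto
    thus "F \<subseteq> ?I (Suc (Max (\<Union>(set ` F))))"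
      using \<open>F \<subseteq> ?A\<close> by (fastforce simp: dec_tuples_def)
  qed
  have le: "sum ?f F \<le> L" if F: "finite F" "F \<subseteq> ?A" for F
  proof -
    obtain N where "F \<subseteq> ?I N" using ex[OF F] by blast
    hence "sum ?f F \<le> trunc ks N"
      unfolding trunc_eq_sum using nn by (intro sum_mono2 finite_dec_tuples) auto
    also have "\<dots> \<le> L"
      using assms trunc_mono by (intro incseq_le) (auto simp: incseq_def)
    finally show ?thesis .
  qed
  show ?thesis unfolding has_sum_def
  proof (rule increasing_tendsto)
    show "\<forall>\<^sub>F F in finite_subsets_at_top ?A. sum ?f F \<le> L"
      by (intro eventually_finite_subsets_at_top_weakI le)
  next
    fix y assume "y < L"
    hence "eventually (\<lambda>N. y < trunc ks N) sequentially"
      using assms by (rule order_tendstoD(1)[rotated])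
    then obtain N where N: "y < trunc ks N"
      by (auto simp: eventually_sequentially)
    have "y < sum ?f F" if "finite F" "?I N \<subseteq> F" "F \<subseteq> ?A" for F
    proof -
      have "trunc ks N \<le> sum ?f F"
        unfolding trunc_eq_sum using that nn by (intro sum_mono2) auto
      thus ?thesis using N by simp
    qed
    thus "\<forall>\<^sub>F F in finite_subsets_at_top ?A. y < sum ?f F"
      unfolding eventually_finite_subsets_at_top
      by (intro exI[of _ "?I N"] conjI allI impI finite_dec_tuples sub) auto
  qed
qed

lemma expands_admissible:
  assumes "admissible ks"
  shows "expands (trunc ks) [:mzv ks:]"
proof (cases ks)
  case Nil
  have "trunc ks = (\<lambda>_. 1)" by (auto simp: Nil)
  hence "trunc ks \<longlonglongrightarrow> 1" by simp
  hence "mzv ks = 1" unfolding mzv_def by (intro infsumI has_sum_mzv)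
  thus ?thesis by (simp add: Nil expands_def negl_0)
next
  case (Cons k ls)
  define a where "a = (\<lambda>n. weight n k * trunc ls n)"
  have k: "k \<ge> 2" "positive_index ls" using assms by (auto simp: admissible_def Cons)
  have a0: "a n \<ge> 0" for n by (simp add: a_def)
  have summ: "summable (\<lambda>n. a n * hsum n ^ j)" for j
  proof (rule summable_comparison_test[OF _ summable_weight_hsum[of "length ls + j"]], intro exI allI impI)
    fix n
    have "a n * hsum n ^ j \<le> (weight n 2 * hsum n ^ length ls) * hsum n ^ j"
      unfolding a_def using k
      by (intro mult_right_mono mult_mono weight_antimono trunc_le_hsum_power
            zero_le_power mult_nonneg_nonneg trunc_nonneg hsum_nonneg weight_nonneg)
    thus "norm (a n * hsum n ^ j) \<le> weight n 2 * hsum n ^ (length ls + j)"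
      using a0[of n] by (simp add: power_add mult_ac abs_mult)
  qed
  have summ0: "summable a" using summ[of 0] by simp
  define L where "L = suminf a"
  have tr: "trunc ks N = (\<Sum>n<N. a n)" for N by (simp add: Cons a_def)
  have "trunc ks \<longlonglongrightarrow> L"
    unfolding tr[abs_def] L_def by (rule summable_LIMSEQ[OF summ0])
  hence L: "mzv ks = L" unfolding mzv_def by (intro infsumI has_sum_mzv)
  have "(\<lambda>N. (L - trunc ks N) * hsum N ^ j) \<longlonglongrightarrow> 0" for j
  proof (rule tendsto_sandwich)
    let ?b = "\<lambda>n. a n * hsum n ^ j"
    have tail: "L - trunc ks N = (\<Sum>n. a (n + N))" for N
      using suminf_minus_initial_segment[OF summ0, of N] by (simp add: L_def tr)
    have "(L - trunc ks N) * hsum N ^ j \<ge> 0" for N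
      unfolding tail using summ0 a0
      by (intro mult_nonneg_nonneg suminf_nonneg zero_le_power hsum_nonneg summable_ignore_initial_segment)
    thus "\<forall>\<^sub>F N in sequentially. 0 \<le> (L - trunc ks N) * hsum N ^ j" by simp
    have "(L - trunc ks N) * hsum N ^ j \<le> suminf ?b - (\<Sum>n<N. ?b n)" for N
    proof -
      have "(L - trunc ks N) * hsum N ^ j = (\<Sum>n. a (n + N) * hsum N ^ j)"
        unfolding tail using summ0
        by (intro suminf_mult2 summable_ignore_initial_segment)
      also have "\<dots> \<le> (\<Sum>n. ?b (n + N))"
        using summ0 summ a0
        by (intro suminf_le summable_mult2 summable_ignore_initial_segment mult_left_mono
              power_mono hsum_mono hsum_nonneg) auto
      also have "\<dots> = suminf ?b - (\<Sum>n<N. ?b n)"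
        using suminf_minus_initial_segment[OF summ] .
      finally show ?thesis .
    qed
    thus "\<forall>\<^sub>F N in sequentially. (L - trunc ks N) * hsum N ^ j \<le> suminf ?b - (\<Sum>n<N. ?b n)"
      by simp
    show "(\<lambda>N. suminf ?b - (\<Sum>n<N. ?b n)) \<longlonglongrightarrow> 0"
      using tendsto_diff[OF tendsto_const summable_LIMSEQ[OF summ[of j]], of "suminf ?b"]
      by simp
  qed simp
  hence "negl (\<lambda>N. L - trunc ks N)" by (simp add: negl_def)
  from negl_uminus[OF this] show ?thesis by (simp add: expands_def L)
qed

lemma expands_ex: "positive_index ks \<Longrightarrow> \<exists>P. expands (trunc ks) P"
proof (induction ks rule: leading_ones_induct)
  case (admissible ks)
  thus ?case using expands_admissible by blast
next
  case (step ks)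
  let ?xs = "filter (\<lambda>ms. ms \<noteq> 1 # ks) (stuffle [1] ks)"
  define c where "c = real (count_list (stuffle [1] ks) (1 # ks))"
  have c: "c > 0" using count_stuffle_one_pos[of ks] by (simp add: c_def)
  obtain Q where Q: "expands (trunc ks) Q" using step by blast
  have "\<forall>ms\<in>set ?xs. \<exists>P. expands (trunc ms) P" using step by auto
  then obtain P where P: "\<And>ms. ms \<in> set ?xs \<Longrightarrow> expands (trunc ms) (P ms)" by metis
  have eq: "trunc (1 # ks) N = 1 / c * (hsum N * trunc ks N + (- 1) * (\<Sum>ms\<leftarrow>?xs. trunc ms N))" for N
    using trunc_stuffle[of "[1]" N ks, folded hsum_def] stuffle_one_sum[of "\<lambda>ms. trunc ms N" ks] c
    by (simp add: c_def field_simps)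
  have "expands (\<lambda>N. 1 / c * (hsum N * trunc ks N + (- 1) * (\<Sum>ms\<leftarrow>?xs. trunc ms N)))
          (smult (1 / c) ([:0, 1:] * Q + smult (- 1) (\<Sum>ms\<leftarrow>?xs. P ms)))"
    using P by (intro expands_cmult expands_add expands_mult expands_sum_list expands_hsum Q)
  thus ?case unfolding eq[symmetric] by blast
qed

lemma harmonic_regularization_ex: "\<exists>Z. harmonic_regularization Z"
proof -
  obtain P where P: "\<And>ks. positive_index ks \<Longrightarrow> expands (trunc ks) (P ks)"
    using expands_ex by metis
  define Z where "Z = (\<lambda>ks. if positive_index ks then coeff (P ks) 0 else 0)"
  have PI: "P ks = Q" if "positive_index ks" "expands (trunc ks) Q" for ks Q
    using that P expands_unique by blast
  have adm: "Z ks = mzv ks" if "admissible ks" for ks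
    using PI[OF _ expands_admissible[OF that]] that by (simp add: Z_def admissible_def)
  have Nil: "Z [] = 1"
  proof -
    have "P [] = [:1:]" by (rule PI) (simp_all add: expands_def negl_0)
    thus ?thesis by (simp add: Z_def)
  qed
  have one: "Z [1] = 0"
    using PI[OF _ expands_hsum[unfolded hsum_def]] by (simp add: Z_def)
  have mult: "Z ks * Z ls = (\<Sum>ms\<leftarrow>stuffle ks ls. Z ms)"
    if "positive_index ks" "positive_index ls" for ks ls
  proof -
    have pos: "positive_index ms" if "ms \<in> set (stuffle ks ls)" for ms
      using that \<open>positive_index ks\<close> \<open>positive_index ls\<close> by (rule positive_index_stuffle)
    have "expands (\<lambda>N. trunc ks N * trunc ls N) (P ks * P ls)"
      using that by (intro expands_mult P)
    moreover have "expands (\<lambda>N. trunc ks N * trunc ls N) (\<Sum>ms\<leftarrow>stuffle ks ls. P ms)"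
      unfolding trunc_stuffle using pos by (intro expands_sum_list P)
    ultimately have "P ks * P ls = (\<Sum>ms\<leftarrow>stuffle ks ls. P ms)"
      by (rule expands_unique)
    hence "coeff (P ks) 0 * coeff (P ls) 0 = coeff (\<Sum>ms\<leftarrow>stuffle ks ls. P ms) 0"
      by (metis coeff_mult_0)
    also have "\<dots> = (\<Sum>ms\<leftarrow>stuffle ks ls. coeff (P ms) 0)"
    proof -
      have "coeff (\<Sum>ms\<leftarrow>xs. P ms) 0 = (\<Sum>ms\<leftarrow>xs. coeff (P ms) 0)" for xs
        by (induction xs) auto
      thus ?thesis .
    qed
    also have "\<dots> = (\<Sum>ms\<leftarrow>stuffle ks ls. Z ms)"
      using pos by (intro arg_cong[of _ _ sum_list] map_cong) (auto simp: Z_def)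
    finally show ?thesis using that by (simp add: Z_def)
  qed
  have "harmonic_regularization Z"
    unfolding harmonic_regularization_def using adm Nil one mult by (auto simp: Z_def)
  thus ?thesis by blast
qed

lemma harmonic_regularization_zeta_star: "harmonic_regularization zeta_star"
  unfolding zeta_star_def
  using harmonic_regularization_ex harmonic_regularization_unique by (rule theI'[OF ex_ex1I])

lemma zeta_star_admissible: "admissible ks \<Longrightarrow> ks \<noteq> [] \<Longrightarrow> zeta_star ks = mzv ks"
  and zeta_star_Nil: "zeta_star [] = 1"
  and zeta_star_one: "zeta_star [1] = 0"
  and zeta_star_stuffle: "positive_index ks \<Longrightarrow> positive_index ls \<Longrightarrow>
        zeta_star ks * zeta_star ls = (\<Sum>ms\<leftarrow>stuffle ks ls. zeta_star ms)"
  using harmonic_regularization_zeta_star unfolding harmonic_regularization_def by blast+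


section \<open>The algebra of multiple zeta values and symmetric multiple zeta values\<close>

global_interpretation rat_real: vector_space "\<lambda>(q::rat) (x::real). of_rat q * x"
  by unfold_locales (simp_all add: algebra_simps of_rat_add of_rat_mult)

definition Z_R :: "real set" where
  "Z_R = rat_real.span (insert 1 {mzv ks | ks. admissible ks \<and> ks \<noteq> []})"

lemma mzv_in_Z_R: "admissible ks \<Longrightarrow> ks \<noteq> [] \<Longrightarrow> mzv ks \<in> Z_R"
  unfolding Z_R_def by (rule rat_real.span_base) auto

lemma Z_R_0 [simp]: "0 \<in> Z_R"
  and Z_R_1 [simp]: "1 \<in> Z_R"
  and Z_R_add: "x \<in> Z_R \<Longrightarrow> y \<in> Z_R \<Longrightarrow> x + y \<in> Z_R"
  and Z_R_diff: "x \<in> Z_R \<Longrightarrow> y \<in> Z_R \<Longrightarrow> x - y \<in> Z_R"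
  and Z_R_uminus: "x \<in> Z_R \<Longrightarrow> - x \<in> Z_R"
  and Z_R_scale: "x \<in> Z_R \<Longrightarrow> of_rat q * x \<in> Z_R"
  unfolding Z_R_def
  by (auto intro: rat_real.span_zero rat_real.span_base rat_real.span_add rat_real.span_diff
      rat_real.span_neg rat_real.span_scale)

lemma Z_R_sum_list: "(\<And>x. x \<in> set xs \<Longrightarrow> f x \<in> Z_R) \<Longrightarrow> (\<Sum>x\<leftarrow>xs. f x) \<in> Z_R"
  by (induction xs) (auto intro: Z_R_add)

lemma zeta_star_admissible_in_Z_R: "admissible ks \<Longrightarrow> zeta_star ks \<in> Z_R"
  by (cases "ks = []") (auto simp: zeta_star_Nil zeta_star_admissible mzv_in_Z_R)

lemma zeta_star_in_Z_R: "positive_index ks \<Longrightarrow> zeta_star ks \<in> Z_R"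
proof (induction ks rule: leading_ones_induct)
  case (step ks)
  let ?c = "count_list (stuffle [1] ks) (1 # ks)"
  have "of_rat (- 1 / of_nat ?c) *
          (\<Sum>ms\<leftarrow>filter (\<lambda>ms. ms \<noteq> 1 # ks) (stuffle [1] ks). zeta_star ms) \<in> Z_R"
    using step by (intro Z_R_scale Z_R_sum_list) auto
  thus ?case
    unfolding harmonic_regularization_step[OF harmonic_regularization_zeta_star step(1)]
    by (simp add: of_rat_divide of_rat_minus)
qed (rule zeta_star_admissible_in_Z_R)

lemma Z_R_mult:
  assumes "x \<in> Z_R" "y \<in> Z_R"
  shows "x * y \<in> Z_R"
proof -
  let ?B = "zeta_star ` {ks. admissible ks}"
  have "insert 1 {mzv ks | ks. admissible ks \<and> ks \<noteq> []} = ?B"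
  proof (intro equalityI subsetI)
    fix x assume "x \<in> insert 1 {mzv ks | ks. admissible ks \<and> ks \<noteq> []}"
    then consider "x = zeta_star []" | ks where "admissible ks" "x = zeta_star ks"
      using zeta_star_admissible zeta_star_Nil by auto
    thus "x \<in> ?B" by cases (auto simp: admissible_def)
  next
    fix x assume "x \<in> ?B"
    then obtain ks where "admissible ks" "x = zeta_star ks" by blast
    thus "x \<in> insert 1 {mzv ks | ks. admissible ks \<and> ks \<noteq> []}"
      using zeta_star_admissible zeta_star_Nil by (cases "ks = []") auto
  qed
  hence Z: "Z_R = rat_real.span ?B" by (simp add: Z_R_def)
  have base: "zeta_star ks * zeta_star ls \<in> Z_R" if "admissible ks" "admissible ls" for ks ls
  proof -
    have "zeta_star ks * zeta_star ls = (\<Sum>ms\<leftarrow>stuffle ks ls. zeta_star ms)"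
      using that by (intro zeta_star_stuffle) (auto simp: admissible_def)
    also have "\<dots> \<in> Z_R"
      using admissible_stuffle[OF _ that] by (intro Z_R_sum_list zeta_star_admissible_in_Z_R)
    finally show ?thesis .
  qed
  have half: "zeta_star ks * y \<in> Z_R" if "admissible ks" for ks
    using assms(2) unfolding Z
  proof (induction y rule: rat_real.span_induct_alt)
    case (step c b y)
    then obtain ls where "admissible ls" "b = zeta_star ls" by blast
    hence "of_rat c * (zeta_star ks * b) + zeta_star ks * y \<in> Z_R"
      using base[OF that] step by (intro Z_R_add Z_R_scale) (auto simp: Z)
    thus ?case by (simp add: Z algebra_simps)
  qed (use Z_R_0 Z in auto)
  show ?thesis
    using assms(1) unfolding Z
  proof (induction x rule: rat_real.span_induct_alt)
    case (step c b x)
    then obtain ks where "admissible ks" "b = zeta_star ks" by blast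
    hence "of_rat c * (b * y) + x * y \<in> Z_R"
      using half step by (intro Z_R_add Z_R_scale) (auto simp: Z)
    thus ?case by (simp add: Z algebra_simps)
  qed (use Z_R_0 Z in auto)
qed

text \<open>The quotient of \<open>Z_R\<close> by its ideal generated by \<open>\<zeta>(2)\<close>, as a type: the relation
  is partial, its domain being \<open>Z_R\<close>. It is not made an instance of \<open>comm_ring_1\<close>, as
  that class requires \<open>0 \<noteq> 1\<close>.\<close>

definition S_rel :: "real \<Rightarrow> real \<Rightarrow> bool" where
  "S_rel x y \<longleftrightarrow> x \<in> Z_R \<and> y \<in> Z_R \<and> (\<exists>z\<in>Z_R. x - y = mzv [2] * z)"

lemma mzv2_in_Z_R: "mzv [2] \<in> Z_R"
  by (rule mzv_in_Z_R) (auto simp: admissible_def)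

lemma S_rel_refl: "x \<in> Z_R \<Longrightarrow> S_rel x x"
  by (auto simp: S_rel_def intro!: bexI[of _ 0])

lemma S_relI: "x \<in> Z_R \<Longrightarrow> y \<in> Z_R \<Longrightarrow> z \<in> Z_R \<Longrightarrow> x - y = mzv [2] * z \<Longrightarrow> S_rel x y"
  unfolding S_rel_def by blast

lemma S_relE:
  assumes "S_rel x y"
  obtains z where "x \<in> Z_R" "y \<in> Z_R" "z \<in> Z_R" "x - y = mzv [2] * z"
  using assms unfolding S_rel_def by blast

lemma part_equivp_S_rel: "part_equivp S_rel"
proof (rule part_equivpI)
  show "\<exists>x. S_rel x x" using S_rel_refl[of 0] by auto
  show "symp S_rel"
  proof (rule sympI)
    fix x y assume "S_rel x y"
    then obtain z where z: "x \<in> Z_R" "y \<in> Z_R" "z \<in> Z_R" "x - y = mzv [2] * z"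
      by (rule S_relE)
    show "S_rel y x"
      by (rule S_relI[of _ _ "- z"]) (use z in \<open>simp_all add: Z_R_uminus\<close>)
  qed
  show "transp S_rel"
  proof (rule transpI)
    fix x y w assume "S_rel x y" "S_rel y w"
    then obtain z z' where z: "x \<in> Z_R" "w \<in> Z_R" "z \<in> Z_R" "z' \<in> Z_R"
        "x - y = mzv [2] * z" "y - w = mzv [2] * z'"
      by (elim S_relE)
    show "S_rel x w"
      by (rule S_relI[of _ _ "z + z'"]) (use z in \<open>simp_all add: Z_R_add distrib_left\<close>)
  qed
qed

quotient_type calS = real / partial: S_rel
  by (rule part_equivp_S_rel)

lemma S_rel_add:
  assumes "S_rel x x'" "S_rel y y'"
  shows "S_rel (x + y) (x' + y')"
  using assms
proof (elim S_relE)
  fix z z'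
  assume z: "x \<in> Z_R" "x' \<in> Z_R" "z \<in> Z_R" "x - x' = mzv [2] * z"
            "y \<in> Z_R" "y' \<in> Z_R" "z' \<in> Z_R" "y - y' = mzv [2] * z'"
  have "x + y - (x' + y') = mzv [2] * (z + z')"
    using z(4,8) by (simp add: distrib_left)
  with z show ?thesis by (intro S_relI[of _ _ "z + z'"] Z_R_add)
qed

lemma S_rel_uminus:
  assumes "S_rel x x'"
  shows "S_rel (- x) (- x')"
  using assms
proof (elim S_relE)
  fix z assume z: "x \<in> Z_R" "x' \<in> Z_R" "z \<in> Z_R" "x - x' = mzv [2] * z"
  have "- x - - x' = mzv [2] * (- z)" using z(4) by simp
  with z show ?thesis by (intro S_relI[of _ _ "- z"] Z_R_uminus)
qed

lemma S_rel_mult: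
  assumes "S_rel x x'" "S_rel y y'"
  shows "S_rel (x * y) (x' * y')"
  using assms
proof (elim S_relE)
  fix z z'
  assume z: "x \<in> Z_R" "x' \<in> Z_R" "z \<in> Z_R" "x - x' = mzv [2] * z"
            "y \<in> Z_R" "y' \<in> Z_R" "z' \<in> Z_R" "y - y' = mzv [2] * z'"
  have "x * y - x' * y' = (x - x') * y + x' * (y - y')" by (simp add: algebra_simps)
  also have "\<dots> = mzv [2] * (z * y + x' * z')" unfolding z(4,8) by (simp add: algebra_simps)
  finally show ?thesis using z by (intro S_relI[of _ _ "z * y + x' * z'"] Z_R_add Z_R_mult)
qed

instantiation calS :: comm_ring
begin

lift_definition zero_calS :: calS is "0::real"
  by (rule S_rel_refl) simp

lift_definition plus_calS :: "calS \<Rightarrow> calS \<Rightarrow> calS" is "(+)"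
  by (rule S_rel_add)

lift_definition uminus_calS :: "calS \<Rightarrow> calS" is uminus
  by (rule S_rel_uminus)

lift_definition minus_calS :: "calS \<Rightarrow> calS \<Rightarrow> calS" is "(-)"
  using S_rel_add[OF _ S_rel_uminus] by simp

lift_definition times_calS :: "calS \<Rightarrow> calS \<Rightarrow> calS" is "(*)"
  by (rule S_rel_mult)

instance
  by standard
     (transfer; auto simp: S_rel_def algebra_simps
        intro!: bexI[of _ 0] Z_R_add Z_R_mult Z_R_diff Z_R_uminus)+

end

definition zeta_star_S :: "nat list \<Rightarrow> real" where
  "zeta_star_S ks = (\<Sum>i=0..length ks. (- 1) ^ sum_list (take i ks) *
     zeta_star (rev (take i ks)) * zeta_star (drop i ks))"

lemma zeta_star_S_in_Z_R:
  assumes "positive_index ks"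
  shows "zeta_star_S ks \<in> Z_R"
proof -
  have "(\<Sum>i\<in>I. (- 1) ^ sum_list (take i ks) * zeta_star (rev (take i ks)) * zeta_star (drop i ks))
          \<in> Z_R" if "finite I" for I
    using that
  proof (induction I)
    case (insert i I)
    have "positive_index (rev (take i ks))" "positive_index (drop i ks)"
      using assms by (auto simp: positive_index_def dest: in_set_takeD in_set_dropD)
    moreover have "(- 1) ^ n \<in> Z_R" for n
      by (induction n) (auto intro: Z_R_mult Z_R_uminus)
    ultimately show ?case
      using insert by (auto intro!: Z_R_add Z_R_mult zeta_star_in_Z_R)
  qed auto
  thus ?thesis unfolding zeta_star_S_def by simp
qed

definition zeta_S :: "nat list \<Rightarrow> calS" where
  "zeta_S ks = abs_calS (zeta_star_S ks)"

end

theory Submission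
  imports Defs
begin

text \<open>Let \<open>q\<close> be such that \<open>[n] = 1 + q + \<dots> + q\<^bsup>n-1\<^esup>\<close> is invertible for \<open>n < N\<close> and \<open>[N] = 0\<close>; put
  \<open>a\<^sub>n = 1/[n]\<close>, \<open>b\<^sub>n = q\<^sup>n/[n]\<close>, and evaluate an index at
  \<open>\<Sum>\<^bsub>N > n\<^sub>1 > \<dots> > n\<^sub>r \<ge> 1\<^esub> \<Prod>\<^sub>i a\<^bsub>n\<^sub>i\<^esub> b\<^bsub>n\<^sub>i\<^esub>\<^bsup>k\<^sub>i-1\<^esup>\<close>. With \<open>X\<close> the multiplication by \<open>b\<close> and \<open>Y\<close>
  the summation against \<open>a\<close>, the generating series of both sides of the theorem in a variable \<open>x\<close> are
  words in \<open>X\<close> and \<open>Y\<close> with factors \<open>(1 - xX)\<^sup>-\<^sup>1\<close> and \<open>(1 - xY)\<^sup>-\<^sup>1\<close>. The addition formula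
  \<open>b\<^sub>d b\<^sub>m = b\<^bsub>d+m\<^esub> (b\<^sub>d + a\<^sub>m)\<close> yields an explicit triangular operator \<open>T\<close> with
  \<open>T X (1 - xY)\<^sup>-\<^sup>1 = X T\<close> and \<open>T Y = Y (1 - xX)\<^sup>-\<^sup>1 T\<close>. Hence the left-hand series equals
  \<open>C = \<Prod>\<^bsub>l<N\<^esub> (1 + x a\<^sub>l)\<close> times the right-hand series.

  For \<open>q = 1\<close>, \<open>N = p\<close> over \<open>\<int>/p\<int>\<close> one has \<open>C \<equiv> 1\<close> modulo \<open>x\<^bsup>p-1\<^esup>\<close>, which is the statement in \<open>\<A>\<close>.
  For \<open>q = exp (2\<pi>\<i>/N)\<close> over \<open>\<complex>\<close> and odd \<open>N \<rightarrow> \<infinity>\<close> the two halves \<open>n < N/2\<close> and \<open>n > N/2\<close> of the sum give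
  the two factors in the definition of \<open>\<zeta>\<^sub>S\<^sup>*\<close>, up to terms that are divisible by \<open>\<pi>\<i>\<close> in \<open>Z_R + \<pi>\<i> Z_R\<close>,
  and \<open>C\<close> tends to \<open>(1 - exp (-2\<pi>\<i>x)) / (2\<pi>\<i>x)\<close>, which is \<open>1\<close> modulo \<open>\<pi>\<i>\<close>. Taking real parts turns
  divisibility by \<open>\<pi>\<i>\<close> into divisibility by \<open>\<zeta>(2) = \<pi>\<^sup>2/6\<close>.\<close>

section \<open>Weighted nested sums and an intertwining operator\<close>

fun zsum :: "(nat \<Rightarrow> 'a::comm_ring_1) \<Rightarrow> (nat \<Rightarrow> 'a) \<Rightarrow> nat list \<Rightarrow> nat \<Rightarrow> 'a" where
  "zsum a b [] n = 1"
| "zsum a b (k # ks) n = (\<Sum>m\<in>{1..<n}. a m * b m ^ (k - 1) * zsum a b ks m)"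

text \<open>The inverse of \<open>1 - c x\<close>, the variable \<open>x\<close> being
  \<open>fps_X\<close>.\<close>

definition geo :: "'a::comm_ring_1 \<Rightarrow> 'a fps" where
  "geo c = Abs_fps (\<lambda>j. c ^ j)"

lemma geo_nth [simp]: "fps_nth (geo c) j = c ^ j"
  by (simp add: geo_def)

lemma geo_inverse: "(1 - fps_X * fps_const c) * geo c = 1"
proof (rule fps_ext)
  fix n
  show "fps_nth ((1 - fps_X * fps_const c) * geo c) n = fps_nth 1 n"
    by (cases n) (simp_all add: left_diff_distrib mult.assoc)
qed

text \<open>\<open>sum_op\<close>, \<open>geometric_sum_op\<close> and \<open>intertwiner\<close> are the operators \<open>Y\<close>, \<open>Y (1 - xX)\<^sup>-\<^sup>1\<close> and
  \<open>T\<close>. The kernel of \<open>T\<close> is found by solving \<open>T X = X T (1 - xY)\<close> row by row, normalized by \<open>T 1 = 1\<close>; the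
  value \<open>rho b 0 = 0\<close> corresponds to \<open>b\<^sub>0 = \<infinity>\<close>.\<close>

definition sum_op :: "(nat \<Rightarrow> 'a::comm_ring_1) \<Rightarrow> (nat \<Rightarrow> 'a fps) \<Rightarrow> nat \<Rightarrow> 'a fps" where
  "sum_op a f n = (\<Sum>m\<in>{1..<n}. fps_const (a m) * f m)"

definition geometric_sum_op :: "(nat \<Rightarrow> 'a::comm_ring_1) \<Rightarrow> (nat \<Rightarrow> 'a) \<Rightarrow> (nat \<Rightarrow> 'a fps) \<Rightarrow> nat \<Rightarrow> 'a fps" where
  "geometric_sum_op a b f n = (\<Sum>m\<in>{1..<n}. fps_const (a m) * geo (b m) * f m)"

definition rho :: "(nat \<Rightarrow> 'a::comm_ring_1) \<Rightarrow> nat \<Rightarrow> 'a fps" where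
  "rho b d = (if d = 0 then 0 else geo (b d))"

definition intertwiner_prod :: "(nat \<Rightarrow> 'a::comm_ring_1) \<Rightarrow> nat \<Rightarrow> nat \<Rightarrow> 'a fps" where
  "intertwiner_prod b i m = (\<Prod>l\<in>{1..m}. rho b (i - l))"

definition intertwiner_kernel :: "(nat \<Rightarrow> 'a::comm_ring_1) \<Rightarrow> nat \<Rightarrow> nat \<Rightarrow> 'a fps" where
  "intertwiner_kernel b i m = intertwiner_prod b i (m - 1) - intertwiner_prod b i m"

definition intertwiner :: "(nat \<Rightarrow> 'a::comm_ring_1) \<Rightarrow> (nat \<Rightarrow> 'a fps) \<Rightarrow> nat \<Rightarrow> 'a fps" where
  "intertwiner b f i = (\<Sum>m\<in>{1..i}. intertwiner_kernel b i m * f m)"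

lemma sum_atLeastLessThan_Suc_right:
  fixes f :: "nat \<Rightarrow> 'a::comm_monoid_add"
  shows "1 \<le> n \<Longrightarrow> (\<Sum>m\<in>{1..<Suc n}. f m) = (\<Sum>m\<in>{1..<n}. f m) + f n"
  by (simp add: add.commute)

lemma sum_drop_last:
  fixes f :: "nat \<Rightarrow> 'a::comm_monoid_add"
  shows "1 \<le> n \<Longrightarrow> f n = 0 \<Longrightarrow> (\<Sum>m\<in>{1..n}. f m) = (\<Sum>m\<in>{1..<n}. f m)"
  using sum_atLeastLessThan_Suc_right[of n f] by (simp add: atLeastLessThanSuc_atLeastAtMost)

lemma sum_op_Suc: "1 \<le> n \<Longrightarrow> sum_op a f (Suc n) = sum_op a f n + fps_const (a n) * f n"
  unfolding sum_op_def by (rule sum_atLeastLessThan_Suc_right)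

lemma sum_op_one [simp]: "sum_op a f (Suc 0) = 0"
  by (simp add: sum_op_def)

lemma geometric_sum_op_Suc: "1 \<le> n \<Longrightarrow> geometric_sum_op a b f (Suc n) = geometric_sum_op a b f n + fps_const (a n) * geo (b n) * f n"
  unfolding geometric_sum_op_def by (rule sum_atLeastLessThan_Suc_right)

lemma geometric_sum_op_one [simp]: "geometric_sum_op a b f (Suc 0) = 0"
  by (simp add: geometric_sum_op_def)

lemma intertwiner_prod_0 [simp]: "intertwiner_prod b i 0 = 1"
  by (simp add: intertwiner_prod_def)

lemma intertwiner_prod_Suc: "intertwiner_prod b i (Suc m) = intertwiner_prod b i m * rho b (i - Suc m)"
  by (simp add: intertwiner_prod_def)

text \<open>The factor with \<open>l = i\<close> is \<open>rho b 0 = 0\<close>, so row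
  \<open>i\<close> of T ends at column \<open>i\<close>.\<close>

lemma intertwiner_prod_diag [simp]: "1 \<le> i \<Longrightarrow> intertwiner_prod b i i = 0"
  by (cases i) (simp_all add: intertwiner_prod_Suc rho_def)

lemma intertwiner_prod_shift: "intertwiner_prod b (Suc i) (Suc m) = rho b i * intertwiner_prod b i m"
  by (induction m) (simp_all add: intertwiner_prod_Suc mult_ac)

lemma intertwiner_prod_pred:
  assumes "1 \<le> m" "m < i"
  shows "intertwiner_prod b i (m - 1) = (1 - fps_X * fps_const (b (i - m))) * intertwiner_prod b i m"
proof -
  obtain l where l: "m = Suc l" using assms by (cases m) auto
  have "intertwiner_prod b i m = intertwiner_prod b i l * geo (b (i - m))"
    using assms by (simp add: l intertwiner_prod_Suc rho_def)
  hence "(1 - fps_X * fps_const (b (i - m))) * intertwiner_prod b i m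
       = intertwiner_prod b i l * ((1 - fps_X * fps_const (b (i - m))) * geo (b (i - m)))"
    by (simp only: mult_ac)
  thus ?thesis by (simp add: geo_inverse l)
qed

text \<open>The kernel is a difference of consecutive products, so its row sum telescopes from 1 to
  \<open>intertwiner_prod b i i = 0\<close>.\<close>

lemma intertwiner_one: "1 \<le> i \<Longrightarrow> intertwiner b (\<lambda>_. 1) i = 1"
proof -
  assume i: "1 \<le> i"
  have "(\<Sum>m\<in>{1..j}. intertwiner_kernel b i m * 1) = 1 - intertwiner_prod b i j" for j
    by (induction j) (simp_all add: intertwiner_kernel_def)
  thus ?thesis using i by (simp add: intertwiner_def)
qed

text \<open>Summation by parts: the kernel is a difference in \<open>m\<close>, and the boundary
  term vanishes on the diagonal.\<close>

lemma intertwiner_sum_op: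
  assumes "1 \<le> i"
  shows "intertwiner b (sum_op a f) i = (\<Sum>m\<in>{1..<i}. intertwiner_prod b i m * fps_const (a m) * f m)"
proof -
  have "(\<Sum>m\<in>{1..j}. intertwiner_kernel b i m * sum_op a f m) =
        (\<Sum>m\<in>{1..<j}. intertwiner_prod b i m * fps_const (a m) * f m) - intertwiner_prod b i j * sum_op a f j" if "1 \<le> j" for j
    using that
  proof (induction j rule: dec_induct)
    case base
    show ?case by (simp add: intertwiner_kernel_def)
  next
    case (step j)
    thus ?case
      by (simp add: sum_op_Suc sum_atLeastLessThan_Suc_right intertwiner_kernel_def algebra_simps)
  qed
  thus ?thesis using assms by (simp add: intertwiner_def)
qed

text \<open>What is needed of \<open>a n = 1/[n]\<close> and \<open>b n = q^n/[n]\<close>: here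
  \<open>\<delta> = 1 - q\<close>, the addition formula encodes
  \<open>[d+m] = [d] + q^d [m]\<close>, and reflection encodes \<open>[N] = 0\<close>. A common
  rescaling of \<open>a\<close>, \<open>b\<close> and \<open>\<delta>\<close> preserves all three
  relations.\<close>

locale addition_weights =
  fixes a b :: "nat \<Rightarrow> 'a::comm_ring_1" and \<delta> :: 'a and N :: nat
  assumes a_eq: "\<And>n. 1 \<le> n \<Longrightarrow> n < N \<Longrightarrow> a n = b n + \<delta>"
    and addition: "\<And>d m. 1 \<le> d \<Longrightarrow> 1 \<le> m \<Longrightarrow> d + m < N \<Longrightarrow> b d * b m = b (d + m) * (b d + a m)"
    and reflection: "\<And>l. 1 \<le> l \<Longrightarrow> l < N \<Longrightarrow> b (N - l) = - a l"
    and N_pos: "1 \<le> N"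
begin

lemma addition': "1 \<le> d \<Longrightarrow> 1 \<le> m \<Longrightarrow> d + m < N \<Longrightarrow> a m * (b (d + m) - b d) = - a (d + m) * b d"
  using addition[of d m] a_eq[of m] a_eq[of "d + m"] by (simp add: algebra_simps)

text \<open>The entries of \<open>T X = X T (1 - xY)\<close>. Off the diagonal the kernel is
  \<open>-x b (i - m)\<close> times the product, so the addition formula with
  \<open>d = i - m\<close> applies; on the diagonal the product vanishes.\<close>

lemma intertwiner_kernel_b:
  assumes "1 \<le> m" "m \<le> i" "i < N"
  shows "intertwiner_kernel b i m * fps_const (b m) =
         fps_const (b i) * (intertwiner_kernel b i m - fps_X * intertwiner_prod b i m * fps_const (a m))"
proof (cases "m = i")
  case False
  define d where "d = i - m"
  have d: "1 \<le> d" "i = d + m" using False assms by (auto simp: d_def)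
  have "fps_const (b d * b m) = fps_const (b i * (b d + a m))"
    using addition[of d m] d assms by simp
  hence *: "fps_const (b d) * fps_const (b m) = fps_const (b i) * (fps_const (b d) + fps_const (a m))"
    by simp
  have T: "intertwiner_kernel b i m = - fps_X * intertwiner_prod b i m * fps_const (b d)"
    using intertwiner_prod_pred[of m i b] False assms by (simp add: intertwiner_kernel_def d_def algebra_simps)
  have "intertwiner_kernel b i m * fps_const (b m) = - fps_X * intertwiner_prod b i m * (fps_const (b d) * fps_const (b m))"
    by (simp only: T mult.assoc)
  also have "\<dots> = fps_const (b i) * (intertwiner_kernel b i m - fps_X * intertwiner_prod b i m * fps_const (a m))"
    unfolding * T by (simp add: algebra_simps del: fps_const_mult fps_const_add)
  finally show ?thesis .
qed (use assms in \<open>simp add: mult.commute\<close>)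

lemma intertwiner_b:
  assumes "1 \<le> i" "i < N"
  shows "intertwiner b (\<lambda>m. fps_const (b m) * f m) i =
         fps_const (b i) * (intertwiner b f i - fps_X * intertwiner b (sum_op a f) i)"
proof -
  have "intertwiner b (\<lambda>m. fps_const (b m) * f m) i = (\<Sum>m\<in>{1..i}. (intertwiner_kernel b i m * fps_const (b m)) * f m)"
    by (simp add: intertwiner_def mult.assoc)
  also have "\<dots> = (\<Sum>m\<in>{1..i}. fps_const (b i) * (intertwiner_kernel b i m * f m
                       - fps_X * (intertwiner_prod b i m * fps_const (a m) * f m)))"
    using assms by (intro sum.cong refl, subst intertwiner_kernel_b) (auto simp: algebra_simps)
  also have "\<dots> = fps_const (b i) * (intertwiner b f i
                    - fps_X * (\<Sum>m\<in>{1..i}. intertwiner_prod b i m * fps_const (a m) * f m))"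
    by (simp add: intertwiner_def sum_distrib_left sum_subtractf right_diff_distrib)
  also have "(\<Sum>m\<in>{1..i}. intertwiner_prod b i m * fps_const (a m) * f m) = intertwiner b (sum_op a f) i"
    unfolding intertwiner_sum_op[OF assms(1)] by (rule sum_drop_last) (use assms in auto)
  finally show ?thesis .
qed

text \<open>The increment of T Y from row \<open>i\<close> to row \<open>i + 1\<close>. The new row
  is the old one shifted by one column and multiplied by \<open>geo (b i)\<close>; what remains
  after extracting that factor is an instance of \<open>addition'\<close> with
  \<open>d = i - m\<close>.\<close>

lemma intertwiner_prod_step:
  assumes "1 \<le> m" "m \<le> i" "i < N"
  shows "intertwiner_prod b (Suc i) m * fps_const (a m) - intertwiner_prod b i m * fps_const (a m) =
         fps_const (a i) * geo (b i) * intertwiner_kernel b i m"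
proof -
  have sh: "intertwiner_prod b (Suc i) m = geo (b i) * intertwiner_prod b i (m - 1)"
    using intertwiner_prod_shift[of b i "m - 1"] assms by (simp add: rho_def)
  show ?thesis
  proof (cases "m = i")
    case False
    define d where "d = i - m"
    have d: "1 \<le> d" "i = d + m" using False assms by (auto simp: d_def)
    have "fps_const (a m * (b i - b d)) = fps_const (- a i * b d)"
      using addition'[of d m] d assms by simp
    hence *: "fps_const (a m) * (fps_const (b i) - fps_const (b d)) = - fps_const (a i) * fps_const (b d)"
      by simp
    have p: "intertwiner_prod b i (m - 1) = (1 - fps_X * fps_const (b d)) * intertwiner_prod b i m"
      using intertwiner_prod_pred[of m i b] False assms by (simp add: d_def)
    \<comment> \<open>Inserting \<open>geo (b i) * (1 - x b i) = 1\<close> lets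
      \<open>geo (b i)\<close> be factored out of both terms.\<close>
    have g: "intertwiner_prod b i m = geo (b i) * (1 - fps_X * fps_const (b i)) * intertwiner_prod b i m"
      using geo_inverse[of "b i"] by (simp add: mult.commute)
    have "intertwiner_prod b (Suc i) m * fps_const (a m) - intertwiner_prod b i m * fps_const (a m) =
          geo (b i) * intertwiner_prod b i (m - 1) * fps_const (a m)
          - (geo (b i) * (1 - fps_X * fps_const (b i)) * intertwiner_prod b i m) * fps_const (a m)"
      by (simp only: sh g[symmetric])
    also have "\<dots> = geo (b i) * fps_X * intertwiner_prod b i m
                    * (fps_const (a m) * (fps_const (b i) - fps_const (b d)))"
      unfolding p by (simp add: algebra_simps del: fps_const_mult fps_const_add fps_const_sub)
    also have "\<dots> = fps_const (a i) * geo (b i) * intertwiner_kernel b i m"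
      unfolding * intertwiner_kernel_def p by (simp add: algebra_simps del: fps_const_mult fps_const_neg)
    finally show ?thesis .
  qed (use assms sh in \<open>simp add: intertwiner_kernel_def mult_ac\<close>)
qed

text \<open>The relation \<open>T Y = Y (1 - xX)^(-1) T\<close>, by adding up the row increments. It
  reaches row \<open>N\<close> itself, one row further than \<open>intertwiner_b\<close>, because
  the last increment only involves row \<open>N - 1\<close> of T.\<close>

lemma intertwiner_sum_op_eq_geometric_sum_op:
  assumes "1 \<le> n" "n \<le> N"
  shows "intertwiner b (sum_op a f) n = geometric_sum_op a b (intertwiner b f) n"
  using assms
proof (induction n rule: dec_induct)
  case (step i)
  have "intertwiner b (sum_op a f) (Suc i) - intertwiner b (sum_op a f) i =
      (\<Sum>m\<in>{1..i}. intertwiner_prod b (Suc i) m * fps_const (a m) * f m)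
      - (\<Sum>m\<in>{1..i}. intertwiner_prod b i m * fps_const (a m) * f m)"
    using step sum_drop_last[of i "\<lambda>m. intertwiner_prod b i m * fps_const (a m) * f m"]
    by (simp only: intertwiner_sum_op le_SucI atLeastLessThanSuc_atLeastAtMost intertwiner_prod_diag mult_zero_left)
  also have "\<dots> = (\<Sum>m\<in>{1..i}. (intertwiner_prod b (Suc i) m * fps_const (a m) - intertwiner_prod b i m * fps_const (a m)) * f m)"
    by (simp add: sum_subtractf left_diff_distrib)
  also have "\<dots> = (\<Sum>m\<in>{1..i}. fps_const (a i) * geo (b i) * (intertwiner_kernel b i m * f m))"
    using step by (intro sum.cong refl) (simp only: intertwiner_prod_step atLeastAtMost_iff mult.assoc Suc_le_eq)
  also have "\<dots> = fps_const (a i) * geo (b i) * intertwiner b f i"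
    by (simp add: intertwiner_def sum_distrib_left)
  finally have "intertwiner b (sum_op a f) (Suc i) = intertwiner b (sum_op a f) i + fps_const (a i) * geo (b i) * intertwiner b f i"
    by (simp add: algebra_simps)
  thus ?case using step by (simp add: geometric_sum_op_Suc)
qed (simp add: intertwiner_sum_op)

end

section \<open>Sums over indices\<close>

text \<open>The left-hand side of the theorem for an arbitrary summand, so that the same recursions
  serve integers, complex numbers, polynomials and both target rings.\<close>

definition comp_sum :: "(nat list \<Rightarrow> 'a::comm_monoid_add) \<Rightarrow> nat list \<Rightarrow> nat \<Rightarrow> 'a" where
  "comp_sum F ks t = (\<Sum>ms\<in>comps (length ks) (length ks + t).
     \<Sum>as\<in>listset (map2 (\<lambda>k m. comps m (k + m - 1)) ks ms). F (concat as))"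

lemma length_le_sum_list_positive: "positive_index ms \<Longrightarrow> length ms \<le> sum_list ms"
  by (induction ms) auto

lemma comps_empty: "s < m \<Longrightarrow> comps m s = {}"
  using length_le_sum_list_positive by (fastforce simp: comps_def)

lemma comps_0: "comps 0 s = (if s = 0 then {[]} else {})"
  by (auto simp: comps_def)

lemma weak_comps_0: "weak_comps 0 s = (if s = 0 then {[]} else {})"
  by (auto simp: weak_comps_def)

lemma sum_comps_Suc:
  "(\<Sum>ms\<in>comps (Suc r) (Suc r + t). G ms) = (\<Sum>j\<le>t. \<Sum>ms\<in>comps r (r + (t - j)). G (Suc j # ms))"
proof -
  have "(\<Sum>j\<le>t. \<Sum>ms\<in>comps r (r + (t - j)). G (Suc j # ms)) =
        (\<Sum>(j, ms)\<in>Sigma {..t} (\<lambda>j. comps r (r + (t - j))). G (Suc j # ms))"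
    by (subst sum.Sigma) (auto simp: finite_comps)
  also have "\<dots> = (\<Sum>ms\<in>comps (Suc r) (Suc r + t). G ms)"
  proof (rule sum.reindex_bij_witness[of _ "\<lambda>ms. (hd ms - 1, tl ms)" "\<lambda>(j, ms). Suc j # ms"], goal_cases)
    case (4 ms)
    then obtain m ms' where ms: "ms = m # ms'" by (cases ms) (auto simp: comps_def)
    \<comment> \<open>The other \<open>r\<close> parts are at least 1 each, so the first part is at
      most \<open>t + 1\<close>.\<close>
    hence "length ms' \<le> sum_list ms'"
      using 4 length_le_sum_list_positive[of ms'] by (auto simp: comps_def)
    thus ?case using 4 ms by (auto simp: comps_def)
  qed (auto simp: comps_def neq_Nil_conv length_Suc_conv)
  finally show ?thesis ..
qed

lemma sum_weak_comps_Suc: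
  "(\<Sum>ms\<in>weak_comps (Suc r) s. G ms) = (\<Sum>j\<le>s. \<Sum>ms\<in>weak_comps r (s - j). G (j # ms))"
proof -
  have "(\<Sum>j\<le>s. \<Sum>ms\<in>weak_comps r (s - j). G (j # ms)) =
        (\<Sum>(j, ms)\<in>Sigma {..s} (\<lambda>j. weak_comps r (s - j)). G (j # ms))"
    by (subst sum.Sigma) (auto simp: finite_weak_comps)
  also have "\<dots> = (\<Sum>ms\<in>weak_comps (Suc r) s. G ms)"
    by (rule sum.reindex_bij_witness[of _ "\<lambda>ms. (hd ms, tl ms)" "\<lambda>(j, ms). j # ms"])
       (auto simp: weak_comps_def neq_Nil_conv length_Suc_conv)
  finally show ?thesis ..
qed

lemma finite_set_Cons: "finite A \<Longrightarrow> finite B \<Longrightarrow> finite (set_Cons A B)"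
proof -
  assume "finite A" "finite B"
  hence "finite ((\<lambda>(x, xs). x # xs) ` (A \<times> B))" by simp
  moreover have "set_Cons A B = (\<lambda>(x, xs). x # xs) ` (A \<times> B)" by (auto simp: set_Cons_def)
  ultimately show ?thesis by simp
qed

lemma sum_set_Cons:
  assumes "finite A" "finite B"
  shows "(\<Sum>xs\<in>set_Cons A B. f xs) = (\<Sum>x\<in>A. \<Sum>xs\<in>B. f (x # xs))"
proof -
  have "set_Cons A B = (\<lambda>(x, xs). x # xs) ` (A \<times> B)" by (auto simp: set_Cons_def)
  moreover have "inj_on (\<lambda>(x, xs). x # xs) (A \<times> B)" by (auto simp: inj_on_def)
  ultimately have "(\<Sum>xs\<in>set_Cons A B. f xs) = (\<Sum>(x, xs)\<in>A \<times> B. f (x # xs))"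
    by (simp add: sum.reindex case_prod_unfold)
  thus ?thesis by (simp add: sum.cartesian_product)
qed

lemma finite_listset: "(\<And>A. A \<in> set As \<Longrightarrow> finite A) \<Longrightarrow> finite (listset As)"
  by (induction As) (auto intro: finite_set_Cons)

lemma finite_listset_comps: "finite (listset (map2 (\<lambda>k m. comps m (k + m - 1)) ks ms))"
  by (rule finite_listset) (auto simp: finite_comps)

lemma comp_sum_Nil: "comp_sum F [] t = (if t = 0 then F [] else 0)"
  by (simp add: comp_sum_def comps_0)

lemma comp_sum_Cons:
  "comp_sum F (k # ks) t = (\<Sum>j\<le>t. \<Sum>a\<in>comps (Suc j) (k + j). comp_sum (\<lambda>as. F (a @ as)) ks (t - j))"
proof -
  have "comp_sum F (k # ks) t = (\<Sum>j\<le>t. \<Sum>ms\<in>comps (length ks) (length ks + (t - j)).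
     \<Sum>a\<in>comps (Suc j) (k + j).
     \<Sum>as\<in>listset (map2 (\<lambda>k m. comps m (k + m - 1)) ks ms). F (a @ concat as))"
    unfolding comp_sum_def list.size add_Suc_right add_0_right
    by (subst sum_comps_Suc, intro sum.cong refl)
       (simp add: sum_set_Cons finite_comps finite_listset_comps del: One_nat_def)
  also have "\<dots> = (\<Sum>j\<le>t. \<Sum>a\<in>comps (Suc j) (k + j). comp_sum (\<lambda>as. F (a @ as)) ks (t - j))"
    unfolding comp_sum_def by (intro sum.cong refl sum.swap)
  finally show ?thesis .
qed

lemma comp_sum_cong:
  assumes "k \<ge> 1" "\<And>a as. a \<ge> 1 \<Longrightarrow> F (a # as) = G (a # as)"
  shows "comp_sum F (k # ks) t = comp_sum G (k # ks) t"
  unfolding comp_sum_Cons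
proof (intro sum.cong refl)
  fix j a assume "a \<in> comps (Suc j) (k + j)"
  then obtain a1 a' where "a = a1 # a'" "a1 \<ge> 1"
    by (cases a) (auto simp: comps_def)
  thus "comp_sum (\<lambda>as. F (a @ as)) ks (t - j) = comp_sum (\<lambda>as. G (a @ as)) ks (t - j)"
    using assms(2) by simp
qed

lemma comp_sum_linear:
  fixes G :: "'b \<Rightarrow> nat list \<Rightarrow> 'a::semiring_0"
  shows "comp_sum (\<lambda>as. \<Sum>m\<in>M. c m * G m as) ks t = (\<Sum>m\<in>M. c m * comp_sum (G m) ks t)"
proof -
  have "comp_sum (\<lambda>as. \<Sum>m\<in>M. c m * G m as) ks t =
     (\<Sum>ms\<in>comps (length ks) (length ks + t). \<Sum>m\<in>M. c m *
        (\<Sum>as\<in>listset (map2 (\<lambda>k m. comps m (k + m - 1)) ks ms). G m (concat as)))"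
    unfolding comp_sum_def by (intro sum.cong refl, subst sum.swap) (simp add: sum_distrib_left)
  also have "\<dots> = (\<Sum>m\<in>M. c m * comp_sum (G m) ks t)"
    unfolding comp_sum_def by (subst sum.swap) (simp add: sum_distrib_left)
  finally show ?thesis .
qed

lemma sum_comps_split:
  assumes "s \<ge> 1"
  shows "(\<Sum>a\<in>comps (Suc j) s. F a) =
         (\<Sum>a\<in>comps j (s - 1). F (1 # a)) + (\<Sum>a\<in>comps (Suc j) (s - 1). F (Suc (hd a) # tl a))"
proof -
  let ?A = "comps (Suc j) s"
  have "(\<Sum>a\<in>?A. F a) = (\<Sum>a\<in>{a\<in>?A. hd a = 1}. F a) + (\<Sum>a\<in>{a\<in>?A. hd a \<noteq> 1}. F a)"
    by (subst sum.union_disjoint[symmetric]) (auto simp: finite_comps intro!: sum.cong)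
  also have "(\<Sum>a\<in>{a\<in>?A. hd a = 1}. F a) = (\<Sum>a\<in>comps j (s - 1). F (1 # a))"
    by (rule sum.reindex_bij_witness[of _ "\<lambda>a. 1 # a" tl])
       (use assms in \<open>auto simp: comps_def length_Suc_conv\<close>)
  also have "(\<Sum>a\<in>{a\<in>?A. hd a \<noteq> 1}. F a) = (\<Sum>a\<in>comps (Suc j) (s - 1). F (Suc (hd a) # tl a))"
    by (rule sum.reindex_bij_witness[of _ "\<lambda>a. Suc (hd a) # tl a" "\<lambda>a. (hd a - 1) # tl a"])
       (use assms in \<open>auto simp: comps_def length_Suc_conv\<close>)
  finally show ?thesis .
qed

text \<open>For \<open>k = 1\<close> the first block consists of ones only. Removing one of them
  either exhausts the block or leaves a shorter block of ones, with one unit of \<open>t\<close>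
  used up.\<close>

lemma comp_sum_one_Cons:
  "comp_sum F (1 # ks) t = comp_sum (\<lambda>as. F (1 # as)) ks t +
     (if t = 0 then 0 else comp_sum (\<lambda>as. F (1 # as)) (1 # ks) (t - 1))"
proof -
  have *: "(\<Sum>a\<in>comps (Suc j) (1 + j). H a) = (\<Sum>a\<in>comps j j. H (1 # a))"
    for j and H :: "nat list \<Rightarrow> 'a"
    by (subst sum_comps_split) (simp_all add: comps_empty)
  have "comp_sum F (1 # ks) t = (\<Sum>j\<le>t. \<Sum>a\<in>comps j j. comp_sum (\<lambda>as. F (1 # a @ as)) ks (t - j))"
    by (simp add: comp_sum_Cons * del: One_nat_def)
  also have "\<dots> = comp_sum (\<lambda>as. F (1 # as)) ks t +
     (if t = 0 then 0 else comp_sum (\<lambda>as. F (1 # as)) (1 # ks) (t - 1))"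
  proof (cases t)
    case (Suc t')
    show ?thesis unfolding Suc sum.atMost_Suc_shift comp_sum_Cons by (simp add: comps_0)
  qed (simp add: comps_0)
  finally show ?thesis .
qed

text \<open>The first entry of the first block is either at least 2, and lowering it by 1 lowers
  \<open>Suc k\<close> to \<open>k\<close>, or it is 1, and removing it leaves a block for the same
  \<open>Suc k\<close> with one unit of \<open>t\<close> used up.\<close>

lemma comp_sum_Suc_Cons:
  assumes "k \<ge> 1"
  shows "comp_sum F (Suc k # ks) t = comp_sum (\<lambda>as. F (Suc (hd as) # tl as)) (k # ks) t +
     (if t = 0 then 0 else comp_sum (\<lambda>as. F (1 # as)) (Suc k # ks) (t - 1))"
proof -
  have *: "(\<Sum>a\<in>comps (Suc j) (Suc k + j). H a) =
      (\<Sum>a\<in>comps j (k + j). H (1 # a)) + (\<Sum>a\<in>comps (Suc j) (k + j). H (Suc (hd a) # tl a))"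
    for j and H :: "nat list \<Rightarrow> 'a"
    by (subst sum_comps_split) simp_all
  have "comp_sum F (Suc k # ks) t =
      (\<Sum>j\<le>t. \<Sum>a\<in>comps j (k + j). comp_sum (\<lambda>as. F (1 # a @ as)) ks (t - j)) +
      (\<Sum>j\<le>t. \<Sum>a\<in>comps (Suc j) (k + j). comp_sum (\<lambda>as. F (Suc (hd a) # tl a @ as)) ks (t - j))"
    by (simp add: comp_sum_Cons[of F] * sum.distrib del: One_nat_def add_Suc)
  also have "(\<Sum>j\<le>t. \<Sum>a\<in>comps (Suc j) (k + j). comp_sum (\<lambda>as. F (Suc (hd a) # tl a @ as)) ks (t - j)) =
      comp_sum (\<lambda>as. F (Suc (hd as) # tl as)) (k # ks) t"
    unfolding comp_sum_Cons
  proof (intro sum.cong refl)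
    fix j a assume "a \<in> comps (Suc j) (k + j)"
    hence "a \<noteq> []" by (auto simp: comps_def)
    thus "comp_sum (\<lambda>as. F (Suc (hd a) # tl a @ as)) ks (t - j) =
          comp_sum (\<lambda>as. F (Suc (hd (a @ as)) # tl (a @ as))) ks (t - j)" by simp
  qed
  also have "(\<Sum>j\<le>t. \<Sum>a\<in>comps j (k + j). comp_sum (\<lambda>as. F (1 # a @ as)) ks (t - j)) =
      (if t = 0 then 0 else comp_sum (\<lambda>as. F (1 # as)) (Suc k # ks) (t - 1))"
  proof (cases t)
    case 0
    thus ?thesis using assms by (simp add: comps_0)
  next
    case (Suc t')
    show ?thesis using assms unfolding Suc sum.atMost_Suc_shift comp_sum_Cons by (simp add: comps_0)
  qed
  finally show ?thesis by (simp add: add.commute)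
qed

section \<open>Sums over increments and inserted ones\<close>

definition ext_sum :: "(nat list \<Rightarrow> 'a::comm_monoid_add) \<Rightarrow> nat list \<Rightarrow> nat \<Rightarrow> 'a" where
  "ext_sum F ks l = (\<Sum>es\<in>weak_comps (length ks) l. F (map2 (+) ks es))"

lemma ext_sum_Nil: "ext_sum F [] l = (if l = 0 then F [] else 0)"
  by (simp add: ext_sum_def weak_comps_0)

lemma ext_sum_Cons: "ext_sum F (k # ks) l = (\<Sum>j\<le>l. ext_sum (\<lambda>as. F ((k + j) # as)) ks (l - j))"
  by (simp add: ext_sum_def sum_weak_comps_Suc)

text \<open>\<open>interleave_ones [m\<^sub>1, \<dots>, m\<^sub>r] [k\<^sub>1, \<dots>, k\<^sub>r]\<close> is
  \<open>({1}\<^bsup>m\<^sub>1\<^esup>, k\<^sub>1, \<dots>, {1}\<^bsup>m\<^sub>r\<^esup>, k\<^sub>r)\<close>.\<close>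

definition interleave_ones :: "nat list \<Rightarrow> nat list \<Rightarrow> nat list" where
  "interleave_ones ms ks = concat (map2 (\<lambda>m k. replicate m 1 @ [k]) ms ks)"

lemma insert_ones_Cons:
  "length ms = length ks \<Longrightarrow> insert_ones (k # ks) ms = k # interleave_ones ms ks"
proof (induction ks arbitrary: k ms)
  case Nil
  thus ?case by (simp add: insert_ones_def interleave_ones_def)
next
  case (Cons k' ks)
  then obtain m ms' where ms: "ms = m # ms'" "length ms' = length ks" by (cases ms) auto
  have "insert_ones (k # k' # ks) ms = k # replicate m 1 @ insert_ones (k' # ks) ms'"
    by (simp add: insert_ones_def ms)
  thus ?case using Cons.IH[of ms' k'] ms by (simp add: interleave_ones_def)
qed

text \<open>The right-hand side of the theorem behind its leading entry: every remaining entry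
  carries the block of ones in front of it, which makes the recursion on \<open>ks\<close>
  uniform.\<close>

definition ones_sum :: "(nat list \<Rightarrow> 'a::comm_monoid_add) \<Rightarrow> nat list \<Rightarrow> nat \<Rightarrow> 'a" where
  "ones_sum F ks t = (\<Sum>l\<le>t. \<Sum>ms\<in>weak_comps (length ks) (t - l). ext_sum F (interleave_ones ms ks) l)"

lemma ones_sum_Nil: "ones_sum F [] t = (if t = 0 then F [] else 0)"
proof -
  have "ones_sum F [] t = (\<Sum>l\<le>t. if l = t then (if t = 0 then F [] else 0) else 0)"
    unfolding ones_sum_def by (intro sum.cong refl) (auto simp: weak_comps_0 interleave_ones_def ext_sum_Nil)
  thus ?thesis by simp
qed

text \<open>The increment \<open>j\<close> of the first entry becomes the outer variable, and
  \<open>l\<close> then counts only the increments of the tail.\<close>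

lemma sum_ext_sum_Cons:
  "(\<Sum>l\<le>t. \<Sum>ms\<in>W (t - l). ext_sum F (k # g ms) l) =
   (\<Sum>j\<le>t. \<Sum>l\<le>t - j. \<Sum>ms\<in>W (t - j - l). ext_sum (\<lambda>as. F ((k + j) # as)) (g ms) l)"
proof -
  have "(\<Sum>l\<le>t. \<Sum>ms\<in>W (t - l). ext_sum F (k # g ms) l) =
        (\<Sum>l\<le>t. \<Sum>j\<le>l. \<Sum>ms\<in>W (t - l). ext_sum (\<lambda>as. F ((k + j) # as)) (g ms) (l - j))"
    unfolding ext_sum_Cons by (intro sum.cong refl sum.swap)
  also have "\<dots> = (\<Sum>(l, j)\<in>(SIGMA l:{..t}. {..l}).
                    \<Sum>ms\<in>W (t - l). ext_sum (\<lambda>as. F ((k + j) # as)) (g ms) (l - j))"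
    by (subst sum.Sigma) auto
  also have "\<dots> = (\<Sum>(j, l)\<in>(SIGMA j:{..t}. {..t - j}).
                    \<Sum>ms\<in>W (t - j - l). ext_sum (\<lambda>as. F ((k + j) # as)) (g ms) l)"
    by (rule sum.reindex_bij_witness[of _ "\<lambda>(j, l). (j + l, j)" "\<lambda>(l, j). (j, l - j)"]) auto
  also have "\<dots> = (\<Sum>j\<le>t. \<Sum>l\<le>t - j. \<Sum>ms\<in>W (t - j - l). ext_sum (\<lambda>as. F ((k + j) # as)) (g ms) l)"
    by (subst sum.Sigma) auto
  finally show ?thesis .
qed

lemma insert_ones_sum:
  "(\<Sum>l=0..t. \<Sum>ms\<in>weak_comps (length ks) (t - l).
      \<Sum>es\<in>weak_comps (length (insert_ones (k # ks) ms)) l. F (map2 (+) (insert_ones (k # ks) ms) es)) =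
   (\<Sum>j\<le>t. ones_sum (\<lambda>as. F ((k + j) # as)) ks (t - j))"
proof -
  have "(\<Sum>l=0..t. \<Sum>ms\<in>weak_comps (length ks) (t - l).
      \<Sum>es\<in>weak_comps (length (insert_ones (k # ks) ms)) l. F (map2 (+) (insert_ones (k # ks) ms) es)) =
     (\<Sum>l\<le>t. \<Sum>ms\<in>weak_comps (length ks) (t - l). ext_sum F (k # interleave_ones ms ks) l)"
    unfolding ext_sum_def atMost_atLeast0
    by (intro sum.cong refl) (auto simp: weak_comps_def insert_ones_Cons)
  also have "\<dots> = (\<Sum>j\<le>t. ones_sum (\<lambda>as. F ((k + j) # as)) ks (t - j))"
    unfolding ones_sum_def by (rule sum_ext_sum_Cons)
  finally show ?thesis .
qed

text \<open>Either the first block of ones is empty and the list begins with \<open>k + j\<close>,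
  or a leading one, raised to \<open>Suc j\<close>, is split off at the cost of one unit of
  \<open>t\<close>.\<close>

lemma ones_sum_Cons:
  "ones_sum F (k # ks) t = (\<Sum>j\<le>t. ones_sum (\<lambda>as. F ((k + j) # as)) ks (t - j)) +
     (if t = 0 then 0 else \<Sum>j\<le>t - 1. ones_sum (\<lambda>as. F (Suc j # as)) (k # ks) (t - 1 - j))"
proof -
  let ?r = "length ks"
  have split: "(\<Sum>ms\<in>weak_comps (Suc ?r) s. H ms) = (\<Sum>ms\<in>weak_comps ?r s. H (0 # ms)) +
      (if s = 0 then 0 else \<Sum>ms\<in>weak_comps (Suc ?r) (s - 1). H (Suc (hd ms) # tl ms))"
    for s and H :: "nat list \<Rightarrow> 'a"
    by (cases s) (simp_all add: sum_weak_comps_Suc sum.atMost_Suc_shift del: sum.atMost_Suc)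
  have "ones_sum F (k # ks) t = (\<Sum>l\<le>t.
     (\<Sum>ms\<in>weak_comps ?r (t - l). ext_sum F (interleave_ones (0 # ms) (k # ks)) l) +
     (if t - l = 0 then 0 else \<Sum>ms\<in>weak_comps (Suc ?r) (t - l - 1).
        ext_sum F (interleave_ones (Suc (hd ms) # tl ms) (k # ks)) l))"
    unfolding ones_sum_def list.size add_Suc_right add_0_right
    by (intro sum.cong refl, rule split)
  also have "\<dots> =
     (\<Sum>l\<le>t. \<Sum>ms\<in>weak_comps ?r (t - l). ext_sum F (k # interleave_ones ms ks) l) +
     (\<Sum>l\<le>t. if t - l = 0 then 0 else \<Sum>ms\<in>weak_comps (Suc ?r) (t - l - 1).
        ext_sum F (interleave_ones (Suc (hd ms) # tl ms) (k # ks)) l)"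
    by (simp add: sum.distrib interleave_ones_def)
  also have "(\<Sum>l\<le>t. \<Sum>ms\<in>weak_comps ?r (t - l). ext_sum F (k # interleave_ones ms ks) l) =
     (\<Sum>j\<le>t. ones_sum (\<lambda>as. F ((k + j) # as)) ks (t - j))"
    unfolding ones_sum_def by (rule sum_ext_sum_Cons)
  also have "(\<Sum>l\<le>t. if t - l = 0 then 0 else \<Sum>ms\<in>weak_comps (Suc ?r) (t - l - 1).
        ext_sum F (interleave_ones (Suc (hd ms) # tl ms) (k # ks)) l) =
      (if t = 0 then 0 else \<Sum>j\<le>t - 1. ones_sum (\<lambda>as. F (Suc j # as)) (k # ks) (t - 1 - j))"
  proof (cases t)
    case (Suc t')
    have il: "interleave_ones (Suc (hd ms) # tl ms) (k # ks) = 1 # interleave_ones ms (k # ks)"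
      if "ms \<in> weak_comps (Suc ?r) s" for ms s
      using that by (cases ms) (auto simp: weak_comps_def interleave_ones_def)
    have "(\<Sum>l\<le>t. if t - l = 0 then 0 else \<Sum>ms\<in>weak_comps (Suc ?r) (t - l - 1).
        ext_sum F (interleave_ones (Suc (hd ms) # tl ms) (k # ks)) l) =
        (\<Sum>l\<le>t'. \<Sum>ms\<in>weak_comps (Suc ?r) (t' - l). ext_sum F (1 # interleave_ones ms (k # ks)) l)"
      unfolding Suc by (auto simp: il Suc_diff_le intro!: sum.cong)
    also have "\<dots> = (\<Sum>j\<le>t'. ones_sum (\<lambda>as. F ((1 + j) # as)) (k # ks) (t' - j))"
      unfolding ones_sum_def list.size add_Suc_right add_0_right by (rule sum_ext_sum_Cons)
    finally show ?thesis by (simp add: Suc)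
  qed simp
  finally show ?thesis .
qed

lemma ones_sum_linear:
  fixes G :: "'b \<Rightarrow> nat list \<Rightarrow> 'a::semiring_0"
  shows "ones_sum (\<lambda>as. \<Sum>m\<in>M. c m * G m as) ks t = (\<Sum>m\<in>M. c m * ones_sum (G m) ks t)"
proof -
  have 1: "ext_sum (\<lambda>as. \<Sum>m\<in>M. c m * G m as) is l = (\<Sum>m\<in>M. c m * ext_sum (G m) is l)" for "is" l
    unfolding ext_sum_def by (subst sum.swap) (simp add: sum_distrib_left)
  have "ones_sum (\<lambda>as. \<Sum>m\<in>M. c m * G m as) ks t =
     (\<Sum>l\<le>t. \<Sum>m\<in>M. c m * (\<Sum>ms\<in>weak_comps (length ks) (t - l). ext_sum (G m) (interleave_ones ms ks) l))"
    unfolding ones_sum_def 1 by (intro sum.cong refl, subst sum.swap) (simp add: sum_distrib_left)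
  also have "\<dots> = (\<Sum>m\<in>M. c m * ones_sum (G m) ks t)"
    unfolding ones_sum_def by (subst sum.swap) (simp add: sum_distrib_left)
  finally show ?thesis .
qed

section \<open>Positivity of the occurring indices and transfer of additive relations\<close>

lemma listset_mem_Cons: "xs \<in> listset (A # As) \<longleftrightarrow> (\<exists>y ys. xs = y # ys \<and> y \<in> A \<and> ys \<in> listset As)"
  by (auto simp: set_Cons_def)

lemma positive_index_append [simp]: "positive_index (xs @ ys) \<longleftrightarrow> positive_index xs \<and> positive_index ys"
  by (auto simp: positive_index_def)

lemma positive_index_replicate [simp]: "positive_index (replicate m (Suc 0))"
  by (auto simp: positive_index_def)

lemma positive_index_concat_listset:
  "as \<in> listset (map2 (\<lambda>k m. comps m (k + m - 1)) ks ms) \<Longrightarrow> positive_index (concat as)"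
proof (induction ks ms arbitrary: as rule: list_induct2')
  case (4 k ks m ms)
  thus ?case by (auto simp: listset_mem_Cons comps_def simp del: listset.simps)
qed auto

lemma positive_index_map2_add: "positive_index ks \<Longrightarrow> length es = length ks \<Longrightarrow> positive_index (map2 (+) ks es)"
  by (induction ks es rule: list_induct2') auto

lemma positive_index_interleave_ones:
  "positive_index ks \<Longrightarrow> positive_index (interleave_ones ms ks)"
  by (induction ms ks rule: list_induct2') (auto simp: interleave_ones_def)

text \<open>Transfer principle for any relation compatible with 0 and addition. It is applied to
  equality, to residues modulo \<open>p\<close>, to \<open>represents\<close> and to the passage to
  classes in \<open>calS\<close>.\<close>

lemma sum_related:
  assumes "P 0 0" "\<And>x y x' y'. P x x' \<Longrightarrow> P y y' \<Longrightarrow> P (x + y) (x' + y')"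
    and "\<And>i. i \<in> A \<Longrightarrow> P (f i) (g i)"
  shows "P (sum f A) (sum g A)"
  using assms(3) by (induction A rule: infinite_finite_induct) (auto intro: assms(1,2))

lemma comp_sum_related:
  assumes "P 0 0" "\<And>x y x' y'. P x x' \<Longrightarrow> P y y' \<Longrightarrow> P (x + y) (x' + y')"
    and "\<And>as. positive_index as \<Longrightarrow> P (F as) (G as)"
  shows "P (comp_sum F ks t) (comp_sum G ks t)"
  unfolding comp_sum_def
  by (intro sum_related[where P = P] assms positive_index_concat_listset)

lemma ones_sum_related:
  assumes "P 0 0" "\<And>x y x' y'. P x x' \<Longrightarrow> P y y' \<Longrightarrow> P (x + y) (x' + y')"
    and "positive_index ks" "\<And>as. positive_index as \<Longrightarrow> P (F as) (G as)"
  shows "P (ones_sum F ks t) (ones_sum G ks t)"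
  unfolding ones_sum_def ext_sum_def
  by (intro sum_related[where P = P] assms positive_index_map2_add positive_index_interleave_ones)
     (auto simp: weak_comps_def)

section \<open>The generating series identity\<close>

definition comp_series :: "(nat \<Rightarrow> 'a::comm_ring_1) \<Rightarrow> (nat \<Rightarrow> 'a) \<Rightarrow> nat list \<Rightarrow> nat \<Rightarrow> 'a fps" where
  "comp_series a b ks n = Abs_fps (comp_sum (\<lambda>as. zsum a b as n) ks)"

text \<open>The series \<open>P\<close> with \<open>comp_series = Y P\<close>: the factor \<open>a\<close> of the outermost summation is stripped.\<close>

definition inner_comp_series :: "(nat \<Rightarrow> 'a::comm_ring_1) \<Rightarrow> (nat \<Rightarrow> 'a) \<Rightarrow> nat \<Rightarrow> nat list \<Rightarrow> nat \<Rightarrow> 'a fps" where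
  "inner_comp_series a b k ks n = Abs_fps (comp_sum (\<lambda>as. b n ^ (hd as - 1) * zsum a b (tl as) n) (k # ks))"

definition ones_series :: "(nat \<Rightarrow> 'a::comm_ring_1) \<Rightarrow> (nat \<Rightarrow> 'a) \<Rightarrow> nat list \<Rightarrow> nat \<Rightarrow> 'a fps" where
  "ones_series a b ks n = Abs_fps (ones_sum (\<lambda>as. zsum a b as n) ks)"

definition insert_ones_series :: "(nat \<Rightarrow> 'a::comm_ring_1) \<Rightarrow> (nat \<Rightarrow> 'a) \<Rightarrow> nat \<Rightarrow> nat list \<Rightarrow> nat \<Rightarrow> 'a fps" where
  "insert_ones_series a b k ks n = Abs_fps (\<lambda>t. \<Sum>j\<le>t. ones_sum (\<lambda>as. zsum a b ((k + j) # as) n) ks (t - j))"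

lemma comp_series_Nil: "comp_series a b [] n = 1"
  by (rule fps_ext) (simp add: comp_series_def comp_sum_Nil)

lemma ones_series_Nil: "ones_series a b [] n = 1"
  by (rule fps_ext) (simp add: ones_series_def ones_sum_Nil)

lemma comp_series_Cons:
  assumes "k \<ge> 1"
  shows "comp_series a b (k # ks) n = sum_op a (inner_comp_series a b k ks) n"
proof (rule fps_ext)
  fix t
  have "fps_nth (comp_series a b (k # ks) n) t =
        comp_sum (\<lambda>as. \<Sum>m\<in>{1..<n}. a m * (b m ^ (hd as - 1) * zsum a b (tl as) m)) (k # ks) t"
    unfolding comp_series_def fps_nth_Abs_fps
    by (rule comp_sum_cong[OF assms]) (simp add: mult.assoc)
  also have "\<dots> = fps_nth (sum_op a (inner_comp_series a b k ks) n) t"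
    by (simp add: comp_sum_linear sum_op_def inner_comp_series_def fps_sum_nth)
  finally show "fps_nth (comp_series a b (k # ks) n) t = fps_nth (sum_op a (inner_comp_series a b k ks) n) t" .
qed

lemma inner_comp_series_one: "inner_comp_series a b 1 ks n = comp_series a b ks n + fps_X * comp_series a b (1 # ks) n"
  by (rule fps_ext) (simp add: inner_comp_series_def comp_series_def comp_sum_one_Cons[unfolded One_nat_def])

text \<open>Lowering a first entry of at least 2 by one splits off a factor \<open>b n\<close>; a
  first entry 1 contributes no power of \<open>b n\<close> and leaves the full series with a factor
  \<open>x\<close>.\<close>

lemma inner_comp_series_Suc:
  assumes "k \<ge> 1"
  shows "inner_comp_series a b (Suc k) ks n = fps_const (b n) * inner_comp_series a b k ks n + fps_X * comp_series a b (Suc k # ks) n"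
proof (rule fps_ext)
  fix t
  have "comp_sum (\<lambda>as. b n ^ hd as * zsum a b (tl as) n) (k # ks) t =
        comp_sum (\<lambda>as. \<Sum>m\<in>{n}. b m * (b m ^ (hd as - 1) * zsum a b (tl as) m)) (k # ks) t"
  proof (rule comp_sum_cong[OF assms])
    fix c as assume "(c::nat) \<ge> 1"
    thus "b n ^ hd (c # as) * zsum a b (tl (c # as)) n =
          (\<Sum>m\<in>{n}. b m * (b m ^ (hd (c # as) - 1) * zsum a b (tl (c # as)) m))"
      by (cases c) (simp_all add: mult.assoc)
  qed
  also have "\<dots> = b n * fps_nth (inner_comp_series a b k ks n) t"
    unfolding comp_sum_linear by (simp add: inner_comp_series_def)
  finally show "fps_nth (inner_comp_series a b (Suc k) ks n) t =
      fps_nth (fps_const (b n) * inner_comp_series a b k ks n + fps_X * comp_series a b (Suc k # ks) n) t"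
    by (simp add: inner_comp_series_def comp_series_def comp_sum_Suc_Cons[OF assms])
qed

text \<open>The increments of the leading entry form a geometric series in \<open>x b\<close>, which
  is the factor \<open>(1 - xX)^(-1)\<close>.\<close>

lemma insert_ones_series_eq:
  assumes "k \<ge> 1"
  shows "insert_ones_series a b k ks n = geometric_sum_op a b (\<lambda>m. fps_const (b m) ^ (k - 1) * ones_series a b ks m) n"
proof (rule fps_ext)
  fix t
  obtain l where k: "k = Suc l" using assms by (cases k) auto
  have "ones_sum (\<lambda>as. zsum a b ((k + j) # as) n) ks s =
        (\<Sum>m\<in>{1..<n}. a m * b m ^ (l + j) * fps_nth (ones_series a b ks m) s)" for j s
    using ones_sum_linear[of "\<lambda>m. a m * b m ^ (l + j)" "\<lambda>m as. zsum a b as m" "{1..<n}" ks s]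
    by (simp add: ones_series_def k)
  hence "fps_nth (insert_ones_series a b k ks n) t =
      (\<Sum>j\<le>t. \<Sum>m\<in>{1..<n}. a m * b m ^ (l + j) * fps_nth (ones_series a b ks m) (t - j))"
    by (simp only: insert_ones_series_def fps_nth_Abs_fps)
  also have "\<dots> = (\<Sum>m\<in>{1..<n}. \<Sum>j\<le>t. a m * b m ^ (l + j) * fps_nth (ones_series a b ks m) (t - j))"
    by (rule sum.swap)
  also have "\<dots> = fps_nth (geometric_sum_op a b (\<lambda>m. fps_const (b m) ^ (k - 1) * ones_series a b ks m) n) t"
    unfolding geometric_sum_op_def fps_sum_nth
  proof (intro sum.cong refl)
    fix m
    have "fps_const (a m) * geo (b m) * (fps_const (b m) ^ (k - 1) * ones_series a b ks m) =
          fps_const (a m) * (fps_const (b m ^ l) * (geo (b m) * ones_series a b ks m))"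
      by (simp add: k fps_const_power mult.assoc mult.left_commute del: fps_const_mult)
    thus "(\<Sum>j\<le>t. a m * b m ^ (l + j) * fps_nth (ones_series a b ks m) (t - j)) =
        fps_nth (fps_const (a m) * geo (b m) * (fps_const (b m) ^ (k - 1) * ones_series a b ks m)) t"
      by (simp only: fps_mult_left_const_nth fps_mult_nth[of "geo _"] geo_nth sum_distrib_left
            atMost_atLeast0 power_add mult.assoc)
  qed
  finally show "fps_nth (insert_ones_series a b k ks n) t =
      fps_nth (geometric_sum_op a b (\<lambda>m. fps_const (b m) ^ (k - 1) * ones_series a b ks m) n) t" .
qed

text \<open>A leading one with its increments is a leading entry \<open>k = 1\<close> in
  \<open>insert_ones_series\<close>, which turns \<open>ones_sum_Cons\<close> into an equation for
  \<open>ones_series\<close>.\<close>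

lemma ones_series_Cons: "ones_series a b (k # ks) n = insert_ones_series a b k ks n + fps_X * geometric_sum_op a b (ones_series a b (k # ks)) n"
proof -
  have "geometric_sum_op a b (ones_series a b (k # ks)) n = insert_ones_series a b 1 (k # ks) n"
    by (simp add: insert_ones_series_eq)
  moreover have "ones_series a b (k # ks) n = insert_ones_series a b k ks n + fps_X * insert_ones_series a b 1 (k # ks) n"
  proof (rule fps_ext)
    fix t
    show "fps_nth (ones_series a b (k # ks) n) t = fps_nth (insert_ones_series a b k ks n + fps_X * insert_ones_series a b 1 (k # ks) n) t"
      using ones_sum_Cons[of "\<lambda>as. zsum a b as n" k ks t]
      by (simp add: ones_series_def insert_ones_series_def del: zsum.simps)
  qed
  ultimately show ?thesis by simp
qed

lemma intertwiner_diff: "intertwiner b (\<lambda>m. f m - fps_X * g m) n = intertwiner b f n - fps_X * intertwiner b g n"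
  by (simp add: intertwiner_def sum_subtractf sum_distrib_left right_diff_distrib mult_ac)

lemma geometric_sum_op_add: "geometric_sum_op a b (\<lambda>m. f m + fps_X * g m) n = geometric_sum_op a b f n + fps_X * geometric_sum_op a b g n"
  by (simp add: geometric_sum_op_def sum.distrib sum_distrib_left distrib_left mult_ac)

lemma geometric_sum_op_cong: "(\<And>m. 1 \<le> m \<Longrightarrow> m < n \<Longrightarrow> f m = g m) \<Longrightarrow> geometric_sum_op a b f n = geometric_sum_op a b g n"
  by (simp add: geometric_sum_op_def)

context addition_weights
begin

text \<open>With P and L = Y P for the inner and full series,
  \<open>P_(k+1) - x L_(k+1) = X P_k\<close>, and \<open>T X P_k = X T (P_k - x L_k)\<close>. So
  each increase of \<open>k\<close> contributes one factor \<open>b n\<close>.\<close>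

lemma intertwiner_inner_comp_series:
  assumes "k \<ge> 1" "1 \<le> n" "n < N"
  shows "intertwiner b (\<lambda>m. inner_comp_series a b k ks m - fps_X * comp_series a b (k # ks) m) n =
         fps_const (b n) ^ (k - 1) * intertwiner b (comp_series a b ks) n"
  using assms(1)
proof (induction k rule: dec_induct)
  case base
  show ?case by (simp add: inner_comp_series_one[unfolded One_nat_def])
next
  case (step k)
  have "intertwiner b (\<lambda>m. inner_comp_series a b (Suc k) ks m - fps_X * comp_series a b (Suc k # ks) m) n =
        intertwiner b (\<lambda>m. fps_const (b m) * inner_comp_series a b k ks m) n"
    using step by (simp add: inner_comp_series_Suc)
  also have "\<dots> = fps_const (b n) * intertwiner b (\<lambda>m. inner_comp_series a b k ks m - fps_X * comp_series a b (k # ks) m) n"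
    using step assms comp_series_Cons[of k a b ks] by (simp add: intertwiner_b intertwiner_diff)
  also have "\<dots> = fps_const (b n) ^ (Suc k - 1) * intertwiner b (comp_series a b ks) n"
    using step by (simp only: step.IH mult.assoc[symmetric] power_Suc[symmetric]) simp
  finally show ?case .
qed

text \<open>Both sides satisfy the equation of \<open>ones_series_Cons\<close>, in which the value
  at \<open>n\<close> depends only on values at smaller arguments. Hence an induction on
  \<open>n\<close> inside the induction on \<open>ks\<close>.\<close>

lemma intertwiner_comp_series:
  assumes "positive_index ks" "1 \<le> n" "n < N"
  shows "intertwiner b (comp_series a b ks) n = ones_series a b ks n"
  using assms
proof (induction ks arbitrary: n)
  case Nil
  thus ?case using intertwiner_one[of n b] by (simp add: comp_series_Nil[abs_def] ones_series_Nil)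
next
  case (Cons k ks)
  have k: "k \<ge> 1" using Cons.prems by simp
  have P: "intertwiner b (inner_comp_series a b k ks) m =
      fps_const (b m) ^ (k - 1) * ones_series a b ks m + fps_X * intertwiner b (comp_series a b (k # ks)) m"
    if "1 \<le> m" "m < N" for m
    using intertwiner_inner_comp_series[OF k that, of ks] Cons.IH[of m] Cons.prems that by (simp add: intertwiner_diff algebra_simps)
  have rec: "intertwiner b (comp_series a b (k # ks)) m =
      insert_ones_series a b k ks m + fps_X * geometric_sum_op a b (intertwiner b (comp_series a b (k # ks))) m" if "1 \<le> m" "m < N" for m
  proof -
    have "intertwiner b (comp_series a b (k # ks)) m = geometric_sum_op a b (intertwiner b (inner_comp_series a b k ks)) m"
      using intertwiner_sum_op_eq_geometric_sum_op[of m "inner_comp_series a b k ks"] that comp_series_Cons[OF k, of a b ks]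
      by (simp add: intertwiner_def)
    also have "\<dots> = geometric_sum_op a b (\<lambda>m. fps_const (b m) ^ (k - 1) * ones_series a b ks m
                       + fps_X * intertwiner b (comp_series a b (k # ks)) m) m"
      using that P by (intro geometric_sum_op_cong) auto
    finally show ?thesis by (simp add: geometric_sum_op_add insert_ones_series_eq[OF k])
  qed
  show ?case using Cons.prems(2,3)
  proof (induction n rule: less_induct)
    case (less n)
    have "geometric_sum_op a b (intertwiner b (comp_series a b (k # ks))) n = geometric_sum_op a b (ones_series a b (k # ks)) n"
      using less by (intro geometric_sum_op_cong) auto
    thus ?case using rec[of n] ones_series_Cons[of a b k ks n] less.prems by simp
  qed
qed

section \<open>The defect series and the identity at the endpoint\<close>

definition defect_series :: "'a fps" where
  "defect_series = (\<Prod>l\<in>{1..<N}. 1 + fps_X * fps_const (a l))"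

lemma geo_uminus_inverse: "(1 + fps_X * fps_const c) * geo (- c) = (1 :: 'a fps)"
  using geo_inverse[of "- c"] by (simp flip: fps_const_neg)

text \<open>Reflection replaces \<open>b (N - l)\<close> by \<open>- a l\<close>, so the last row
  involves only the weights \<open>a\<close>.\<close>

lemma intertwiner_prod_N:
  assumes "m < N"
  shows "intertwiner_prod b N m = (\<Prod>l\<in>{1..m}. geo (- a l))"
  unfolding intertwiner_prod_def rho_def using assms reflection by (intro prod.cong) auto

lemma defect_series_intertwiner_prod: "defect_series * intertwiner_prod b N (N - 1) = 1"
proof -
  have "{1..<N} = {1..N - 1}" using N_pos by auto
  hence "defect_series * intertwiner_prod b N (N - 1) = (\<Prod>l\<in>{1..N - 1}. (1 + fps_X * fps_const (a l)) * geo (- a l))"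
    using N_pos unfolding defect_series_def by (subst intertwiner_prod_N) (simp_all add: prod.distrib)
  thus ?thesis by (simp only: geo_uminus_inverse prod.neutral_const)
qed

text \<open>In row \<open>N\<close> consecutive products differ by the factor
  \<open>1 + x a M\<close>, and exactly this makes the sum over \<open>f - x Y f\<close>
  telescope.\<close>

lemma intertwiner_prod_N_parts:
  assumes "1 \<le> M" "M \<le> N"
  shows "(\<Sum>m\<in>{1..<M}. intertwiner_prod b N m * fps_const (a m) * (f m - fps_X * sum_op a f m)) =
         intertwiner_prod b N (M - 1) * sum_op a f M"
  using assms
proof (induction M rule: dec_induct)
  case (step M)
  have "intertwiner_prod b N (M - 1) = (1 + fps_X * fps_const (a M)) * intertwiner_prod b N M"
  proof -
    have "intertwiner_prod b N M = intertwiner_prod b N (M - 1) * geo (- a M)"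
      using step by (cases M) (simp_all add: intertwiner_prod_N)
    hence "(1 + fps_X * fps_const (a M)) * intertwiner_prod b N M =
           intertwiner_prod b N (M - 1) * ((1 + fps_X * fps_const (a M)) * geo (- a M))"
      by (simp only: mult_ac)
    thus ?thesis by (simp add: geo_uminus_inverse)
  qed
  hence *: "intertwiner_prod b N (M - Suc 0) = (1 + fps_X * fps_const (a M)) * intertwiner_prod b N M" by simp
  have "(\<Sum>m\<in>{1..<Suc M}. intertwiner_prod b N m * fps_const (a m) * (f m - fps_X * sum_op a f m)) =
        intertwiner_prod b N (M - 1) * sum_op a f M + intertwiner_prod b N M * fps_const (a M) * (f M - fps_X * sum_op a f M)"
    using step sum_atLeastLessThan_Suc_right[of M] by simp
  also have "\<dots> = intertwiner_prod b N (Suc M - 1) * sum_op a f (Suc M)"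
    using step by (simp add: * sum_op_Suc algebra_simps)
  finally show ?case .
qed simp

text \<open>Row \<open>N\<close> of \<open>T Y (P - x L)\<close> is evaluated twice: moving T to the
  right gives the right-hand series, and the telescoping in the last row gives the left-hand series
  divided by the defect.\<close>

lemma comp_series_eq_insert_ones_series:
  assumes "k \<ge> 1" "positive_index ks"
  shows "comp_series a b (k # ks) N = defect_series * insert_ones_series a b k ks N"
proof -
  let ?P = "inner_comp_series a b k ks" and ?f = "\<lambda>m. inner_comp_series a b k ks m - fps_X * comp_series a b (k # ks) m"
  have L: "comp_series a b (k # ks) = sum_op a ?P" using comp_series_Cons[OF assms(1)] by blast
  have "insert_ones_series a b k ks N = geometric_sum_op a b (intertwiner b ?f) N"
    unfolding insert_ones_series_eq[OF assms(1)] using intertwiner_inner_comp_series[OF assms(1)] intertwiner_comp_series[OF assms(2)]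
    by (intro geometric_sum_op_cong) simp
  also have "\<dots> = intertwiner b (sum_op a ?f) N"
    using intertwiner_sum_op_eq_geometric_sum_op[of N ?f] N_pos by simp
  also have "\<dots> = intertwiner_prod b N (N - 1) * comp_series a b (k # ks) N"
    unfolding intertwiner_sum_op[OF N_pos] L using N_pos by (rule intertwiner_prod_N_parts) simp
  finally have "defect_series * insert_ones_series a b k ks N = (defect_series * intertwiner_prod b N (N - 1)) * comp_series a b (k # ks) N"
    by (simp only: mult.assoc)
  thus ?thesis unfolding defect_series_intertwiner_prod by simp
qed

text \<open>For the index \<open>[1]\<close> all entries are 1, so the coefficients are the
  elementary symmetric functions of the weights \<open>a\<close>.\<close>

lemma comp_series_one: "1 + fps_X * comp_series a b [1] N = defect_series"
proof -
  have "1 + fps_X * comp_series a b [1] n = (\<Prod>l\<in>{1..<n}. 1 + fps_X * fps_const (a l))" if "1 \<le> n" for n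
    using that
  proof (induction n rule: dec_induct)
    case base
    show ?case by (simp add: comp_series_Cons)
  next
    case (step n)
    have "1 + fps_X * comp_series a b [1] (Suc n) =
        1 + fps_X * comp_series a b [1] n + fps_X * (fps_const (a n) * (1 + fps_X * comp_series a b [1] n))"
    proof -
      have "comp_series a b [1] (Suc n) = comp_series a b [1] n + fps_const (a n) * inner_comp_series a b 1 [] n"
        using step by (simp only: comp_series_Cons[of 1 a b "[]"] sum_op_Suc order_refl)
      thus ?thesis by (simp only: inner_comp_series_one comp_series_Nil distrib_left add.assoc)
    qed
    also have "\<dots> = (1 + fps_X * comp_series a b [1] n) * (1 + fps_X * fps_const (a n))"
      by (simp add: algebra_simps)
    also have "\<dots> = (\<Prod>l\<in>{1..<Suc n}. 1 + fps_X * fps_const (a l))"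
      using step by (simp add: prod.atLeastLessThan_Suc)
    finally show ?case .
  qed
  thus ?thesis using N_pos by (simp add: defect_series_def)
qed

text \<open>The logarithmic derivative of the product, \<open>geo (- a l)\<close> being the inverse
  of \<open>1 + x a l\<close>.\<close>

lemma defect_series_deriv: "fps_deriv defect_series = defect_series * (\<Sum>l\<in>{1..<N}. fps_const (a l) * geo (- a l))"
proof -
  have "fps_deriv (\<Prod>l\<in>A. 1 + fps_X * fps_const (a l)) =
      (\<Prod>l\<in>A. 1 + fps_X * fps_const (a l)) * (\<Sum>l\<in>A. fps_const (a l) * geo (- a l))"
    if "finite A" for A
    using that
  proof (induction A)
    case (insert l A)
    define E u P S where "E = 1 + fps_X * fps_const (a l)" and "u = fps_const (a l) * geo (- a l)"
      and "P = (\<Prod>l\<in>A. 1 + fps_X * fps_const (a l))" and "S = (\<Sum>l\<in>A. fps_const (a l) * geo (- a l))"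
    have "E * u = fps_const (a l) * (E * geo (- a l))"
      unfolding u_def by (simp only: mult_ac)
    hence "E * u = fps_const (a l)"
      unfolding E_def geo_uminus_inverse by simp
    moreover have "E * P * (u + S) = P * (E * u) + E * (P * S)"
      by (simp add: algebra_simps)
    ultimately have "E * P * (u + S) = P * fps_const (a l) + E * (P * S)" by simp
    also have "\<dots> = fps_deriv (E * P)"
      using insert.IH by (simp add: E_def P_def S_def mult_ac)
    finally show ?case
      using insert.hyps by (simp add: E_def P_def S_def u_def)
  qed simp
  thus ?thesis by (simp add: defect_series_def)
qed

text \<open>For the index \<open>[1]\<close> the main identity reads \<open>C = 1 + x C R\<close>.
  Reflection expresses \<open>R\<close> through the logarithmic derivative of \<open>C\<close>, so
  \<open>C\<close> satisfies a linear differential equation of first order; the claim compares its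
  coefficients.\<close>

lemma defect_series_nth_rec: "of_nat (j + 2) * fps_nth defect_series (Suc j) = \<delta> * (of_nat N - of_nat (Suc j)) * fps_nth defect_series j"
proof -
  let ?S = "\<Sum>l\<in>{1..<N}. fps_const (a l) * geo (- a l)"
  have "insert_ones_series a b 1 [] N = (\<Sum>l\<in>{1..<N}. fps_const (a l) * geo (b l))"
    by (simp add: insert_ones_series_eq ones_series_Nil geometric_sum_op_def)
  also have "\<dots> = (\<Sum>l\<in>{1..<N}. fps_const (a (N - l)) * geo (b (N - l)))"
    by (rule sum.reindex_bij_witness[of _ "\<lambda>l. N - l" "\<lambda>l. N - l"]) auto
  also have "\<dots> = (\<Sum>l\<in>{1..<N}. fps_const \<delta> - fps_const \<delta> * fps_X * (fps_const (a l) * geo (- a l))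
                        - fps_const (a l) * geo (- a l))"
  proof (intro sum.cong refl)
    fix l assume l: "l \<in> {1..<N}"
    \<comment> \<open>From \<open>a_eq\<close> and reflection,
      \<open>a (N - l) = \<delta> - a l\<close>.\<close>
    have "fps_const (a (N - l)) * geo (b (N - l)) = (fps_const \<delta> - fps_const (a l)) * geo (- a l)"
    proof -
      have "1 \<le> N - l" "N - l < N" using l by auto
      thus ?thesis using l a_eq[of "N - l"] reflection[of l] by simp
    qed
    also have "\<dots> = fps_const \<delta> * geo (- a l) - fps_const (a l) * geo (- a l)"
      by (rule left_diff_distrib)
    also have "fps_const \<delta> * geo (- a l) = fps_const \<delta> * (1 - fps_X * (fps_const (a l) * geo (- a l)))"
      using geo_uminus_inverse[of "a l"] by (intro arg_cong[of _ _ "(*) _"]) (simp add: algebra_simps)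
    finally show "fps_const (a (N - l)) * geo (b (N - l)) =
        fps_const \<delta> - fps_const \<delta> * fps_X * (fps_const (a l) * geo (- a l)) - fps_const (a l) * geo (- a l)"
      by (simp add: right_diff_distrib mult.assoc)
  qed
  also have "\<dots> = of_nat (N - 1) * fps_const \<delta> - fps_const \<delta> * fps_X * ?S - ?S"
    by (simp add: sum_subtractf sum_distrib_left)
  finally have R: "insert_ones_series a b 1 [] N = of_nat (N - 1) * fps_const \<delta> - fps_const \<delta> * fps_X * ?S - ?S" .
  have "defect_series = 1 + fps_X * (defect_series * insert_ones_series a b 1 [] N)"
    unfolding comp_series_eq_insert_ones_series[of 1 "[]", simplified, symmetric, unfolded One_nat_def[symmetric]] by (rule comp_series_one[symmetric])
  also have "defect_series * insert_ones_series a b 1 [] N = fps_const (of_nat (N - 1) * \<delta>) * defect_series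
               - fps_const \<delta> * (fps_X * fps_deriv defect_series) - fps_deriv defect_series"
  proof -
    have "defect_series * (of_nat (N - 1) * fps_const \<delta> - fps_const \<delta> * fps_X * S - S) =
        of_nat (N - 1) * fps_const \<delta> * defect_series - fps_const \<delta> * (fps_X * (defect_series * S)) - defect_series * S" for S
      by (simp add: right_diff_distrib mult_ac)
    thus ?thesis unfolding R defect_series_deriv by (simp add: fps_of_nat flip: fps_const_mult)
  qed
  finally have "fps_nth defect_series (Suc j) = fps_nth (1 + fps_X * (fps_const (of_nat (N - 1) * \<delta>) * defect_series
               - fps_const \<delta> * (fps_X * fps_deriv defect_series) - fps_deriv defect_series)) (Suc j)"
    by (rule arg_cong)
  also have "\<dots> = of_nat (N - 1) * \<delta> * fps_nth defect_series j - \<delta> * (of_nat j * fps_nth defect_series j)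
                   - of_nat (Suc j) * fps_nth defect_series (Suc j)"
    by (cases j) simp_all
  finally have *: "fps_nth defect_series (Suc j) + of_nat (Suc j) * fps_nth defect_series (Suc j) =
      of_nat (N - 1) * \<delta> * fps_nth defect_series j - \<delta> * (of_nat j * fps_nth defect_series j)"
    by (simp only: eq_diff_eq)
  have "of_nat (j + 2) * fps_nth defect_series (Suc j) =
      fps_nth defect_series (Suc j) + of_nat (Suc j) * fps_nth defect_series (Suc j)"
    by (simp add: algebra_simps)
  also note *
  also have "of_nat (N - 1) * \<delta> * fps_nth defect_series j - \<delta> * (of_nat j * fps_nth defect_series j) =
      \<delta> * (of_nat N - of_nat (Suc j)) * fps_nth defect_series j"
    using N_pos by (simp add: algebra_simps of_nat_diff)
  finally show ?thesis .
qed

lemma defect_series_nth_0: "fps_nth defect_series 0 = 1"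
  unfolding comp_series_one[symmetric] by simp

end

section \<open>Finite multiple zeta values\<close>

text \<open>The ring \<open>\<Prod>\<^sub>p \<int>/p\<int>\<close>. For a fixed prime \<open>p\<close>, congruences modulo \<open>p\<close> become equations
  between its elements supported at \<open>p\<close>.\<close>

definition residues_rel :: "(nat \<Rightarrow> int) \<Rightarrow> (nat \<Rightarrow> int) \<Rightarrow> bool" where
  "residues_rel f g \<longleftrightarrow> (\<forall>p. [f p = g p] (mod int p))"

lemma equivp_residues_rel: "equivp residues_rel"
  by (rule equivpI) (auto simp: reflp_def symp_def transp_def residues_rel_def cong_sym_eq intro: cong_trans)

quotient_type residue_family = "nat \<Rightarrow> int" / residues_rel
  by (rule equivp_residues_rel)

instantiation residue_family :: comm_ring_1
begin

lift_definition zero_residue_family :: residue_family is "\<lambda>_. 0" .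

lift_definition one_residue_family :: residue_family is "\<lambda>_. 1" .

lift_definition plus_residue_family :: "residue_family \<Rightarrow> residue_family \<Rightarrow> residue_family"
  is "\<lambda>f g p. f p + g p"
  by (simp add: residues_rel_def cong_add)

lift_definition minus_residue_family :: "residue_family \<Rightarrow> residue_family \<Rightarrow> residue_family"
  is "\<lambda>f g p. f p - g p"
  by (simp add: residues_rel_def cong_diff)

lift_definition uminus_residue_family :: "residue_family \<Rightarrow> residue_family" is "\<lambda>f p. - f p"
  by (simp add: residues_rel_def cong_minus_minus_iff)

lift_definition times_residue_family :: "residue_family \<Rightarrow> residue_family \<Rightarrow> residue_family"
  is "\<lambda>f g p. f p * g p"
  by (simp add: residues_rel_def cong_mult)

instance
proof
  show "(0::residue_family) \<noteq> 1"
    \<comment> \<open>Modulo 0 congruence is equality of integers, so the component at 0 separates 0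
      from 1.\<close>
    by transfer (auto simp: residues_rel_def intro!: exI[of _ 0])
qed (transfer; simp add: residues_rel_def algebra_simps)+

end

text \<open>A relation rather than a function, since a residue class has no preferred integer
  representative.\<close>

lift_definition residue_at :: "nat \<Rightarrow> residue_family \<Rightarrow> int \<Rightarrow> bool" is "\<lambda>p f z. [f p = z] (mod int p)"
  by (auto simp: residues_rel_def intro: cong_trans cong_sym)

lift_definition supported_at :: "nat \<Rightarrow> int \<Rightarrow> residue_family" is "\<lambda>p z q. if q = p then z else 0" .

lemma residue_at_0: "residue_at p 0 0"
  and residue_at_1: "residue_at p 1 1"
  and residue_at_supported: "residue_at p (supported_at p z) z"
  by (transfer; simp)+

lemma residue_at_add: "residue_at p x z \<Longrightarrow> residue_at p y w \<Longrightarrow> residue_at p (x + y) (z + w)"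
  and residue_at_mult: "residue_at p x z \<Longrightarrow> residue_at p y w \<Longrightarrow> residue_at p (x * y) (z * w)"
  by (transfer; simp add: cong_add cong_mult)+

lemma residue_at_power: "residue_at p x z \<Longrightarrow> residue_at p (x ^ n) (z ^ n)"
  by (induction n) (auto intro: residue_at_1 residue_at_mult)

lemma residue_at_of_nat: "residue_at p (of_nat n) (int n)"
  by (induction n) (auto intro: residue_at_0 residue_at_1 residue_at_add)

lemma residue_at_unique: "residue_at p x z \<Longrightarrow> residue_at p x w \<Longrightarrow> [z = w] (mod int p)"
  by transfer (metis cong_sym cong_trans)

lemma residue_at_cong: "residue_at p x z \<Longrightarrow> [z = w] (mod int p) \<Longrightarrow> residue_at p x w"
  by transfer (rule cong_trans)

lemma residue_at_ex: "\<exists>z. residue_at p x z"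
  by transfer (blast intro: cong_refl)

lemma residue_at_zsum:
  assumes "\<And>n. residue_at p (a n) (a' n)" "\<And>n. residue_at p (b n) (b' n)"
  shows "residue_at p (zsum a b ks n) (zsum a' b' ks n)"
proof (induction ks arbitrary: n)
  case (Cons k ks)
  show ?case unfolding zsum.simps
    by (intro sum_related[where P = "residue_at p"] residue_at_0 residue_at_add residue_at_mult
        residue_at_power assms Cons)
qed (simp add: residue_at_1)

section \<open>Inverses modulo a prime as weights\<close>

definition inverse_mod :: "nat \<Rightarrow> nat \<Rightarrow> int" where
  "inverse_mod p n = modular_inverse (int p) (int n)"

lemma inverse_modE:
  assumes "prime p" "1 \<le> n" "n < p"
  obtains q where "inverse_mod p n * int n = 1 + int p * q"
proof -
  have "coprime (int n) (int p)"
    using assms by (metis coprime_commute coprime_int_iff nat_dvd_not_less not_one_le_zero gr0I prime_imp_coprime_nat)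
  hence "int p dvd inverse_mod p n * int n - 1"
    unfolding inverse_mod_def by (simp add: cong_modular_inverse2 flip: cong_iff_dvd_diff)
  then obtain q where "inverse_mod p n * int n - 1 = int p * q" by auto
  thus ?thesis by (intro that[of q]) simp
qed

lemma inverse_mod_addition:
  assumes p: "prime p" and "1 \<le> d" "1 \<le> m" "d + m < p"
  shows "[inverse_mod p d * inverse_mod p m =
          inverse_mod p (d + m) * (inverse_mod p d + inverse_mod p m)] (mod int p)"
proof -
  obtain A where A: "inverse_mod p d * int d = 1 + int p * A"
    by (rule inverse_modE[OF p, of d]) (use assms in auto)
  obtain B where B: "inverse_mod p m * int m = 1 + int p * B"
    by (rule inverse_modE[OF p, of m]) (use assms in auto)
  obtain C where C: "inverse_mod p (d + m) * int (d + m) = 1 + int p * C"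
    by (rule inverse_modE[OF p, of "d + m"]) (use assms in auto)
  define x y z where "x = inverse_mod p d" and "y = inverse_mod p m" and "z = inverse_mod p (d + m)"
  \<comment> \<open>Here \<open>1 + p C\<close> is \<open>z (d + m)\<close>; splitting
    \<open>d + m\<close> pairs \<open>d\<close> with \<open>x\<close> and \<open>m\<close> with
    \<open>y\<close>.\<close>
  have "x * y * (1 + int p * C) = y * z * (1 + int p * A) + x * z * (1 + int p * B)"
    unfolding A[symmetric] B[symmetric] C[symmetric] x_def y_def z_def by (simp add: algebra_simps)
  hence "x * y - z * (x + y) = int p * (y * z * A + x * z * B - x * y * C)"
    by (simp add: algebra_simps)
  thus ?thesis unfolding x_def y_def z_def cong_iff_dvd_diff by (metis dvd_triv_left)
qed

lemma inverse_mod_reflection: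
  assumes p: "prime p" and "1 \<le> l" "l < p"
  shows "[inverse_mod p (p - l) = - inverse_mod p l] (mod int p)"
proof -
  obtain A where A: "inverse_mod p l * int l = 1 + int p * A"
    by (rule inverse_modE[OF p, of l]) (use assms in auto)
  obtain B where B: "inverse_mod p (p - l) * int (p - l) = 1 + int p * B"
    by (rule inverse_modE[OF p, of "p - l"]) (use assms in auto)
  define x y where "x = inverse_mod p l" and "y = inverse_mod p (p - l)"
  have B': "y * (int p - int l) = 1 + int p * B"
    using B assms by (simp add: y_def of_nat_diff)
  have "x * (y * (int p - int l)) = x * y * int p - y * (x * int l)"
    by (simp add: algebra_simps)
  hence "x * (1 + int p * B) = x * y * int p - y * (1 + int p * A)"
    unfolding B' using A by (simp add: x_def)
  hence "y - - x = int p * (x * y - y * A - x * B)" by (simp add: algebra_simps)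
  thus ?thesis unfolding x_def y_def cong_iff_dvd_diff by (metis dvd_triv_left)
qed

lemma supported_at_eqI: "[z = w] (mod int p) \<Longrightarrow> supported_at p z = supported_at p w"
  by transfer (auto simp: residues_rel_def)

lemma supported_at_mult: "supported_at p z * supported_at p w = supported_at p (z * w)"
  and supported_at_add: "supported_at p z + supported_at p w = supported_at p (z + w)"
  and supported_at_uminus: "- supported_at p z = supported_at p (- z)"
  by (transfer; auto simp: residues_rel_def)+

text \<open>The case \<open>q = 1\<close>, where \<open>a = b\<close> and
  \<open>\<delta> = 0\<close>.\<close>

lemma addition_weights_inverse_mod:
  assumes "prime p"
  shows "addition_weights (\<lambda>n. supported_at p (inverse_mod p n)) (\<lambda>n. supported_at p (inverse_mod p n)) 0 p"
  using assms
  by unfold_locales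
     (auto simp: supported_at_mult supported_at_add supported_at_uminus Suc_leI prime_gt_0_nat
       intro!: supported_at_eqI inverse_mod_addition inverse_mod_reflection)

definition finite_zsum :: "nat \<Rightarrow> nat list \<Rightarrow> int" where
  "finite_zsum p ks = zsum (inverse_mod p) (inverse_mod p) ks p"

text \<open>For \<open>\<delta> = 0\<close> the recursion says that \<open>j + 2\<close> times the
  coefficient of degree \<open>j + 1\<close> of the defect series is 0. As
  \<open>j + 2 \<le> t + 1 < p\<close>, the defect series is 1 modulo \<open>p\<close> up to degree
  \<open>t\<close>.\<close>

lemma finite_zsum_cong:
  assumes p: "prime p" "t + 1 < p" and k: "k \<ge> 1" "positive_index ks"
  shows "[comp_sum (finite_zsum p) (k # ks) t =
          (\<Sum>j\<le>t. ones_sum (\<lambda>as. finite_zsum p ((k + j) # as)) ks (t - j))] (mod int p)"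
proof -
  let ?a = "\<lambda>n. supported_at p (inverse_mod p n)"
  interpret addition_weights ?a ?a 0 p
    by (rule addition_weights_inverse_mod[OF p(1)])
  have z: "residue_at p (zsum ?a ?a as p) (finite_zsum p as)" for as
    unfolding finite_zsum_def by (intro residue_at_zsum residue_at_supported)
  have L: "residue_at p (fps_nth (comp_series ?a ?a (k # ks) p) t) (comp_sum (finite_zsum p) (k # ks) t)"
    unfolding comp_series_def fps_nth_Abs_fps
    by (intro comp_sum_related[where P = "residue_at p"] residue_at_0 residue_at_add z)
  have R: "residue_at p (fps_nth (insert_ones_series ?a ?a k ks p) t)
             (\<Sum>j\<le>t. ones_sum (\<lambda>as. finite_zsum p ((k + j) # as)) ks (t - j))"
    unfolding insert_ones_series_def fps_nth_Abs_fps
    by (intro sum_related[where P = "residue_at p"] ones_sum_related[where P = "residue_at p"]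
        residue_at_0 residue_at_add z k)
  have C: "residue_at p (fps_nth defect_series (Suc j)) 0" if "j < t" for j
  proof -
    obtain c where c: "residue_at p (fps_nth defect_series (Suc j)) c" using residue_at_ex by blast
    have "residue_at p (of_nat (j + 2) * fps_nth defect_series (Suc j)) (int (j + 2) * c)"
      by (intro residue_at_mult residue_at_of_nat c)
    moreover have "of_nat (j + 2) * fps_nth defect_series (Suc j) = 0"
      using defect_series_nth_rec[of j] by simp
    ultimately have "[int (j + 2) * c = 0] (mod int p)"
      using residue_at_unique residue_at_0 by metis
    hence "int p dvd int (j + 2) * c" by (simp add: cong_0_iff)
    moreover have "\<not> int p dvd int (j + 2)"
      unfolding int_dvd_int_iff by (rule nat_dvd_not_less) (use that p in auto)
    ultimately have "[c = 0] (mod int p)"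
      using p by (simp add: cong_0_iff prime_dvd_mult_iff)
    thus ?thesis by (rule residue_at_cong[OF c])
  qed
  define r where "r i = (SOME z. residue_at p (fps_nth (insert_ones_series ?a ?a k ks p) i) z)" for i
  have r: "residue_at p (fps_nth (insert_ones_series ?a ?a k ks p) i) (r i)" for i
    unfolding r_def by (rule someI_ex[OF residue_at_ex])
  have "fps_nth (comp_series ?a ?a (k # ks) p) t =
      (\<Sum>i\<in>{0..t}. fps_nth defect_series i * fps_nth (insert_ones_series ?a ?a k ks p) (t - i))"
    unfolding comp_series_eq_insert_ones_series[OF k] by (rule fps_mult_nth)
  moreover have "residue_at p \<dots> (\<Sum>i\<in>{0..t}. (if i = 0 then 1 else 0) * r (t - i))"
  proof (intro sum_related[where P = "residue_at p"] residue_at_0 residue_at_add residue_at_mult r)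
    fix i assume "i \<in> {0..t}"
    thus "residue_at p (fps_nth defect_series i) (if i = 0 then 1 else 0)"
      by (cases i) (auto simp: defect_series_nth_0 residue_at_1 intro: C)
  qed
  moreover have "(\<Sum>i\<in>{0..t}. (if i = 0 then 1 else 0) * r (t - i)) = (\<Sum>i\<in>{0..t}. if i = 0 then r t else 0)"
    by (intro sum.cong refl) auto
  ultimately have "residue_at p (fps_nth (comp_series ?a ?a (k # ks) p) t) (r t)"
    by simp
  hence "[comp_sum (finite_zsum p) (k # ks) t = r t] (mod int p)"
    using L residue_at_unique by blast
  also have "[r t = (\<Sum>j\<le>t. ones_sum (\<lambda>as. finite_zsum p ((k + j) # as)) ks (t - j))] (mod int p)"
    using r R residue_at_unique by blast
  finally show ?thesis .
qed

section \<open>From congruences to identities in \<A>\<close>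

lemma sum_dec_tuples_Suc:
  "(\<Sum>ns\<in>dec_tuples (Suc r) {1..<N}. f ns) =
         (\<Sum>n\<in>{1..<N}. \<Sum>ns\<in>dec_tuples r {1..<n}. f (n # ns))"
proof -
  have "(\<Sum>n\<in>{1..<N}. \<Sum>ns\<in>dec_tuples r {1..<n}. f (n # ns)) =
        (\<Sum>(n, ns)\<in>Sigma {1..<N} (\<lambda>n. dec_tuples r {1..<n}). f (n # ns))"
    by (subst sum.Sigma) (auto intro: finite_dec_tuples)
  also have "\<dots> = (\<Sum>ns\<in>dec_tuples (Suc r) {1..<N}. f ns)"
  proof (rule sum.reindex_bij_witness[of _ "\<lambda>ns. (hd ns, tl ns)" "\<lambda>(n, ns). n # ns"], goal_cases)
    case (2 x)
    thus ?case by (auto simp: dec_tuples_def subset_iff)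
  next
    case (3 ns)
    thus ?case by (cases ns) (auto simp: dec_tuples_def)
  next
    case (4 ns)
    thus ?case by (cases ns) (auto simp: dec_tuples_def subset_iff)
  qed auto
  finally show ?thesis ..
qed

lemma zsum_eq_sum_dec_tuples:
  "positive_index ks \<Longrightarrow> zsum a a ks N =
     (\<Sum>ns\<in>dec_tuples (length ks) {1..<N}. prod_list (map2 (\<lambda>n k. a n ^ k) ns ks))"
proof (induction ks arbitrary: N)
  case Nil
  have "dec_tuples 0 {1..<N} = {[]}" by (auto simp: dec_tuples_def)
  thus ?case by simp
next
  case (Cons k ks)
  have "a m * a m ^ (k - 1) = a m ^ k" for m
    using Cons.prems by (cases k) auto
  thus ?case using Cons by (simp add: sum_dec_tuples_Suc[unfolded One_nat_def] sum_distrib_left)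
qed

lemma zeta_A_eq: "positive_index ks \<Longrightarrow> zeta_A ks = abs_calA (\<lambda>p. finite_zsum p ks)"
  unfolding zeta_A_def finite_zsum_def by (simp add: zsum_eq_sum_dec_tuples inverse_mod_def)

lemma sum_abs_calA: "(\<Sum>x\<in>S. abs_calA (f x)) = abs_calA (\<lambda>p. \<Sum>x\<in>S. f x p)"
  by (induction S rule: infinite_finite_induct) (simp_all add: zero_calA_def plus_calA.abs_eq)

lemma zeta_A_comp_sum:
  assumes "k \<ge> 1" "positive_index ks"
  shows "comp_sum zeta_A (k # ks) t = (\<Sum>j\<le>t. ones_sum (\<lambda>as. zeta_A ((k + j) # as)) ks (t - j))"
proof -
  have "comp_sum zeta_A (k # ks) t = comp_sum (\<lambda>as. abs_calA (\<lambda>p. finite_zsum p as)) (k # ks) t"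
    by (rule comp_sum_related[where P = "(=)"]) (auto simp: zeta_A_eq)
  also have "\<dots> = abs_calA (\<lambda>p. comp_sum (finite_zsum p) (k # ks) t)"
    unfolding comp_sum_def by (simp only: sum_abs_calA)
  also have "\<dots> = abs_calA (\<lambda>p. \<Sum>j\<le>t. ones_sum (\<lambda>as. finite_zsum p ((k + j) # as)) ks (t - j))"
  proof (subst calA.abs_eq_iff)
    let ?L = "\<lambda>p. comp_sum (finite_zsum p) (k # ks) t"
      and ?R = "\<lambda>p. \<Sum>j\<le>t. ones_sum (\<lambda>as. finite_zsum p ((k + j) # as)) ks (t - j)"
    \<comment> \<open>Only primes up to \<open>t + 1\<close> can violate the congruence, and
      finitely many primes do not matter in \<A>.\<close>
    have "p \<le> t + 1" if "prime p" "\<not> [?L p = ?R p] (mod int p)" for p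
      using finite_zsum_cong[OF that(1) _ assms, of t] that(2) by linarith
    hence "{p. prime p \<and> \<not> [?L p = ?R p] (mod int p)} \<subseteq> {..t + 1}" by blast
    thus "A_rel ?L ?R" unfolding A_rel_def by (rule finite_subset) simp
  qed
  also have "\<dots> = (\<Sum>j\<le>t. ones_sum (\<lambda>as. abs_calA (\<lambda>p. finite_zsum p ((k + j) # as))) ks (t - j))"
    unfolding ones_sum_def ext_sum_def by (simp only: sum_abs_calA)
  also have "\<dots> = (\<Sum>j\<le>t. ones_sum (\<lambda>as. zeta_A ((k + j) # as)) ks (t - j))"
    using assms by (intro sum.cong refl ones_sum_related[where P = "(=)"]) (auto simp: zeta_A_eq)
  finally show ?thesis .
qed

section \<open>Splitting and reflecting nested sums\<close>

fun interval_zsum :: "(nat \<Rightarrow> nat \<Rightarrow> 'a::comm_ring_1) \<Rightarrow> nat list \<Rightarrow> nat \<Rightarrow> nat \<Rightarrow> 'a" where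
  "interval_zsum w [] lo hi = 1"
| "interval_zsum w (k # ks) lo hi = (\<Sum>n\<in>{lo..<hi}. w n k * interval_zsum w ks lo n)"

lemma zsum_eq_interval_zsum: "zsum a b ks n = interval_zsum (\<lambda>n k. a n * b n ^ (k - 1)) ks 1 n"
  by (induction ks arbitrary: n) simp_all

text \<open>The variables decrease along the list, so those that are at least \<open>M\<close>
  belong to an initial segment; \<open>i\<close> is their number.\<close>

lemma interval_zsum_split:
  assumes "lo \<le> M" "M \<le> hi"
  shows "interval_zsum w ks lo hi = (\<Sum>i\<le>length ks. interval_zsum w (take i ks) M hi * interval_zsum w (drop i ks) lo M)"
  using assms
proof (induction ks arbitrary: hi)
  case (Cons k ks)
  have "interval_zsum w (k # ks) lo hi = (\<Sum>n\<in>{lo..<M}. w n k * interval_zsum w ks lo n) + (\<Sum>n\<in>{M..<hi}. w n k * interval_zsum w ks lo n)"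
    unfolding interval_zsum.simps using Cons.prems by (subst sum.atLeastLessThan_concat) auto
  also have "(\<Sum>n\<in>{M..<hi}. w n k * interval_zsum w ks lo n) =
      (\<Sum>n\<in>{M..<hi}. \<Sum>i\<le>length ks. w n k * interval_zsum w (take i ks) M n * interval_zsum w (drop i ks) lo M)"
    using Cons.IH Cons.prems by (intro sum.cong refl) (simp add: sum_distrib_left mult.assoc)
  also have "\<dots> = (\<Sum>i\<le>length ks. interval_zsum w (take (Suc i) (k # ks)) M hi * interval_zsum w (drop (Suc i) (k # ks)) lo M)"
    by (subst sum.swap) (simp add: sum_distrib_right)
  finally show ?case
    unfolding list.size add_Suc_right add_0_right sum.atMost_Suc_shift by simp
qed simp

lemma interval_zsum_snoc: "interval_zsum w (ks @ [k]) lo hi = (\<Sum>n\<in>{lo..<hi}. w n k * interval_zsum w ks (Suc n) hi)"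
proof (induction ks arbitrary: lo hi)
  case (Cons k' ks)
  have "interval_zsum w ((k' # ks) @ [k]) lo hi =
      (\<Sum>n'\<in>{lo..<hi}. \<Sum>n\<in>{lo..<n'}. w n' k' * (w n k * interval_zsum w ks (Suc n) n'))"
    by (simp add: Cons sum_distrib_left)
  also have "\<dots> = (\<Sum>n\<in>{lo..<hi}. \<Sum>n'\<in>{Suc n..<hi}. w n' k' * (w n k * interval_zsum w ks (Suc n) n'))"
    unfolding sum.Sigma[OF finite_atLeastLessThan ballI[OF finite_atLeastLessThan]]
    by (rule sum.reindex_bij_witness[of _ "\<lambda>(n, n'). (n', n)" "\<lambda>(n', n). (n, n')"]) auto
  also have "\<dots> = (\<Sum>n\<in>{lo..<hi}. w n k * interval_zsum w (k' # ks) (Suc n) hi)"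
    by (simp add: sum_distrib_left mult.left_commute)
  finally show ?case .
qed simp

text \<open>The substitution of \<open>N - n\<close> for \<open>n\<close> reverses the order of the
  variables. It maps \<open>lo \<le> n < hi\<close> to \<open>N - hi < n \<le> N - lo\<close>, which
  as a half-open interval has endpoints \<open>Suc N - hi\<close> and
  \<open>Suc N - lo\<close>.\<close>

lemma interval_zsum_reflect:
  assumes "1 \<le> lo" "hi \<le> N"
  shows "interval_zsum w ks lo hi = interval_zsum (\<lambda>n. w (N - n)) (rev ks) (Suc N - hi) (Suc N - lo)"
  using assms
proof (induction ks arbitrary: hi)
  case (Cons k ks)
  have "interval_zsum w (k # ks) lo hi =
      (\<Sum>n\<in>{lo..<hi}. w n k * interval_zsum (\<lambda>n. w (N - n)) (rev ks) (Suc N - n) (Suc N - lo))"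
    using Cons by simp
  also have "\<dots> = (\<Sum>n\<in>{Suc N - hi..<Suc N - lo}.
      w (N - n) k * interval_zsum (\<lambda>n. w (N - n)) (rev ks) (Suc n) (Suc N - lo))"
    by (rule sum.reindex_bij_witness[of _ "\<lambda>n. N - n" "\<lambda>n. N - n"])
       (use Cons.prems in \<open>auto simp: Suc_diff_le\<close>)
  finally show ?case by (simp add: interval_zsum_snoc)
qed simp

lemma interval_zsum_cnj:
  assumes "positive_index ks"
    and "\<And>n k. lo \<le> n \<Longrightarrow> n < hi \<Longrightarrow> k \<ge> 1 \<Longrightarrow> w' n k = (- 1) ^ k * cnj (w n k)"
  shows "interval_zsum w' ks lo hi = (- 1) ^ sum_list ks * cnj (interval_zsum w ks lo hi)"
  using assms
proof (induction ks arbitrary: hi)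
  case (Cons k ks)
  have "interval_zsum w' (k # ks) lo hi =
      (\<Sum>n\<in>{lo..<hi}. ((- 1) ^ k * cnj (w n k)) * ((- 1) ^ sum_list ks * cnj (interval_zsum w ks lo n)))"
    unfolding interval_zsum.simps using Cons by (intro sum.cong refl) simp
  thus ?case by (simp add: sum_distrib_left power_add mult_ac)
qed simp

context addition_weights
begin

text \<open>When the variable of \<open>[1]\<close> meets that of an entry \<open>k\<close>, the
  weights multiply to \<open>a a b^(k-1) = a b^k + \<delta> a b^(k-1)\<close>. The first term is the
  stuffle term; the second restores \<open>ks\<close>, once for each of its entries.\<close>

lemma zsum_stuffle_one:
  assumes "positive_index ks" "n \<le> N"
  shows "zsum a b [1] n * zsum a b ks n =
         (\<Sum>ms\<leftarrow>stuffle [1] ks. zsum a b ms n) + of_nat (length ks) * \<delta> * zsum a b ks n"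
  using assms
proof (induction ks arbitrary: n)
  case (Cons k ks)
  have k: "k \<ge> 1" using Cons.prems by simp
  have map: "(\<Sum>ms\<leftarrow>map ((#) k) xs. zsum a b ms (Suc n)) =
        (\<Sum>ms\<leftarrow>map ((#) k) xs. zsum a b ms n) + a n * b n ^ (k - 1) * (\<Sum>ms\<leftarrow>xs. zsum a b ms n)"
    if "1 \<le> n" for xs n
    using that by (induction xs) (simp_all add: distrib_left)
  have map0: "(\<Sum>ms\<leftarrow>map ((#) k) xs. zsum a b ms n) = 0" if "n \<le> 1" for xs n
    using that by (induction xs) auto
  have st: "(\<Sum>ms\<leftarrow>stuffle [1] (k # ks). zsum a b ms n) =
      zsum a b (1 # k # ks) n + (\<Sum>ms\<leftarrow>map ((#) k) (stuffle [1] ks). zsum a b ms n)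
      + zsum a b (Suc k # ks) n" for n
    by (simp del: zsum.simps map_map add: add.assoc)
  show ?case using Cons.prems(2)
  proof (induction n)
    case 0
    show ?case unfolding st map0[OF zero_le] by simp
  next
    case (Suc n)
    show ?case
    proof (cases "n = 0")
      case True
      have *: "(\<Sum>ms\<leftarrow>map ((#) k) (stuffle [1] ks). zsum a b ms 1) = 0" by (rule map0) simp
      show ?thesis unfolding True st One_nat_def[symmetric] * by simp
    next
      case False
      hence n: "1 \<le> n" "n < N" using Suc.prems by auto
      define w where "w = a n * b n ^ (k - 1)"
      have S: "zsum a b (l # ls) (Suc n) = zsum a b (l # ls) n + a n * b n ^ (l - 1) * zsum a b ls n"
        for l ls using n by simp
      have w: "a n * w = a n * b n ^ (Suc k - 1) + \<delta> * w"
        using k n a_eq[of n] by (cases k) (simp_all add: w_def algebra_simps)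
      define A B C E where "A = zsum a b [1] n" and "B = zsum a b (k # ks) n"
        and "C = zsum a b ks n" and "E = (\<Sum>ms\<leftarrow>stuffle [1] ks. zsum a b ms n)"
      have ih: "E = A * C - of_nat (length ks) * \<delta> * C"
        using Cons.IH[of n] Cons.prems n by (simp add: A_def C_def E_def)
      have "zsum a b [1] (Suc n) * zsum a b (k # ks) (Suc n) = (A + a n) * (B + w * C)"
        unfolding S A_def B_def C_def w_def by simp
      also have "\<dots> = A * B + a n * B + w * (A * C) + (a n * w) * C"
        by (simp add: algebra_simps)
      also have "\<dots> = (A * B) + a n * B + w * E + a n * b n ^ (Suc k - 1) * C
                     + of_nat (length (k # ks)) * \<delta> * (w * C)"
        unfolding w ih by (simp add: algebra_simps)
      also have "A * B = (\<Sum>ms\<leftarrow>stuffle [1] (k # ks). zsum a b ms n) + of_nat (length (k # ks)) * \<delta> * B"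
        using Suc.IH n unfolding A_def B_def by simp
      also have "(\<Sum>ms\<leftarrow>stuffle [1] (k # ks). zsum a b ms n) + of_nat (length (k # ks)) * \<delta> * B
          + a n * B + w * E + a n * b n ^ (Suc k - 1) * C + of_nat (length (k # ks)) * \<delta> * (w * C) =
          (\<Sum>ms\<leftarrow>stuffle [1] (k # ks). zsum a b ms (Suc n))
          + of_nat (length (k # ks)) * \<delta> * (B + w * C)"
        unfolding st map[OF n(1)] S[of 1] S[of "Suc k"] B_def C_def E_def w_def
        by (simp add: algebra_simps del: zsum.simps stuffle.simps map_map)
      finally show ?thesis unfolding S B_def C_def w_def .
    qed
  qed
qed simp

end

section \<open>Cotangent weights\<close>

lemma mult_cos_le_sin:
  fixes x :: real
  assumes "0 \<le> x" "x \<le> pi"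
  shows "x * cos x \<le> sin x"
proof -
  have "(\<lambda>x. sin x - x * cos x) 0 \<le> (\<lambda>x. sin x - x * cos x) x"
  proof (rule DERIV_nonneg_imp_nondecreasing[OF assms(1)])
    fix y :: real assume y: "0 \<le> y" "y \<le> x"
    have "((\<lambda>x. sin x - x * cos x) has_real_derivative y * sin y) (at y)"
      by (auto intro!: derivative_eq_intros)
    moreover have "y * sin y \<ge> 0"
      using y assms by (intro mult_nonneg_nonneg sin_ge_zero) auto
    ultimately show "\<exists>z. ((\<lambda>x. sin x - x * cos x) has_real_derivative z) (at y) \<and> 0 \<le> z" by blast
  qed
  thus ?thesis by simp
qed

text \<open>The quotient \<open>(sin y - y cos y) / (y sin y)\<close> is bounded through
  \<open>sin y - y cos y \<le> y^3/2\<close> and \<open>sin y \<ge> y/2\<close>, together with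
  \<open>y < pi/2 < 2\<close>.\<close>

lemma inverse_minus_cot_bounds:
  fixes y :: real
  assumes "0 < y" "y < pi / 2"
  shows "0 \<le> 1 / y - cot y" "1 / y - cot y \<le> 2"
proof -
  have s: "sin y > 0" using assms by (intro sin_gt_zero) auto
  have c: "cos y \<ge> 0" using assms by (intro cos_ge_zero) auto
  have f: "1 / y - cot y = (sin y - y * cos y) / (y * sin y)"
    using s assms by (simp add: cot_def field_simps)
  have "y * cos y \<le> sin y" using assms by (intro mult_cos_le_sin) auto
  thus "0 \<le> 1 / y - cot y" unfolding f using s assms by simp
  have half: "y / 2 * cos (y / 2) \<le> sin (y / 2)" using assms by (intro mult_cos_le_sin) auto
  have ch: "cos (y / 2) \<ge> 0" using assms by (intro cos_ge_zero) auto
  have "sin y = 2 * sin (y / 2) * cos (y / 2)" using sin_double[of "y / 2"] by simp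
  also have "\<dots> \<ge> 2 * (y / 2 * cos (y / 2)) * cos (y / 2)"
    using half ch by (intro mult_right_mono mult_left_mono) auto
  finally have "sin y \<ge> y * (cos (y / 2))\<^sup>2" by (simp add: power2_eq_square)
  moreover have "(cos (y / 2))\<^sup>2 = (1 + cos y) / 2"
    using cos_double_cos[of "y / 2"] by simp
  ultimately have "sin y \<ge> y * ((1 + cos y) / 2)" by simp
  moreover have "y * ((1 + cos y) / 2) \<ge> y * (1 / 2)" using c assms by (intro mult_left_mono) auto
  ultimately have sl: "sin y \<ge> y / 2" by simp
  have "(sin (y / 2))\<^sup>2 \<le> (y / 2)\<^sup>2"
    using assms by (intro power_mono sin_x_le_x sin_ge_zero) auto
  hence cl: "1 - cos y \<le> y\<^sup>2 / 2"
    using cos_double_sin[of "y / 2"] by (simp add: power2_eq_square field_simps)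
  have "sin y - y * cos y \<le> y * (1 - cos y)"
    using sin_x_le_x[of y] assms by (simp add: algebra_simps)
  also have "\<dots> \<le> y * (y\<^sup>2 / 2)" using cl assms by (intro mult_left_mono) auto
  also have "\<dots> = y * (y * (y / 2))" by (simp add: power2_eq_square)
  also have "\<dots> \<le> y * (y * sin y)" using sl assms by (intro mult_left_mono) auto
  also have "\<dots> \<le> 2 * (y * sin y)"
    using assms s pi_less_4 by (intro mult_right_mono) auto
  finally show "1 / y - cot y \<le> 2" unfolding f using s assms by (simp add: pos_divide_le_eq)
qed

text \<open>Up to a factor independent of \<open>n\<close> that tends to \<open>1\<close>, \<open>cot_a M n\<close> is \<open>1/[n]\<close> and \<open>cot_b M n\<close> is
  \<open>q\<^sup>n/[n]\<close> for \<open>q = exp (2\<pi>\<i>/N)\<close> and \<open>N = 2M - 1\<close>.\<close>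

definition cot_weight :: "nat \<Rightarrow> nat \<Rightarrow> real" where
  "cot_weight M n = pi / (2 * real M - 1) * cot (pi * real n / (2 * real M - 1))"

definition cot_a :: "nat \<Rightarrow> nat \<Rightarrow> complex" where
  "cot_a M n = Complex (cot_weight M n) (- pi / (2 * real M - 1))"

definition cot_b :: "nat \<Rightarrow> nat \<Rightarrow> complex" where
  "cot_b M n = Complex (cot_weight M n) (pi / (2 * real M - 1))"

definition cot_\<delta> :: "nat \<Rightarrow> complex" where
  "cot_\<delta> M = Complex 0 (- 2 * pi / (2 * real M - 1))"

lemma cnj_cot_a: "cnj (cot_a M n) = cot_b M n"
  by (simp add: cot_a_def cot_b_def complex_eq_iff)

lemma cot_add_real:
  fixes x y :: real
  assumes "sin x \<noteq> 0" "sin y \<noteq> 0" "sin (x + y) \<noteq> 0"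
  shows "cot (x + y) * (cot x + cot y) = cot x * cot y - 1"
proof -
  have "cot x + cot y = sin (x + y) / (sin x * sin y)"
    using assms by (simp add: cot_def sin_add field_simps)
  hence "cot (x + y) * (cot x + cot y) = cos (x + y) / (sin x * sin y)"
    using assms by (simp add: cot_def)
  thus ?thesis using assms by (simp add: cot_def cos_add field_simps)
qed

text \<open>Up to the factor \<open>pi/N\<close> the weights are \<open>cot x - i\<close> and
  \<open>cot x + i\<close>. The real part of the addition formula is that of the cotangent, the
  imaginary parts agree at once, and reflection is \<open>cot (pi - x) = - cot x\<close>.\<close>

lemma addition_weights_cot:
  assumes "M \<ge> 1"
  shows "addition_weights (cot_a M) (cot_b M) (cot_\<delta> M) (2 * M - 1)"
proof
  define N where "N = 2 * real M - 1"
  have N: "N > 0" "real (2 * M - 1) = N" using assms by (auto simp: N_def of_nat_diff)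
  have sin: "sin (pi * real n / N) > 0" if "1 \<le> n" "n < 2 * M - 1" for n
  proof (rule sin_gt_zero)
    have "real n < real (2 * M - 1)" using that by linarith
    hence "real n < N" using N by simp
    thus "pi * real n / N < pi" using N by (simp add: field_simps)
    show "0 < pi * real n / N" using that N by simp
  qed
  show "cot_a M n = cot_b M n + cot_\<delta> M" for n
    by (simp add: cot_a_def cot_b_def cot_\<delta>_def complex_eq_iff field_simps)
  show "cot_b M d * cot_b M m = cot_b M (d + m) * (cot_b M d + cot_a M m)"
    if "1 \<le> d" "1 \<le> m" "d + m < 2 * M - 1" for d m
  proof -
    define x y where "x = pi * real d / N" and "y = pi * real m / N"
    have xy: "pi * real (d + m) / N = x + y" by (simp add: x_def y_def add_divide_distrib distrib_left)
    have *: "cot (x + y) * (cot x + cot y) = cot x * cot y - 1"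
    proof (rule cot_add_real)
      show "sin x \<noteq> 0" "sin y \<noteq> 0" unfolding x_def y_def using sin[of d] sin[of m] that by auto
      show "sin (x + y) \<noteq> 0" unfolding xy[symmetric] using sin[of "d + m"] that by auto
    qed
    define e where "e = pi / N"
    have "e * cot (x + y) * (e * cot x + e * cot y) = e * e * (cot (x + y) * (cot x + cot y))"
      by (simp add: algebra_simps)
    also have "\<dots> = e * cot x * (e * cot y) - e * e" unfolding * by (simp add: algebra_simps)
    finally show ?thesis
      unfolding cot_a_def cot_b_def cot_weight_def N_def[symmetric] xy x_def[symmetric] y_def[symmetric] minus_divide_left[symmetric] e_def[symmetric]
      by (simp add: complex_eq_iff algebra_simps)
  qed
  show "cot_b M (2 * M - 1 - l) = - cot_a M l" if "1 \<le> l" "l < 2 * M - 1" for l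
  proof -
    have "real (2 * M - 1 - l) = N - real l" using that N by (simp add: of_nat_diff)
    hence "pi * real (2 * M - 1 - l) / N = pi * (N - real l) / N" by (simp only:)
    also have "\<dots> = pi - pi * real l / N" using N(1) by (simp add: right_diff_distrib diff_divide_distrib)
    finally have "pi * real (2 * M - 1 - l) / N = pi - pi * real l / N" .
    hence "cot (pi * real (2 * M - 1 - l) / N) = - cot (pi * real l / N)"
      by (simp add: cot_def)
    thus ?thesis by (simp add: cot_a_def cot_b_def cot_weight_def N_def complex_eq_iff)
  qed
  show "1 \<le> 2 * M - 1" using assms by linarith
qed

text \<open>The condition \<open>n < M\<close> means \<open>n < N/2\<close> for
  \<open>N = 2M - 1\<close>, so the argument of the cotangent stays below \<open>pi/2\<close>. The
  constant 8 is \<open>4 * 2\<close>, from \<open>pi < 4\<close> and the bound 2 for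
  \<open>1/y - cot y\<close>.\<close>

lemma cot_weight_bounds:
  assumes "1 \<le> n" "n < M"
  shows "0 \<le> 1 / real n - cot_weight M n" "1 / real n - cot_weight M n \<le> 8 / real M" "0 \<le> cot_weight M n"
proof -
  define N where "N = 2 * real M - 1"
  define y where "y = pi * real n / N"
  have N: "N > 0" "N \<ge> real M" "2 * real n < N" using assms by (auto simp: N_def)
  have y: "0 < y" "y < pi / 2" using N assms by (auto simp: y_def field_simps)
  have e: "1 / real n - cot_weight M n = pi / N * (1 / y - cot y)"
    using N assms by (simp add: cot_weight_def y_def N_def field_simps)
  show "0 \<le> 1 / real n - cot_weight M n"
    unfolding e using inverse_minus_cot_bounds(1)[OF y] N by simp
  have "pi / N * (1 / y - cot y) \<le> 4 / real M * 2"
    using inverse_minus_cot_bounds[OF y] N assms pi_less_4 by (intro mult_mono frac_le) auto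
  thus "1 / real n - cot_weight M n \<le> 8 / real M" unfolding e by simp
  have "cot y \<ge> 0" using y by (auto simp: cot_def intro!: divide_nonneg_pos sin_gt_zero cos_ge_zero)
  thus "0 \<le> cot_weight M n" using N by (simp add: cot_weight_def y_def N_def)
qed

lemma norm_weights:
  assumes "1 \<le> n" "n < M"
  shows "norm (cot_a M n - 1 / of_nat n) \<le> 12 / real M" "norm (cot_b M n - 1 / of_nat n) \<le> 12 / real M"
    "norm (cot_a M n) \<le> 13 / real n" "norm (cot_b M n) \<le> 13 / real n"
proof -
  have pi: "pi / (2 * real M - 1) \<le> 4 / real M"
    using assms pi_less_4 by (intro frac_le) auto
  \<comment> \<open>The real part contributes \<open>8/M\<close> and the imaginary part
    \<open>4/M\<close>.\<close>
  have "cmod (Complex (cot_weight M n - 1 / real n) s) \<le> 12 / real M" if "\<bar>s\<bar> \<le> 4 / real M" for s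
    using cmod_le[of "Complex (cot_weight M n - 1 / real n) s"] cot_weight_bounds[OF assms] that by simp
  moreover have "Complex (cot_weight M n) s - 1 / of_nat n = Complex (cot_weight M n - 1 / real n) s" for s
    by (simp add: complex_eq_iff Re_divide_of_nat Im_divide_of_nat)
  moreover have "\<bar>pi / (2 * real M - 1)\<bar> \<le> 4 / real M" using pi assms by simp
  ultimately show a: "norm (cot_a M n - 1 / of_nat n) \<le> 12 / real M" and b: "norm (cot_b M n - 1 / of_nat n) \<le> 12 / real M"
    by (simp_all add: cot_a_def cot_b_def)
  have "12 / real M \<le> 12 / real n" using assms by (intro frac_le) auto
  moreover have "norm (1 / of_nat n :: complex) = 1 / real n" by (simp add: norm_divide)
  ultimately show "norm (cot_a M n) \<le> 13 / real n" "norm (cot_b M n) \<le> 13 / real n"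
    using a b norm_triangle_sub[of "cot_a M n" "1 / of_nat n"] norm_triangle_sub[of "cot_b M n" "1 / of_nat n"]
    by (simp_all add: add_divide_distrib[symmetric])
qed

lemma norm_weight_power:
  assumes "k \<ge> 1"
  shows "\<exists>K\<ge>0. \<forall>M n. 1 \<le> n \<and> n < M \<longrightarrow>
    norm (cot_a M n * cot_b M n ^ (k - 1) - of_real (weight n k)) \<le> K / (real M * real n ^ (k - 1))"
  using assms
proof (induction k rule: dec_induct)
  case base
  show ?case using norm_weights(1) by (intro exI[of _ 12]) (auto simp: weight_def)
next
  case (step k)
  obtain K where K: "K \<ge> 0" "\<And>M n. 1 \<le> n \<Longrightarrow> n < M \<Longrightarrow>
    norm (cot_a M n * cot_b M n ^ (k - 1) - of_real (weight n k)) \<le> K / (real M * real n ^ (k - 1))"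
    using step.IH by blast
  have "norm (cot_a M n * cot_b M n ^ (Suc k - 1) - of_real (weight n (Suc k))) \<le>
      (13 * K + 12) / (real M * real n ^ (Suc k - 1))" if n: "1 \<le> n" "n < M" for M n
  proof -
    define w where "w = cot_a M n * cot_b M n ^ (k - 1)"
    have pk: "cot_b M n ^ (Suc k - 1) = cot_b M n ^ (k - 1) * cot_b M n" "real n ^ (Suc k - 1) = real n ^ (k - 1) * real n"
      using step by (cases k; simp)+
    have "real n ^ k = real n ^ (k - 1) * real n"
      using step(1) by (cases k) simp_all
    hence wt: "weight n (Suc k) = weight n k * (1 / real n)" "weight n k = 1 / (real n ^ (k - 1) * real n)"
      using n by (auto simp: weight_def)
    have "cot_a M n * cot_b M n ^ (Suc k - 1) - of_real (weight n (Suc k)) =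
        (w - of_real (weight n k)) * cot_b M n + of_real (weight n k) * (cot_b M n - 1 / of_nat n)"
      unfolding pk wt(1) w_def by (simp add: algebra_simps)
    also have "norm \<dots> \<le> K / (real M * real n ^ (k - 1)) * (13 / real n) + weight n k * (12 / real M)"
    proof (intro order.trans[OF norm_triangle_ineq] add_mono)
      show "norm ((w - of_real (weight n k)) * cot_b M n) \<le> K / (real M * real n ^ (k - 1)) * (13 / real n)"
        unfolding norm_mult using K(2)[OF n] norm_weights(4)[OF n] K(1) by (intro mult_mono) (auto simp: w_def)
      show "norm (of_real (weight n k) * (cot_b M n - 1 / of_nat n)) \<le> weight n k * (12 / real M)"
        unfolding norm_mult using norm_weights(2)[OF n] by (intro mult_mono) auto
    qed
    also have "\<dots> = (13 * K + 12) / (real M * real n ^ (Suc k - 1))"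
      unfolding pk wt(2) using n by (simp add: field_simps)
    finally show ?thesis .
  qed
  thus ?case using K(1) by (intro exI[of _ "13 * K + 12"]) auto
qed

section \<open>Comparison of the half sums with truncated multiple zeta values\<close>

definition log_bound :: "nat \<Rightarrow> real" where
  "log_bound M = 1 + hsum M"

lemma log_bound_ge_1: "log_bound M \<ge> 1"
  by (simp add: log_bound_def)

lemma trunc_le_log_bound:
  assumes "positive_index ks" "m \<le> M"
  shows "trunc ks m \<le> log_bound M ^ length ks"
proof -
  have "trunc ks m \<le> trunc ks M" using assms by (intro trunc_mono)
  also have "\<dots> \<le> hsum M ^ length ks" using assms by (intro trunc_le_hsum_power)
  also have "\<dots> \<le> log_bound M ^ length ks" by (intro power_mono) (auto simp: log_bound_def)
  finally show ?thesis .
qed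

lemma trunc_Cons: "trunc (k # ks) m = (\<Sum>n\<in>{1..<m}. weight n k * trunc ks n)"
  unfolding trunc.simps by (intro sum.mono_neutral_right) (auto simp: weight_def)

text \<open>The factor \<open>m/M\<close> in the hypothesis supplies a factor \<open>n\<close> that
  offsets one power in \<open>weight n k\<close>, so both error terms of the summand have order
  \<open>1/(M n^(k-1))\<close> up to logarithms. The sum over \<open>n\<close> is kept because
  \<open>k = 1\<close> and \<open>k \<ge> 2\<close> call for different bounds.\<close>

lemma zsum_trunc_step:
  assumes "k \<ge> 1" "positive_index ks" "K \<ge> 0"
    and K: "\<And>M m. m \<le> M \<Longrightarrow> norm (zsum (cot_a M) (cot_b M) ks m - of_real (trunc ks m)) \<le> K * (real m / real M) * log_bound M ^ length ks"
  shows "\<exists>K'\<ge>0. \<forall>M m. m \<le> M \<longrightarrow> norm (zsum (cot_a M) (cot_b M) (k # ks) m - of_real (trunc (k # ks) m)) \<le>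
     K' / real M * log_bound M ^ length ks * (\<Sum>n\<in>{1..<m}. 1 / real n ^ (k - 1))"
proof -
  obtain C where C: "C \<ge> 0" "\<And>M n. 1 \<le> n \<Longrightarrow> n < M \<Longrightarrow>
    norm (cot_a M n * cot_b M n ^ (k - 1) - of_real (weight n k)) \<le> C / (real M * real n ^ (k - 1))"
    using norm_weight_power[OF assms(1)] by blast
  have "norm (zsum (cot_a M) (cot_b M) (k # ks) m - of_real (trunc (k # ks) m)) \<le>
     (C * (1 + K) + K) / real M * log_bound M ^ length ks * (\<Sum>n\<in>{1..<m}. 1 / real n ^ (k - 1))"
    if m: "m \<le> M" for M m
  proof -
    let ?H = "log_bound M ^ length ks"
    have H: "?H \<ge> 0" using log_bound_ge_1[of M] by simp
    have "norm (zsum (cot_a M) (cot_b M) (k # ks) m - of_real (trunc (k # ks) m)) \<le>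
        (\<Sum>n\<in>{1..<m}. norm (cot_a M n * cot_b M n ^ (k - 1) * zsum (cot_a M) (cot_b M) ks n
                            - of_real (weight n k * trunc ks n)))"
      unfolding zsum.simps trunc_Cons of_real_sum sum_subtractf[symmetric] by (rule norm_sum)
    also have "\<dots> \<le> (\<Sum>n\<in>{1..<m}. (C * (1 + K) + K) / real M * ?H * (1 / real n ^ (k - 1)))"
    proof (intro sum_mono)
      fix n assume "n \<in> {1..<m}"
      hence n: "1 \<le> n" "n < M" "n \<le> M" using m by auto
      define w z where "w = cot_a M n * cot_b M n ^ (k - 1)" and "z = zsum (cot_a M) (cot_b M) ks n"
      have "real n / real M \<le> 1" using n by simp
      hence "K * (real n / real M) * ?H \<le> K * 1 * ?H"
        using assms(3) H by (intro mult_right_mono mult_left_mono) auto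
      hence "norm (z - of_real (trunc ks n)) \<le> K * ?H"
        using K[OF n(3)] by (simp add: z_def)
      moreover have "norm (of_real (trunc ks n) :: complex) \<le> ?H"
        using trunc_le_log_bound[OF assms(2) n(3)] by simp
      ultimately have z: "norm z \<le> (1 + K) * ?H"
        using norm_triangle_sub[of z "of_real (trunc ks n)"] by (simp add: distrib_right)
      have "w * z - of_real (weight n k * trunc ks n) =
          (w - of_real (weight n k)) * z + of_real (weight n k) * (z - of_real (trunc ks n))"
        by (simp add: algebra_simps)
      also have "norm \<dots> \<le> C / (real M * real n ^ (k - 1)) * ((1 + K) * ?H)
            + weight n k * (K * (real n / real M) * ?H)"
      proof (intro order.trans[OF norm_triangle_ineq] add_mono)
        show "norm ((w - of_real (weight n k)) * z) \<le> C / (real M * real n ^ (k - 1)) * ((1 + K) * ?H)"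
          unfolding norm_mult using C(2)[OF n(1,2)] C(1) z by (intro mult_mono) (auto simp: w_def)
        show "norm (of_real (weight n k) * (z - of_real (trunc ks n))) \<le>
            weight n k * (K * (real n / real M) * ?H)"
          unfolding norm_mult using K[OF n(3)] by (intro mult_mono) (auto simp: z_def)
      qed
      also have "weight n k = 1 / (real n ^ (k - 1) * real n)"
        using n assms(1) by (cases k) (simp_all add: weight_def mult.commute)
      hence "C / (real M * real n ^ (k - 1)) * ((1 + K) * ?H) + weight n k * (K * (real n / real M) * ?H) =
          (C * (1 + K) + K) / real M * ?H * (1 / real n ^ (k - 1))"
        using n by (simp add: field_simps)
      finally show "norm (cot_a M n * cot_b M n ^ (k - 1) * zsum (cot_a M) (cot_b M) ks n
                            - of_real (weight n k * trunc ks n)) \<le>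
          (C * (1 + K) + K) / real M * ?H * (1 / real n ^ (k - 1))" by (simp add: w_def z_def)
    qed
    also have "\<dots> = (C * (1 + K) + K) / real M * ?H * (\<Sum>n\<in>{1..<m}. 1 / real n ^ (k - 1))"
      by (simp only: sum_distrib_left)
    finally show ?thesis .
  qed
  thus ?thesis using C(1) assms(3) by (intro exI[of _ "C * (1 + K) + K"]) auto
qed

lemma zsum_trunc:
  assumes "positive_index ks"
  shows "\<exists>K\<ge>0. \<forall>M m. m \<le> M \<longrightarrow>
    norm (zsum (cot_a M) (cot_b M) ks m - of_real (trunc ks m)) \<le> K * (real m / real M) * log_bound M ^ length ks"
  using assms
proof (induction ks)
  case Nil
  show ?case by (intro exI[of _ 0]) simp
next
  case (Cons k ks)
  have k: "k \<ge> 1" "positive_index ks" using Cons.prems by auto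
  obtain K where K: "K \<ge> 0" "\<And>M m. m \<le> M \<Longrightarrow>
    norm (zsum (cot_a M) (cot_b M) ks m - of_real (trunc ks m)) \<le> K * (real m / real M) * log_bound M ^ length ks"
    using Cons.IH[OF k(2)] by blast
  obtain K' where K': "K' \<ge> 0"
    "\<And>M m. m \<le> M \<Longrightarrow> norm (zsum (cot_a M) (cot_b M) (k # ks) m - of_real (trunc (k # ks) m)) \<le>
     K' / real M * log_bound M ^ length ks * (\<Sum>n\<in>{1..<m}. 1 / real n ^ (k - 1))"
    using zsum_trunc_step[OF k K] by blast
  have "norm (zsum (cot_a M) (cot_b M) (k # ks) m - of_real (trunc (k # ks) m)) \<le>
      K' * (real m / real M) * log_bound M ^ length (k # ks)" if m: "m \<le> M" for M m
  proof -
    have "(\<Sum>n\<in>{1..<m}. 1 / real n ^ (k - 1)) \<le> (\<Sum>n\<in>{1..<m}. 1)"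
      by (intro sum_mono) (auto simp: divide_le_eq one_le_power)
    hence s: "(\<Sum>n\<in>{1..<m}. 1 / real n ^ (k - 1)) \<le> real m" by simp
    have "norm (zsum (cot_a M) (cot_b M) (k # ks) m - of_real (trunc (k # ks) m)) \<le>
        K' / real M * log_bound M ^ length ks * real m"
      using s K' log_bound_ge_1[of M] by (intro order.trans[OF K'(2)[OF m]] mult_left_mono) auto
    also have "\<dots> = K' * (real m / real M) * log_bound M ^ length ks" by simp
    also have "\<dots> \<le> K' * (real m / real M) * log_bound M ^ length (k # ks)"
      using K' log_bound_ge_1[of M] by (intro mult_left_mono power_increasing) auto
    finally show ?thesis .
  qed
  thus ?case using K'(1) by blast
qed

lemma zsum_half_bound:
  assumes "positive_index ks"
  shows "\<exists>K\<ge>0. \<forall>M\<ge>1. norm (zsum (cot_a M) (cot_b M) ks M) \<le> K * log_bound M ^ length ks"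
proof -
  obtain K where K: "K \<ge> 0" "\<And>M m. m \<le> M \<Longrightarrow>
    norm (zsum (cot_a M) (cot_b M) ks m - of_real (trunc ks m)) \<le> K * (real m / real M) * log_bound M ^ length ks"
    using zsum_trunc[OF assms] by blast
  have "norm (zsum (cot_a M) (cot_b M) ks M) \<le> (1 + K) * log_bound M ^ length ks" if "M \<ge> 1" for M
    using norm_triangle_sub[of "zsum (cot_a M) (cot_b M) ks M" "of_real (trunc ks M)"]
      K(2)[of M M] trunc_le_log_bound[OF assms, of M M] that by (simp add: distrib_right)
  thus ?thesis using K(1) by (intro exI[of _ "1 + K"]) auto
qed

text \<open>For a leading entry of at least 2 the remaining sum over \<open>n\<close> is at most
  harmonic, so the error is a power of the logarithm divided by \<open>M\<close> and tends to
  0.\<close>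

lemma zsum_half_admissible:
  assumes "admissible ks"
  shows "\<exists>K\<ge>0. \<forall>M. norm (zsum (cot_a M) (cot_b M) ks M - of_real (trunc ks M)) \<le> K * (log_bound M ^ length ks / real M)"
proof (cases ks)
  case Nil
  show ?thesis by (intro exI[of _ 0]) (simp add: Nil)
next
  case (Cons k ls)
  have k: "k \<ge> 2" "k \<ge> 1" "positive_index ls" using assms by (auto simp: admissible_def Cons)
  obtain K where K: "K \<ge> 0" "\<And>M m. m \<le> M \<Longrightarrow>
    norm (zsum (cot_a M) (cot_b M) ls m - of_real (trunc ls m)) \<le> K * (real m / real M) * log_bound M ^ length ls"
    using zsum_trunc[OF k(3)] by blast
  obtain K' where K': "K' \<ge> 0"
    "\<And>M m. m \<le> M \<Longrightarrow> norm (zsum (cot_a M) (cot_b M) (k # ls) m - of_real (trunc (k # ls) m)) \<le>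
     K' / real M * log_bound M ^ length ls * (\<Sum>n\<in>{1..<m}. 1 / real n ^ (k - 1))"
    using zsum_trunc_step[OF k(2,3) K] by blast
  have "norm (zsum (cot_a M) (cot_b M) ks M - of_real (trunc ks M)) \<le> K' * (log_bound M ^ length ks / real M)" for M
  proof -
    have "(\<Sum>n\<in>{1..<M}. 1 / real n ^ (k - 1)) \<le> (\<Sum>n\<in>{1..<M}. weight n 1 * trunc [] n)"
    proof (intro sum_mono)
      fix n assume "n \<in> {1..<M}"
      hence "1 / real n ^ (k - 1) \<le> 1 / real n ^ 1"
        using k by (intro divide_left_mono power_increasing) auto
      thus "1 / real n ^ (k - 1) \<le> weight n 1 * trunc [] n"
        using \<open>n \<in> _\<close> by (simp add: weight_def)
    qed
    also have "\<dots> = hsum M" unfolding hsum_def trunc_Cons ..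
    also have "\<dots> \<le> log_bound M" by (simp add: log_bound_def)
    finally have s: "(\<Sum>n\<in>{1..<M}. 1 / real n ^ (k - 1)) \<le> log_bound M" .
    have "norm (zsum (cot_a M) (cot_b M) ks M - of_real (trunc ks M)) \<le> K' / real M * log_bound M ^ length ls * log_bound M"
      unfolding Cons using s K' log_bound_ge_1[of M] by (intro order.trans[OF K'(2)[OF order_refl]] mult_left_mono) auto
    thus ?thesis by (simp add: Cons mult_ac)
  qed
  thus ?thesis using K'(1) by blast
qed

lemma negl_log_bound: "negl (\<lambda>M. log_bound M ^ l / real M)"
  unfolding negl_def
proof
  fix j
  show "(\<lambda>M. log_bound M ^ l / real M * hsum M ^ j) \<longlonglongrightarrow> 0"
  proof (rule tendsto_sandwich[OF _ _ tendsto_const])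
    show "\<forall>\<^sub>F M in sequentially. 0 \<le> log_bound M ^ l / real M * hsum M ^ j"
      by (intro always_eventually allI mult_nonneg_nonneg divide_nonneg_nonneg) (auto simp: log_bound_def)
    show "\<forall>\<^sub>F M in sequentially. log_bound M ^ l / real M * hsum M ^ j \<le> (2 + ln (real M)) ^ (l + j) / real M"
      using eventually_gt_at_top[of 1]
    proof eventually_elim
      case (elim M)
      have "hsum M \<le> hsum (Suc M)" by (rule hsum_mono) simp
      also have "\<dots> \<le> 1 + ln (real M)"
        using euler_mascheroni_sequence_decreasing[of 1 M] elim by (simp add: hsum_eq harm_expand)
      finally have h: "hsum M \<le> 1 + ln (real M)" .
      have "log_bound M ^ l * hsum M ^ j \<le> (2 + ln (real M)) ^ l * (2 + ln (real M)) ^ j"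
        using h elim by (intro mult_mono power_mono) (auto simp: log_bound_def intro!: zero_le_power add_nonneg_nonneg)
      thus ?case using elim by (simp add: power_add divide_right_mono)
    qed
    show "(\<lambda>M. (2 + ln (real M)) ^ (l + j) / real M) \<longlonglongrightarrow> 0"
      by real_asymp
  qed
qed

section \<open>Symmetric multiple zeta values\<close>

text \<open>\<open>represents x z\<close> says that \<open>x\<close>, an element of the ring \<open>Z_R + \<pi>\<i> Z_R\<close>, is congruent to
  \<open>z\<close> modulo the ideal generated by \<open>\<pi>\<i>\<close>, which meets the reals in \<open>\<zeta>(2) Z_R\<close>.\<close>

definition represents :: "complex \<Rightarrow> real \<Rightarrow> bool" where
  "represents x z \<longleftrightarrow> z \<in> Z_R \<and> (\<exists>u\<in>Z_R. Re x = z + mzv [2] * u) \<and> (\<exists>v\<in>Z_R. Im x = pi * v)"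

lemma representsI:
  "z \<in> Z_R \<Longrightarrow> u \<in> Z_R \<Longrightarrow> v \<in> Z_R \<Longrightarrow> Re x = z + mzv [2] * u \<Longrightarrow> Im x = pi * v \<Longrightarrow> represents x z"
  unfolding represents_def by blast

lemma representsE:
  assumes "represents x z"
  obtains u v where "z \<in> Z_R" "u \<in> Z_R" "v \<in> Z_R" "Re x = z + mzv [2] * u" "Im x = pi * v"
  using assms unfolding represents_def by blast

lemma mzv2: "mzv [2] = pi\<^sup>2 / 6"
proof -
  have eq: "trunc [2] = (\<lambda>N. \<Sum>n<N - 1. 1 / (real n + 1)\<^sup>2)"
  proof
    fix N
    show "trunc [2] N = (\<Sum>n<N - 1. 1 / (real n + 1)\<^sup>2)"
    proof (cases N)
      case (Suc m)
      have "trunc [2] (Suc m) = (\<Sum>n<m. 1 / (real n + 1)\<^sup>2)"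
        by (induction m) (simp_all add: weight_def add.commute)
      thus ?thesis using Suc by simp
    qed simp
  qed
  have "(\<lambda>N. \<Sum>n<N - 1. 1 / (real n + 1)\<^sup>2) \<longlonglongrightarrow> pi\<^sup>2 / 6"
  proof (subst filterlim_sequentially_Suc[symmetric])
    show "(\<lambda>N. \<Sum>n<Suc N - 1. 1 / (real n + 1)\<^sup>2) \<longlonglongrightarrow> pi\<^sup>2 / 6"
      using inverse_squares_sums by (simp add: sums_def add.commute)
  qed
  hence "trunc [2] \<longlonglongrightarrow> pi\<^sup>2 / 6" unfolding eq .
  thus ?thesis unfolding mzv_def by (intro infsumI has_sum_mzv)
qed

lemma represents_of_real: "z \<in> Z_R \<Longrightarrow> represents (of_real z) z"
  by (rule representsI[of _ 0 0]) auto

lemma represents_cnj: "represents x z \<Longrightarrow> represents (cnj x) z"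
proof (elim representsE)
  fix u v assume "z \<in> Z_R" "u \<in> Z_R" "v \<in> Z_R" "Re x = z + mzv [2] * u" "Im x = pi * v"
  thus "represents (cnj x) z" by (intro representsI[of z u "- v"]) (auto simp: Z_R_uminus)
qed

lemma represents_add:
  assumes "represents x z" "represents y w"
  shows "represents (x + y) (z + w)"
  using assms
proof (elim representsE)
  fix u v u' v'
  assume *: "z \<in> Z_R" "u \<in> Z_R" "v \<in> Z_R" "Re x = z + mzv [2] * u" "Im x = pi * v"
    "w \<in> Z_R" "u' \<in> Z_R" "v' \<in> Z_R" "Re y = w + mzv [2] * u'" "Im y = pi * v'"
  show ?thesis
    by (rule representsI[of _ "u + u'" "v + v'"]) (use * in \<open>auto intro!: Z_R_add simp: algebra_simps\<close>)
qed

text \<open>The product of the two imaginary parts is \<open>pi^2 v v' = 6 \<zeta>(2) v v'\<close>,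
  hence a multiple of \<open>\<zeta>(2)\<close> inside \<open>Z_R\<close>.\<close>

lemma represents_mult:
  assumes "represents x z" "represents y w"
  shows "represents (x * y) (z * w)"
  using assms
proof (elim representsE)
  fix u v u' v'
  assume *: "z \<in> Z_R" "u \<in> Z_R" "v \<in> Z_R" "Re x = z + mzv [2] * u" "Im x = pi * v"
    "w \<in> Z_R" "u' \<in> Z_R" "v' \<in> Z_R" "Re y = w + mzv [2] * u'" "Im y = pi * v'"
  have pi2: "pi * pi = 6 * mzv [2]" by (simp add: mzv2 power2_eq_square)
  have "of_rat 6 * (v * v') \<in> Z_R" using * by (intro Z_R_scale Z_R_mult)
  hence six: "6 * (v * v') \<in> Z_R" by simp
  show ?thesis
  proof (rule representsI)
    show "z * w \<in> Z_R" using * by (intro Z_R_mult)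
    show "z * u' + u * w + mzv [2] * (u * u') - 6 * (v * v') \<in> Z_R"
      using * mzv2_in_Z_R by (intro Z_R_diff[OF _ six] Z_R_add Z_R_mult)
    show "(z + mzv [2] * u) * v' + v * (w + mzv [2] * u') \<in> Z_R"
      using * mzv2_in_Z_R by (intro Z_R_add Z_R_mult)
    have "Re (x * y) = (z + mzv [2] * u) * (w + mzv [2] * u') - (pi * pi) * (v * v')"
      by (simp add: *)
    thus "Re (x * y) = z * w + mzv [2] * (z * u' + u * w + mzv [2] * (u * u') - 6 * (v * v'))"
      unfolding pi2 by (simp add: algebra_simps)
    show "Im (x * y) = pi * ((z + mzv [2] * u) * v' + v * (w + mzv [2] * u'))"
      by (simp add: * algebra_simps)
  qed
qed

lemma represents_0: "represents 0 0"
  using represents_of_real[of 0] by simp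

lemma represents_pi: "q \<in> Z_R \<Longrightarrow> represents (Complex 0 (pi * q)) 0"
  by (rule representsI[of _ 0 q]) auto

lemma inverse_of_nat_in_Z_R: "1 / real c \<in> Z_R"
  using Z_R_scale[of 1 "1 / of_nat c"] by (simp add: of_rat_divide)

lemma represents_inverse_of_nat: "represents (1 / of_nat c) (1 / real c)"
  using represents_of_real[OF inverse_of_nat_in_Z_R[of c]] by simp

lemma represents_minus_one: "represents (- 1) (- 1)"
  using represents_of_real[OF Z_R_uminus[OF Z_R_1]] by simp

lemma represents_minus_one_power: "represents ((- 1) ^ n) ((- 1) ^ n)"
  by (induction n) (use represents_of_real[OF Z_R_1] represents_mult[OF represents_minus_one] in simp_all)

lemma represents_sum_list:
  "(\<And>x. x \<in> set xs \<Longrightarrow> represents (f x) (g x)) \<Longrightarrow> represents (\<Sum>x\<leftarrow>xs. f x) (\<Sum>x\<leftarrow>xs. g x)"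
  by (induction xs) (auto intro: represents_0 represents_add)

lemma represents_sum:
  "(\<And>x. x \<in> A \<Longrightarrow> represents (f x) (g x)) \<Longrightarrow> represents (sum f A) (sum g A)"
  by (rule sum_related[where P = represents]) (auto intro: represents_0 represents_add)

lemma represents_unique:
  assumes "represents x z" "represents x w"
  shows "S_rel z w"
  using assms
proof (elim representsE)
  fix u v u' v'
  assume *: "z \<in> Z_R" "u \<in> Z_R" "Re x = z + mzv [2] * u" "w \<in> Z_R" "u' \<in> Z_R" "Re x = w + mzv [2] * u'"
  show ?thesis by (rule S_relI[of _ _ "u' - u"]) (use * in \<open>auto intro: Z_R_diff simp: algebra_simps\<close>)
qed

section \<open>Asymptotic expansions in the cotangent sum\<close>

definition cot_sum :: "nat \<Rightarrow> real" where
  "cot_sum M = (\<Sum>n\<in>{1..<M}. cot_weight M n)"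

lemma hsum_eq_sum: "hsum M = (\<Sum>n\<in>{1..<M}. 1 / real n)"
  unfolding hsum_def trunc_Cons by (intro sum.cong) (auto simp: weight_def)

lemma cot_sum_bounds: "0 \<le> cot_sum M" "cot_sum M \<le> hsum M" "hsum M - 8 \<le> cot_sum M"
proof -
  show "0 \<le> cot_sum M" unfolding cot_sum_def using cot_weight_bounds(3) by (intro sum_nonneg) auto
  show "cot_sum M \<le> hsum M"
    unfolding cot_sum_def hsum_eq_sum using cot_weight_bounds(1) by (intro sum_mono) (auto simp: diff_ge_0_iff_ge)
  have "hsum M - cot_sum M = (\<Sum>n\<in>{1..<M}. 1 / real n - cot_weight M n)"
    by (simp add: cot_sum_def hsum_eq_sum sum_subtractf)
  also have "\<dots> \<le> (\<Sum>n\<in>{1..<M}. 8 / real M)"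
    using cot_weight_bounds(2) by (intro sum_mono) auto
  also have "\<dots> \<le> 8" by (cases "M = 0") (auto simp: field_simps of_nat_diff)
  finally show "hsum M - 8 \<le> cot_sum M" by simp
qed

lemma negl_mono:
  assumes "negl v" "\<And>M. \<bar>u M\<bar> \<le> v M"
  shows "negl u"
  unfolding negl_def
proof
  fix j
  have "(\<lambda>M. v M * hsum M ^ j) \<longlonglongrightarrow> 0" using assms(1) by (simp add: negl_def)
  moreover have "norm (u M * hsum M ^ j) \<le> v M * hsum M ^ j" for M
    using assms(2)[of M] by (simp add: abs_mult mult_right_mono)
  ultimately show "(\<lambda>M. u M * hsum M ^ j) \<longlonglongrightarrow> 0"
    by (intro Lim_null_comparison[of "\<lambda>M. u M * hsum M ^ j" "\<lambda>M. v M * hsum M ^ j"]) auto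
qed

definition cexpands :: "(nat \<Rightarrow> complex) \<Rightarrow> complex poly \<Rightarrow> bool" where
  "cexpands u P \<longleftrightarrow> negl (\<lambda>M. norm (u M - poly P (of_real (cot_sum M))))"

text \<open>By its lower bound \<open>cot_sum\<close> tends to infinity, and a nonzero polynomial in
  it cannot tend to 0.\<close>

lemma cexpands_unique:
  assumes "cexpands u P" "cexpands u Q"
  shows "P = Q"
proof (rule ccontr)
  assume "P \<noteq> Q"
  define R where "R = P - Q"
  have "(\<lambda>M. u M - poly P (of_real (cot_sum M))) \<longlonglongrightarrow> 0" "(\<lambda>M. u M - poly Q (of_real (cot_sum M))) \<longlonglongrightarrow> 0"
    using assms negl_tendsto tendsto_norm_zero_iff unfolding cexpands_def by blast+
  from tendsto_diff[OF this(2,1)] have lim: "(\<lambda>M. poly R (of_real (cot_sum M))) \<longlonglongrightarrow> 0"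
    by (simp add: R_def)
  have "filterlim cot_sum at_top sequentially"
  proof (rule filterlim_at_top_mono)
    show "filterlim (\<lambda>M. - 8 + hsum M) at_top sequentially"
      by (rule filterlim_tendsto_add_at_top[OF tendsto_const hsum_at_top])
    show "\<forall>\<^sub>F M in sequentially. - 8 + hsum M \<le> cot_sum M"
      using cot_sum_bounds(3) by (simp add: algebra_simps)
  qed
  hence inf: "filterlim (\<lambda>M. complex_of_real (cot_sum M)) at_infinity sequentially"
    by (intro tendsto_of_real_iff[THEN iffD1] filterlim_compose[OF filterlim_of_real_at_infinity])
  show False
  proof (cases "degree R = 0")
    case True
    then obtain c where "R = [:c:]" by (metis degree_eq_zeroE)
    thus False using lim \<open>P \<noteq> Q\<close> by (simp add: R_def LIMSEQ_const_iff)
  next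
    case False
    have "filterlim (\<lambda>M. poly R (of_real (cot_sum M))) at_infinity sequentially"
      using filterlim_compose[OF filterlim_poly_at_infinity inf] False by simp
    thus False using lim not_tendsto_and_filterlim_at_infinity by (metis sequentially_bot)
  qed
qed

lemma cexpands_add:
  assumes "cexpands u P" "cexpands v Q"
  shows "cexpands (\<lambda>M. u M + v M) (P + Q)"
  unfolding cexpands_def
proof (rule negl_mono[OF negl_add[OF assms[unfolded cexpands_def]]])
  fix M
  let ?h = "complex_of_real (cot_sum M)"
  show "\<bar>norm (u M + v M - poly (P + Q) ?h)\<bar> \<le> norm (u M - poly P ?h) + norm (v M - poly Q ?h)"
    using norm_triangle_ineq[of "u M - poly P ?h" "v M - poly Q ?h"] by (simp add: algebra_simps)
qed

text \<open>Negligibility is measured against powers of \<open>hsum\<close>, which dominates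
  \<open>cot_sum\<close>.\<close>

lemma negl_norm_poly:
  "negl (\<lambda>M. norm (u M)) \<Longrightarrow> negl (\<lambda>M. norm (u M * poly P (complex_of_real (cot_sum M))))"
proof (induction P)
  case (pCons a P)
  let ?h = "\<lambda>M. complex_of_real (cot_sum M)"
  have "negl (\<lambda>M. norm a * norm (u M) + norm (u M * poly P (?h M)) * hsum M)"
    using pCons by (intro negl_add negl_cmult negl_hsum)
  thus ?case
  proof (rule negl_mono)
    fix M
    have "u M * poly (pCons a P) (?h M) = a * u M + (u M * poly P (?h M)) * ?h M"
      by (simp add: algebra_simps)
    also have "norm \<dots> \<le> norm a * norm (u M) + norm (u M * poly P (?h M)) * cot_sum M"
      using cot_sum_bounds(1)[of M] by (intro order.trans[OF norm_triangle_ineq]) (simp add: norm_mult)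
    also have "\<dots> \<le> norm a * norm (u M) + norm (u M * poly P (?h M)) * hsum M"
      using cot_sum_bounds(2)[of M] by (intro add_left_mono mult_left_mono) auto
    finally show "\<bar>norm (u M * poly (pCons a P) (?h M))\<bar> \<le>
        norm a * norm (u M) + norm (u M * poly P (?h M)) * hsum M" by simp
  qed
qed (simp add: negl_0)

lemma cexpands_mult:
  assumes "cexpands u P" "cexpands v Q"
  shows "cexpands (\<lambda>M. u M * v M) (P * Q)"
proof -
  let ?h = "\<lambda>M. complex_of_real (cot_sum M)"
  define d where "d = (\<lambda>M. u M - poly P (?h M))"
  define e where "e = (\<lambda>M. v M - poly Q (?h M))"
  have de: "negl (\<lambda>M. norm (d M))" "negl (\<lambda>M. norm (e M))"
    using assms by (auto simp: d_def e_def cexpands_def)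
  have "negl (\<lambda>M. norm (d M) * norm (e M) + norm (d M * poly Q (?h M)) + norm (e M * poly P (?h M)))"
    using de by (intro negl_add negl_norm_poly negl_mult[OF _ negl_tendsto])
  thus ?thesis unfolding cexpands_def
  proof (rule negl_mono)
    fix M
    have eq: "u M * v M - poly (P * Q) (?h M) = d M * e M + d M * poly Q (?h M) + e M * poly P (?h M)"
      by (simp add: d_def e_def algebra_simps)
    show "\<bar>norm (u M * v M - poly (P * Q) (?h M))\<bar> \<le>
        norm (d M) * norm (e M) + norm (d M * poly Q (?h M)) + norm (e M * poly P (?h M))"
      unfolding eq using norm_triangle_ineq[of "d M * e M + d M * poly Q (?h M)" "e M * poly P (?h M)"]
        norm_triangle_ineq[of "d M * e M" "d M * poly Q (?h M)"] by (simp add: norm_mult)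
  qed
qed

lemma cexpands_const: "cexpands (\<lambda>_. c) [:c:]"
  by (simp add: cexpands_def negl_0)

lemma cexpands_0: "cexpands (\<lambda>_. 0) 0"
  by (simp add: cexpands_def negl_0)

lemma cexpands_cmult: "cexpands u P \<Longrightarrow> cexpands (\<lambda>M. c * u M) (smult c P)"
  using cexpands_mult[OF cexpands_const] by fastforce

lemma cexpands_sum_list:
  "(\<And>x. x \<in> set xs \<Longrightarrow> cexpands (f x) (P x)) \<Longrightarrow>
     cexpands (\<lambda>M. \<Sum>x\<leftarrow>xs. f x M) (\<Sum>x\<leftarrow>xs. P x)"
proof (induction xs)
  case (Cons x xs)
  show ?case unfolding list.map sum_list.Cons by (rule cexpands_add) (use Cons in auto)
qed (simp add: cexpands_0)

lemma cexpands_sum: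
  assumes "\<And>x. x \<in> A \<Longrightarrow> cexpands (f x) (P x)"
  shows "cexpands (\<lambda>M. \<Sum>x\<in>A. f x M) (\<Sum>x\<in>A. P x)"
  using assms
proof (induction A rule: infinite_finite_induct)
  case (insert x A)
  have "cexpands (\<lambda>M. f x M + (\<Sum>x\<in>A. f x M)) (P x + (\<Sum>x\<in>A. P x))"
    by (rule cexpands_add) (use insert in auto)
  thus ?case using insert.hyps by simp
qed (simp_all add: cexpands_0)

lemma cexpands_cnj:
  assumes "cexpands u P"
  shows "cexpands (\<lambda>M. cnj (u M)) (map_poly cnj P)"
proof -
  have eq: "norm (cnj (u M) - poly (map_poly cnj P) (complex_of_real (cot_sum M))) =
        norm (u M - poly P (complex_of_real (cot_sum M)))" for M
  proof -
    have "cnj (u M) - poly (map_poly cnj P) (complex_of_real (cot_sum M)) =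
        cnj (u M - poly P (complex_of_real (cot_sum M)))"
      by (simp add: poly_map_poly_cnj)
    thus ?thesis by (simp only: complex_mod_cnj)
  qed
  show ?thesis using assms unfolding cexpands_def eq .
qed

text \<open>Identities are available for \<open>M \<ge> 1\<close> only: at \<open>M = 0\<close> the
  endpoint \<open>2 * M - 1\<close> truncates to 0, outside the range of
  \<open>addition_weights\<close>.\<close>

lemma cexpands_cong:
  assumes "cexpands u P" "\<And>M. M \<ge> 1 \<Longrightarrow> u M = v M"
  shows "cexpands v P"
proof -
  have "(\<lambda>M. norm (v M - poly P (of_real (cot_sum M))) * hsum M ^ j) \<longlonglongrightarrow> 0" for j
  proof (rule Lim_transform_eventually)
    show "(\<lambda>M. norm (u M - poly P (of_real (cot_sum M))) * hsum M ^ j) \<longlonglongrightarrow> 0"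
      using assms(1) by (simp add: cexpands_def negl_def)
    show "\<forall>\<^sub>F M in sequentially. norm (u M - poly P (of_real (cot_sum M))) * hsum M ^ j =
        norm (v M - poly P (of_real (cot_sum M))) * hsum M ^ j"
      using eventually_ge_at_top[of 1] by eventually_elim (simp add: assms(2))
  qed
  thus ?thesis by (simp add: cexpands_def negl_def)
qed

lemma cexpands_approx:
  assumes "\<And>M. M \<ge> 1 \<Longrightarrow> norm (u M - poly P (of_real (cot_sum M))) \<le> K * (log_bound M ^ l / real M)"
  shows "cexpands u P"
  unfolding cexpands_def negl_def
proof
  fix j
  show "(\<lambda>M. norm (u M - poly P (of_real (cot_sum M))) * hsum M ^ j) \<longlonglongrightarrow> 0"
  proof (rule Lim_null_comparison)
    show "(\<lambda>M. K * (log_bound M ^ l / real M) * hsum M ^ j) \<longlonglongrightarrow> 0"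
      using negl_cmult[OF negl_log_bound] unfolding negl_def by blast
    show "\<forall>\<^sub>F M in sequentially. norm (norm (u M - poly P (of_real (cot_sum M))) * hsum M ^ j) \<le>
        K * (log_bound M ^ l / real M) * hsum M ^ j"
      using eventually_ge_at_top[of 1]
    proof eventually_elim
      case (elim M)
      have "norm (u M - poly P (of_real (cot_sum M))) * hsum M ^ j \<le> K * (log_bound M ^ l / real M) * hsum M ^ j"
        using assms[OF elim] by (rule mult_right_mono) simp
      thus ?case by (simp add: abs_mult)
    qed
  qed
qed

text \<open>The real part is exactly \<open>cot_sum\<close>, which is why expansions use this
  variable. The imaginary part is \<open>M - 1 = (N - 1)/2\<close> copies of \<open>-pi/N\<close>,
  that is \<open>-pi/2\<close> up to \<open>pi/(2N)\<close>.\<close>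

lemma cexpands_zsum_one: "cexpands (\<lambda>M. zsum (cot_a M) (cot_b M) [1] M) [:Complex 0 (- pi / 2), 1:]"
proof (rule cexpands_approx[of _ _ 4 0])
  fix M :: nat assume M: "M \<ge> 1"
  define N where "N = 2 * real M - 1"
  have N: "N > 0" "N \<ge> real M" "real (M - 1) = (N - 1) / 2" using M by (auto simp: N_def of_nat_diff)
  have "zsum (cot_a M) (cot_b M) [1] M = (\<Sum>n\<in>{1..<M}. Complex (cot_weight M n) (- pi / N))"
    by (simp add: cot_a_def N_def)
  also have "\<dots> = Complex (cot_sum M) (real (M - 1) * (- pi / N))"
    by (simp add: complex_eq_iff cot_sum_def)
  finally have "zsum (cot_a M) (cot_b M) [1] M - poly [:Complex 0 (- pi / 2), 1:] (of_real (cot_sum M)) =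
      Complex 0 (pi / (2 * N))"
    unfolding N(3) using N(1) by (simp add: complex_eq_iff field_simps)
  hence "norm (zsum (cot_a M) (cot_b M) [1] M - poly [:Complex 0 (- pi / 2), 1:] (of_real (cot_sum M))) = pi / (2 * N)"
    using N(1) by (simp add: cmod_def)
  also have "\<dots> \<le> 4 / real M" using N M pi_less_4 by (intro frac_le) auto
  finally show "norm (zsum (cot_a M) (cot_b M) [1] M - poly [:Complex 0 (- pi / 2), 1:] (of_real (cot_sum M))) \<le>
      4 * (log_bound M ^ 0 / real M)" by simp
qed

lemma norm_cot_\<delta>: "M \<ge> 1 \<Longrightarrow> norm (cot_\<delta> M) \<le> 8 / real M"
proof -
  assume M: "M \<ge> 1"
  hence "norm (cot_\<delta> M) = 2 * pi / (2 * real M - 1)" by (simp add: cot_\<delta>_def cmod_def)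
  also have "\<dots> \<le> 8 / real M" using M pi_less_4 by (intro frac_le) auto
  finally show ?thesis .
qed

lemma cexpands_cot_\<delta>_zsum:
  assumes "positive_index ks"
  shows "cexpands (\<lambda>M. c * cot_\<delta> M * zsum (cot_a M) (cot_b M) ks M) 0"
proof -
  obtain K where K: "K \<ge> 0" "\<And>M. M \<ge> 1 \<Longrightarrow> norm (zsum (cot_a M) (cot_b M) ks M) \<le> K * log_bound M ^ length ks"
    using zsum_half_bound[OF assms] by blast
  show ?thesis
  proof (rule cexpands_approx[of _ _ "norm c * 8 * K" "length ks"])
    fix M :: nat assume M: "M \<ge> 1"
    have "norm (c * cot_\<delta> M * zsum (cot_a M) (cot_b M) ks M) \<le> norm c * (8 / real M) * (K * log_bound M ^ length ks)"
      unfolding norm_mult using norm_cot_\<delta>[OF M] K(2)[OF M] by (intro mult_mono) auto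
    thus "norm (c * cot_\<delta> M * zsum (cot_a M) (cot_b M) ks M - poly 0 (of_real (cot_sum M))) \<le>
        norm c * 8 * K * (log_bound M ^ length ks / real M)" by simp
  qed
qed

lemma sum_list_count_filter:
  fixes f :: "'b \<Rightarrow> 'a::comm_ring_1"
  shows "(\<Sum>x\<leftarrow>xs. f x) = of_nat (count_list xs y) * f y + (\<Sum>x\<leftarrow>filter (\<lambda>x. x \<noteq> y) xs. f x)"
  by (induction xs) (auto simp: algebra_simps)

text \<open>The harmonic regularization is rebuilt for the half sums. Multiplication by
  \<open>[1]\<close> has constant term \<open>-pi i/2\<close>, which represents
  \<open>0 = \<zeta>\<^sup>*(1)\<close>, and the \<open>\<delta>\<close> correction in the stuffle
  relation is negligible.\<close>

lemma cexpands_half: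
  assumes "positive_index ks"
  shows "\<exists>P. cexpands (\<lambda>M. zsum (cot_a M) (cot_b M) ks M) P \<and> represents (coeff P 0) (zeta_star ks)"
  using assms
proof (induction ks rule: leading_ones_induct)
  case (admissible ks)
  let ?P = "[:complex_of_real (zeta_star ks):]"
  have neg: "negl (\<lambda>M. \<bar>trunc ks M - zeta_star ks\<bar>)"
  proof -
    have "negl (\<lambda>M. trunc ks M - zeta_star ks)"
    proof (cases "ks = []")
      case True
      thus ?thesis by (simp add: zeta_star_Nil negl_0)
    next
      case False
      thus ?thesis
        using expands_admissible[OF admissible] zeta_star_admissible[OF admissible] by (simp add: expands_def)
    qed
    hence "(\<lambda>M. \<bar>(trunc ks M - zeta_star ks) * hsum M ^ j\<bar>) \<longlonglongrightarrow> 0" for j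
      unfolding negl_def by (auto intro: tendsto_rabs_zero)
    thus ?thesis by (simp add: negl_def abs_mult)
  qed
  obtain K where K: "\<And>M. norm (zsum (cot_a M) (cot_b M) ks M - of_real (trunc ks M)) \<le> K * (log_bound M ^ length ks / real M)"
    using zsum_half_admissible[OF admissible] by blast
  have "negl (\<lambda>M. K * (log_bound M ^ length ks / real M) + \<bar>trunc ks M - zeta_star ks\<bar>)"
    by (intro negl_add negl_cmult negl_log_bound neg)
  hence "cexpands (\<lambda>M. zsum (cot_a M) (cot_b M) ks M) ?P"
    unfolding cexpands_def
  proof (rule negl_mono)
    fix M
    have "norm (zsum (cot_a M) (cot_b M) ks M - of_real (zeta_star ks)) \<le>
        norm (zsum (cot_a M) (cot_b M) ks M - of_real (trunc ks M)) + norm (complex_of_real (trunc ks M) - of_real (zeta_star ks))"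
      using norm_triangle_ineq[of "zsum (cot_a M) (cot_b M) ks M - of_real (trunc ks M)"
          "complex_of_real (trunc ks M) - of_real (zeta_star ks)"] by simp
    also have "norm (complex_of_real (trunc ks M) - of_real (zeta_star ks)) = \<bar>trunc ks M - zeta_star ks\<bar>"
      by (metis norm_of_real of_real_diff)
    finally show "\<bar>norm (zsum (cot_a M) (cot_b M) ks M - poly ?P (of_real (cot_sum M)))\<bar> \<le>
        K * (log_bound M ^ length ks / real M) + \<bar>trunc ks M - zeta_star ks\<bar>" using K[of M] by simp
  qed
  moreover have "represents (coeff ?P 0) (zeta_star ks)"
    using represents_of_real[OF zeta_star_admissible_in_Z_R[OF admissible]] by simp
  ultimately show ?case by blast
next
  case (step ks)
  let ?Z = "\<lambda>ks M. zsum (cot_a M) (cot_b M) ks M"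
  let ?xs = "filter (\<lambda>ms. ms \<noteq> 1 # ks) (stuffle [1] ks)"
  define c where "c = count_list (stuffle [1] ks) (1 # ks)"
  have c: "c > 0" using count_stuffle_one_pos[of ks] by (simp add: c_def)
  obtain Q where Q: "cexpands (?Z ks) Q" "represents (coeff Q 0) (zeta_star ks)" using step(2) by blast
  have "\<forall>ms\<in>set ?xs. \<exists>P. cexpands (?Z ms) P \<and> represents (coeff P 0) (zeta_star ms)"
  proof
    fix ms assume "ms \<in> set ?xs"
    hence "ms \<in> set (stuffle [1] ks)" "ms \<noteq> 1 # ks" by auto
    thus "\<exists>P. cexpands (?Z ms) P \<and> represents (coeff P 0) (zeta_star ms)" by (rule step(3))
  qed
  from bchoice[OF this] obtain P where P: "\<And>ms. ms \<in> set ?xs \<Longrightarrow> cexpands (?Z ms) (P ms)"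
    "\<And>ms. ms \<in> set ?xs \<Longrightarrow> represents (coeff (P ms) 0) (zeta_star ms)" by blast
  \<comment> \<open>The stuffle relation solved for the sum of \<open>1 # ks\<close>; the last
    summand is the zero expansion of the \<open>\<delta>\<close> correction.\<close>
  let ?R = "smult (1 / of_nat c) ([:Complex 0 (- pi / 2), 1:] * Q + smult (- 1) (\<Sum>ms\<leftarrow>?xs. P ms) + smult (- 1) 0)"
  let ?u = "\<lambda>M. 1 / of_nat c * (?Z [1] M * ?Z ks M + (- 1) * (\<Sum>ms\<leftarrow>?xs. ?Z ms M)
              + (- 1) * (of_nat (length ks) * cot_\<delta> M * ?Z ks M))"
  have "cexpands ?u ?R"
    by (rule cexpands_cmult[OF cexpands_add[OF cexpands_add[OF cexpands_mult[OF cexpands_zsum_one Q(1)]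
          cexpands_cmult[OF cexpands_sum_list[OF P(1)]]] cexpands_cmult[OF cexpands_cot_\<delta>_zsum[OF step(1)]]]])
  moreover have "?u M = ?Z (1 # ks) M" if "M \<ge> 1" for M
  proof -
    interpret addition_weights "cot_a M" "cot_b M" "cot_\<delta> M" "2 * M - 1"
      by (rule addition_weights_cot[OF that])
    have st: "?Z [1] M * ?Z ks M =
        of_nat c * ?Z (1 # ks) M + (\<Sum>ms\<leftarrow>?xs. ?Z ms M) + of_nat (length ks) * cot_\<delta> M * ?Z ks M"
      unfolding c_def sum_list_count_filter[of "\<lambda>ms. ?Z ms M" "stuffle [1] ks" "1 # ks", symmetric]
      by (rule zsum_stuffle_one) (use step(1) that in auto)
    have "1 / of_nat c * (of_nat c * D + S + E + (- 1) * S + (- 1) * E) = D" for D S E :: complex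
      using c by simp
    thus ?thesis unfolding st .
  qed
  ultimately have "cexpands (?Z (1 # ks)) ?R" by (rule cexpands_cong)
  moreover have "represents (coeff ?R 0) (zeta_star (1 # ks))"
  proof -
    have "represents (1 / of_nat c * (Complex 0 (pi * (- (1 / real 2))) * coeff Q 0 + (- 1) * (\<Sum>ms\<leftarrow>?xs. coeff (P ms) 0)))
        (1 / real c * (0 * zeta_star ks + (- 1) * (\<Sum>ms\<leftarrow>?xs. zeta_star ms)))"
      using P(2) by (intro represents_mult represents_add represents_inverse_of_nat represents_pi Z_R_uminus
          inverse_of_nat_in_Z_R represents_minus_one represents_sum_list Q)
    moreover have "coeff (\<Sum>ms\<leftarrow>xs. P ms) 0 = (\<Sum>ms\<leftarrow>xs. coeff (P ms) 0)" for xs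
      by (induction xs) auto
    ultimately show ?thesis
      using harmonic_regularization_step[OF harmonic_regularization_zeta_star step(1)]
      by (simp add: c_def coeff_mult_0 del: stuffle.simps)
  qed
  ultimately show ?case by blast
qed

text \<open>The sum is cut at \<open>M\<close>, between \<open>n < N/2\<close> and
  \<open>n > N/2\<close>. Under \<open>n \<mapsto> N - n\<close> the weights become
  \<open>a (N - n) = - b n\<close> and \<open>b (N - n) = - a n\<close>, so the upper half is a
  signed complex conjugate of a lower half with the index reversed.\<close>

lemma zsum_symmetric:
  assumes "positive_index ks" "M \<ge> 1"
  shows "zsum (cot_a M) (cot_b M) ks (2 * M - 1) = (\<Sum>i\<le>length ks. (- 1) ^ sum_list (take i ks) *
           (cnj (zsum (cot_a M) (cot_b M) (rev (take i ks)) M) * zsum (cot_a M) (cot_b M) (drop i ks) M))"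
proof -
  interpret addition_weights "cot_a M" "cot_b M" "cot_\<delta> M" "2 * M - 1"
    by (rule addition_weights_cot[OF assms(2)])
  let ?N = "2 * M - 1" and ?w = "\<lambda>n k. cot_a M n * cot_b M n ^ (k - 1)"
  \<comment> \<open>With \<open>N = 2M - 1\<close> reflection maps the range from \<open>M\<close>
    to \<open>N - 1\<close> exactly onto the range from 1 to \<open>M - 1\<close>.\<close>
  have N: "1 \<le> M" "M \<le> ?N" "Suc ?N - ?N = 1" "Suc ?N - M = M" using assms(2) by auto
  have refl: "?w (?N - n) k = (- 1) ^ k * cnj (?w n k)" if "1 \<le> n" "n < M" "k \<ge> 1" for n k
  proof -
    have n: "n < ?N" "1 \<le> ?N - n" "?N - n < ?N" using that by auto
    have b: "cot_b M (?N - n) = - cot_a M n" using reflection[OF that(1) n(1)] .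
    have a: "cot_a M (?N - n) = - cot_b M n" using a_eq[OF n(2,3)] a_eq[OF that(1) n(1)] b by simp
    have cb: "cnj (cot_b M n) = cot_a M n" using cnj_cot_a[of M n] by (metis complex_cnj_cnj)
    show ?thesis unfolding a b using that(3) by (cases k) (simp_all add: cnj_cot_a cb power_minus[of "cot_a M n"])
  qed
  have "interval_zsum ?w (take i ks) M ?N = (- 1) ^ sum_list (take i ks) * cnj (zsum (cot_a M) (cot_b M) (rev (take i ks)) M)" for i
  proof -
    have pos: "positive_index (rev (take i ks))"
      using assms(1) by (auto simp: positive_index_def dest: in_set_takeD)
    have "interval_zsum ?w (take i ks) M ?N = interval_zsum (\<lambda>n. ?w (?N - n)) (rev (take i ks)) 1 M"
      using interval_zsum_reflect[OF N(1) order_refl[of ?N], of ?w "take i ks"] unfolding N(3,4) .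
    also have "\<dots> = (- 1) ^ sum_list (rev (take i ks)) * cnj (interval_zsum ?w (rev (take i ks)) 1 M)"
      using refl by (intro interval_zsum_cnj[OF pos]) blast
    finally show ?thesis by (simp add: zsum_eq_interval_zsum)
  qed
  thus ?thesis
    unfolding zsum_eq_interval_zsum[of _ _ ks] interval_zsum_split[OF N(1,2)] by (simp add: zsum_eq_interval_zsum mult.assoc)
qed

lemma cexpands_symmetric:
  assumes "positive_index ks"
  shows "\<exists>P. cexpands (\<lambda>M. zsum (cot_a M) (cot_b M) ks (2 * M - 1)) P \<and> represents (coeff P 0) (zeta_star_S ks)"
proof -
  have pos: "positive_index (rev (take i ks))" "positive_index (drop i ks)" for i
    using assms by (auto simp: positive_index_def dest: in_set_takeD in_set_dropD)
  have "\<forall>i. \<exists>P. cexpands (\<lambda>M. zsum (cot_a M) (cot_b M) (rev (take i ks)) M) P \<and> represents (coeff P 0) (zeta_star (rev (take i ks)))"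
    using cexpands_half[OF pos(1)] by blast
  from choice[OF this] obtain P where P: "\<And>i. cexpands (\<lambda>M. zsum (cot_a M) (cot_b M) (rev (take i ks)) M) (P i)"
    "\<And>i. represents (coeff (P i) 0) (zeta_star (rev (take i ks)))" by blast
  have "\<forall>i. \<exists>P. cexpands (\<lambda>M. zsum (cot_a M) (cot_b M) (drop i ks) M) P \<and> represents (coeff P 0) (zeta_star (drop i ks))"
    using cexpands_half[OF pos(2)] by blast
  from choice[OF this] obtain Q where Q: "\<And>i. cexpands (\<lambda>M. zsum (cot_a M) (cot_b M) (drop i ks) M) (Q i)"
    "\<And>i. represents (coeff (Q i) 0) (zeta_star (drop i ks))" by blast
  let ?R = "\<Sum>i\<le>length ks. smult ((- 1) ^ sum_list (take i ks)) (map_poly cnj (P i) * Q i)"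
  have "cexpands (\<lambda>M. \<Sum>i\<le>length ks. (- 1) ^ sum_list (take i ks) *
           (cnj (zsum (cot_a M) (cot_b M) (rev (take i ks)) M) * zsum (cot_a M) (cot_b M) (drop i ks) M)) ?R"
    by (intro cexpands_sum cexpands_cmult cexpands_mult cexpands_cnj P Q)
  hence "cexpands (\<lambda>M. zsum (cot_a M) (cot_b M) ks (2 * M - 1)) ?R"
    by (rule cexpands_cong) (rule zsum_symmetric[OF assms, symmetric])
  moreover have "represents (coeff ?R 0) (zeta_star_S ks)"
  proof -
    have "represents (\<Sum>i\<le>length ks. (- 1) ^ sum_list (take i ks) * (cnj (coeff (P i) 0) * coeff (Q i) 0))
        (\<Sum>i\<le>length ks. (- 1) ^ sum_list (take i ks) * (zeta_star (rev (take i ks)) * zeta_star (drop i ks)))"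
      by (intro represents_sum represents_mult represents_minus_one_power represents_cnj P Q)
    thus ?thesis by (simp add: coeff_sum coeff_mult_0 coeff_map_poly zeta_star_S_def atMost_atLeast0 mult.assoc)
  qed
  ultimately show ?thesis by blast
qed

text \<open>The product of \<open>cot_\<delta> M\<close> and \<open>N\<close> is exactly
  \<open>-2 pi i\<close>; the rest is \<open>j + 1\<close> times a quantity of order
  \<open>1/M\<close>.\<close>

lemma cexpands_cot_\<delta>: "cexpands (\<lambda>M. cot_\<delta> M * (of_nat (2 * M - 1) - of_nat (Suc j))) [:Complex 0 (- (2 * pi)):]"
proof (rule cexpands_approx[of _ _ "real (Suc j) * 8" 0])
  fix M :: nat assume M: "M \<ge> 1"
  have N: "complex_of_nat (2 * M - 1) = of_real (2 * real M - 1)" using M by (simp add: of_nat_diff)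
  have "cot_\<delta> M * of_nat (2 * M - 1) = Complex 0 (- (2 * pi))"
    unfolding N cot_\<delta>_def using M by (simp add: complex_eq_iff)
  hence "cot_\<delta> M * (of_nat (2 * M - 1) - of_nat (Suc j)) - Complex 0 (- (2 * pi)) = - (of_nat (Suc j) * cot_\<delta> M)"
    by (simp add: right_diff_distrib del: of_nat_Suc)
  hence "norm (cot_\<delta> M * (of_nat (2 * M - 1) - of_nat (Suc j)) - Complex 0 (- (2 * pi))) = real (Suc j) * norm (cot_\<delta> M)"
    by (simp only: norm_minus_cancel norm_mult norm_of_nat)
  also have "\<dots> \<le> real (Suc j) * (8 / real M)" using norm_cot_\<delta>[OF M] by (rule mult_left_mono) simp
  finally show "norm (cot_\<delta> M * (of_nat (2 * M - 1) - of_nat (Suc j))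
      - poly [:Complex 0 (- (2 * pi)):] (of_real (cot_sum M))) \<le> real (Suc j) * 8 * (log_bound M ^ 0 / real M)"
    by simp
qed

section \<open>The defect series in the limit\<close>

definition defect_coeff :: "nat \<Rightarrow> nat \<Rightarrow> complex" where
  "defect_coeff j M = fps_nth (addition_weights.defect_series (cot_a M) (2 * M - 1)) j"

text \<open>In the limit the recursion multiplies by \<open>-2 pi i/(j + 2)\<close>, which
  represents 0, so only the coefficient of degree 0 survives modulo \<open>pi i\<close>.\<close>

lemma cexpands_defect_coeff: "\<exists>P. cexpands (defect_coeff j) P \<and> represents (coeff P 0) (if j = 0 then 1 else 0)"
proof (induction j)
  case 0
  have "cexpands (defect_coeff 0) [:1:]"
  proof (rule cexpands_cong[OF cexpands_const])
    fix M :: nat assume "M \<ge> 1"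
    then interpret addition_weights "cot_a M" "cot_b M" "cot_\<delta> M" "2 * M - 1" by (rule addition_weights_cot)
    show "1 = defect_coeff 0 M" unfolding defect_coeff_def by (rule defect_series_nth_0[symmetric])
  qed
  thus ?case using represents_of_real[OF Z_R_1] by auto
next
  case (Suc j)
  then obtain P where P: "cexpands (defect_coeff j) P" "represents (coeff P 0) (if j = 0 then 1 else 0)" by blast
  have "cexpands (\<lambda>M. 1 / of_nat (j + 2) * (cot_\<delta> M * (of_nat (2 * M - 1) - of_nat (Suc j)) * defect_coeff j M))
      (smult (1 / of_nat (j + 2)) ([:Complex 0 (- (2 * pi)):] * P))"
    by (intro cexpands_cmult cexpands_mult cexpands_cot_\<delta> P)
  hence "cexpands (defect_coeff (Suc j)) (smult (1 / of_nat (j + 2)) ([:Complex 0 (- (2 * pi)):] * P))"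
  proof (rule cexpands_cong)
    fix M :: nat assume "M \<ge> 1"
    then interpret addition_weights "cot_a M" "cot_b M" "cot_\<delta> M" "2 * M - 1" by (rule addition_weights_cot)
    have nz: "complex_of_nat (j + 2) \<noteq> 0" by (metis add_2_eq_Suc' of_nat_neq_0)
    have "complex_of_nat (j + 2) * defect_coeff (Suc j) M = cot_\<delta> M * (of_nat (2 * M - 1) - of_nat (Suc j)) * defect_coeff j M"
      unfolding defect_coeff_def by (rule defect_series_nth_rec)
    thus "1 / of_nat (j + 2) * (cot_\<delta> M * (of_nat (2 * M - 1) - of_nat (Suc j)) * defect_coeff j M) = defect_coeff (Suc j) M"
      using nz by (metis nonzero_mult_div_cancel_left times_divide_eq_left mult_1)
  qed
  moreover have "represents (1 / of_nat (j + 2) * (Complex 0 (pi * (- (1 + 1))) * coeff P 0))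
      (1 / real (j + 2) * (0 * (if j = 0 then 1 else 0)))"
    by (intro represents_mult represents_inverse_of_nat represents_pi Z_R_uminus Z_R_add Z_R_1 P)
  hence "represents (coeff (smult (1 / of_nat (j + 2)) ([:Complex 0 (- (2 * pi)):] * P)) 0) 0"
    by (simp add: coeff_mult_0 mult.commute[of pi] del: of_nat_add)
  ultimately show ?case by auto
qed

section \<open>Comparison of constant coefficients\<close>

lemma cexpands_comp_sum:
  assumes "\<And>as. positive_index as \<Longrightarrow> cexpands (\<lambda>M. F M as) (P as)"
  shows "cexpands (\<lambda>M. comp_sum (F M) ks t) (comp_sum P ks t)"
  unfolding comp_sum_def by (intro cexpands_sum assms positive_index_concat_listset)

lemma cexpands_ones_sum:
  assumes "positive_index ks" "\<And>as. positive_index as \<Longrightarrow> cexpands (\<lambda>M. F M as) (P as)"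
  shows "cexpands (\<lambda>M. ones_sum (F M) ks t) (ones_sum P ks t)"
  unfolding ones_sum_def ext_sum_def
  by (intro cexpands_sum assms positive_index_map2_add positive_index_interleave_ones)
     (auto simp: weak_comps_def)

text \<open>The identity between nested sums holds for every \<open>M \<ge> 1\<close>, hence between
  their expansions. In the constant coefficients the defect series represents 1, and both sides of
  the claim are represented by the same complex number.\<close>

lemma S_rel_comp_sum:
  assumes "k \<ge> 1" "positive_index ks"
  shows "S_rel (comp_sum zeta_star_S (k # ks) t)
           (\<Sum>j\<le>t. ones_sum (\<lambda>as. zeta_star_S ((k + j) # as)) ks (t - j))"
proof -
  let ?Z = "\<lambda>M as. zsum (cot_a M) (cot_b M) as (2 * M - 1)"
  have "\<forall>as. \<exists>P. positive_index as \<longrightarrow> cexpands (\<lambda>M. ?Z M as) P \<and> represents (coeff P 0) (zeta_star_S as)"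
    using cexpands_symmetric by blast
  from choice[OF this] obtain P where P: "\<And>as. positive_index as \<Longrightarrow> cexpands (\<lambda>M. ?Z M as) (P as)"
    "\<And>as. positive_index as \<Longrightarrow> represents (coeff (P as) 0) (zeta_star_S as)" by blast
  have "\<forall>j. \<exists>P. cexpands (defect_coeff j) P \<and> represents (coeff P 0) (if j = 0 then 1 else 0)"
    using cexpands_defect_coeff by blast
  from choice[OF this] obtain C where C: "\<And>j. cexpands (defect_coeff j) (C j)" "\<And>j. represents (coeff (C j) 0) (if j = 0 then 1 else 0)"
    by blast
  let ?rhs = "\<lambda>F s. \<Sum>j\<le>s. ones_sum (\<lambda>as. F ((k + j) # as)) ks (s - j)"
  have L: "cexpands (\<lambda>M. comp_sum (?Z M) (k # ks) t) (comp_sum P (k # ks) t)"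
    by (intro cexpands_comp_sum P)
  have R: "cexpands (\<lambda>M. \<Sum>j\<le>s. ones_sum (\<lambda>as. ?Z M ((k + j) # as)) ks (s - j)) (?rhs P s)" for s
    using assms by (intro cexpands_sum cexpands_ones_sum P) auto
  have "cexpands (\<lambda>M. \<Sum>i\<in>{0..t}. defect_coeff i M * (\<Sum>j\<le>t - i. ones_sum (\<lambda>as. ?Z M ((k + j) # as)) ks (t - i - j)))
      (\<Sum>i\<in>{0..t}. C i * ?rhs P (t - i))"
    by (intro cexpands_sum cexpands_mult C R)
  hence "cexpands (\<lambda>M. comp_sum (?Z M) (k # ks) t) (\<Sum>i\<in>{0..t}. C i * ?rhs P (t - i))"
  proof (rule cexpands_cong)
    fix M :: nat assume "M \<ge> 1"
    then interpret addition_weights "cot_a M" "cot_b M" "cot_\<delta> M" "2 * M - 1" by (rule addition_weights_cot)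
    have "fps_nth (comp_series (cot_a M) (cot_b M) (k # ks) (2 * M - 1)) t =
        (\<Sum>i\<in>{0..t}. defect_coeff i M * fps_nth (insert_ones_series (cot_a M) (cot_b M) k ks (2 * M - 1)) (t - i))"
      unfolding comp_series_eq_insert_ones_series[OF assms] defect_coeff_def by (rule fps_mult_nth)
    thus "(\<Sum>i\<in>{0..t}. defect_coeff i M * (\<Sum>j\<le>t - i. ones_sum (\<lambda>as. ?Z M ((k + j) # as)) ks (t - i - j))) =
        comp_sum (?Z M) (k # ks) t"
      by (simp only: comp_series_def insert_ones_series_def fps_nth_Abs_fps)
  qed
  hence eq: "comp_sum P (k # ks) t = (\<Sum>i\<in>{0..t}. C i * ?rhs P (t - i))"
    by (rule cexpands_unique[OF L])
  let ?rep = "\<lambda>Q. represents (coeff Q 0)"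
  have rep0: "?rep 0 0" and repadd: "\<And>x y x' y'. ?rep x x' \<Longrightarrow> ?rep y y' \<Longrightarrow> ?rep (x + y) (x' + y')"
    by (simp_all add: represents_0 represents_add)
  have "?rep (comp_sum P (k # ks) t) (comp_sum zeta_star_S (k # ks) t)"
    by (rule comp_sum_related[where P = ?rep]) (use rep0 repadd P in auto)
  moreover have rhs: "?rep (?rhs P s) (?rhs zeta_star_S s)" for s
  proof (rule sum_related[where P = ?rep])
    fix j
    show "?rep (ones_sum (\<lambda>as. P ((k + j) # as)) ks (s - j)) (ones_sum (\<lambda>as. zeta_star_S ((k + j) # as)) ks (s - j))"
      by (rule ones_sum_related[where P = ?rep]) (use rep0 repadd P assms in auto)
  qed (use rep0 repadd in auto)
  have "?rep (\<Sum>i\<in>{0..t}. C i * ?rhs P (t - i)) (\<Sum>i\<in>{0..t}. (if i = 0 then 1 else 0) * ?rhs zeta_star_S (t - i))"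
  proof (rule sum_related[where P = ?rep])
    fix i
    show "?rep (C i * ?rhs P (t - i)) ((if i = 0 then 1 else 0) * ?rhs zeta_star_S (t - i))"
      unfolding coeff_mult_0 by (intro represents_mult C rhs)
  qed (use rep0 repadd in auto)
  moreover have "(\<Sum>i\<in>{0..t}. (if i = 0 then 1 else 0) * ?rhs zeta_star_S (t - i)) =
      (\<Sum>i\<in>{0..t}. if i = 0 then ?rhs zeta_star_S t else 0)"
    by (intro sum.cong refl) auto
  ultimately show ?thesis unfolding eq by (intro represents_unique) (assumption, simp)
qed

lemma zeta_S_comp_sum:
  assumes "k \<ge> 1" "positive_index ks"
  shows "comp_sum zeta_S (k # ks) t = (\<Sum>j\<le>t. ones_sum (\<lambda>as. zeta_S ((k + j) # as)) ks (t - j))"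
proof -
  \<comment> \<open>Membership in \<open>Z_R\<close> is carried along because \<open>S_rel\<close>
    is reflexive only there, and \<open>abs_calS\<close> is shown to be additive on that
    domain.\<close>
  let ?P = "\<lambda>x y. y \<in> Z_R \<and> x = abs_calS y"
  have P0: "?P 0 0" by (simp add: zero_calS_def)
  have Padd: "?P (x + y) (x' + y')" if "?P x x'" "?P y y'" for x y x' y'
    using that by (auto simp: plus_calS.abs_eq S_rel_refl intro: Z_R_add)
  have z: "?P (zeta_S as) (zeta_star_S as)" if "positive_index as" for as
    using zeta_star_S_in_Z_R[OF that] by (simp add: zeta_S_def)
  have "?P (comp_sum zeta_S (k # ks) t) (comp_sum zeta_star_S (k # ks) t)"
    by (rule comp_sum_related[where P = ?P, OF P0 Padd z])
  moreover have "?P (\<Sum>j\<le>t. ones_sum (\<lambda>as. zeta_S ((k + j) # as)) ks (t - j))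
      (\<Sum>j\<le>t. ones_sum (\<lambda>as. zeta_star_S ((k + j) # as)) ks (t - j))"
    by (rule sum_related[where P = ?P, OF P0 Padd], assumption+,
        rule ones_sum_related[where P = ?P, OF P0 Padd assms(2)], assumption+, rule z)
       (use assms in auto)
  moreover have "abs_calS (comp_sum zeta_star_S (k # ks) t) =
      abs_calS (\<Sum>j\<le>t. ones_sum (\<lambda>as. zeta_star_S ((k + j) # as)) ks (t - j))"
    using Quotient_rel_abs[OF Quotient_calS S_rel_comp_sum[OF assms]] .
  ultimately show ?thesis by simp
qed

theorem theorem1p6:
  fixes r t :: nat and ks :: "nat list"
  assumes "r \<ge> 1" and "length ks = r" and "\<forall>k\<in>set ks. k \<ge> 1"
  shows
    "(\<Sum>ms\<in>comps r (r + t).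
        \<Sum>as\<in>listset (map2 (\<lambda>k m. comps m (k + m - 1)) ks ms). zeta_A (concat as)) =
     (\<Sum>l=0..t. \<Sum>ms\<in>weak_comps (r - 1) (t - l).
        \<Sum>es\<in>weak_comps (length (insert_ones ks ms)) l. zeta_A (map2 (+) (insert_ones ks ms) es)) \<and>
     (\<Sum>ms\<in>comps r (r + t).
        \<Sum>as\<in>listset (map2 (\<lambda>k m. comps m (k + m - 1)) ks ms). zeta_S (concat as)) =
     (\<Sum>l=0..t. \<Sum>ms\<in>weak_comps (r - 1) (t - l).
        \<Sum>es\<in>weak_comps (length (insert_ones ks ms)) l. zeta_S (map2 (+) (insert_ones ks ms) es))"
proof -
  obtain k ks' where ks: "ks = k # ks'" using assms by (cases ks) auto
  have r: "r = length (k # ks')" "r - 1 = length ks'" using assms(2) ks by auto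
  have k: "k \<ge> 1" "positive_index ks'" using assms(3) ks by (auto simp: positive_index_def)
  show ?thesis
    \<comment> \<open>Rewriting \<open>r - 1\<close> before \<open>r\<close> gives the right-hand
      side the shape of \<open>insert_ones_sum\<close>.\<close>
    unfolding r(2) ks insert_ones_sum unfolding r(1) comp_sum_def[symmetric]
    using zeta_A_comp_sum[OF k] zeta_S_comp_sum[OF k] by blast
qed

end
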